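(* Let $\gamma\le 0$ be a real number, let $B,L>0$ be arbitrary, $D=(0,L)\times(0,B)\subset\mathbb{R}^2$, and $a=\frac{\pi^2}{B^2}+\frac{\pi^2}{L^2}$. Let $u_0:D\to\mathbb{R}$ satisfy $$u_0\in H^4(D),\qquad \partial_x^5u_0\in L^2(D),$$ $$u_0(0,y)=u_{0x}(0,y)=u_0(L,y)=u_{0x}(L,y)=u_{0xx}(L,y)=0,$$ $$u_0(x,0)=u_0(x,B)=u_{0yy}(x,0)=u_{0yy}(x,B)=0,$$ $$J_w=\int_D\big[|\Delta^2u_0|^2+|\Delta u_0|^2+u_0^2u_{0x}^2+|\partial_x^5u_0|^2\big]\,dx\,dy<\infty.$$ Then every global (regular) solution $u$ of the problem $$u_t+\Delta^2u+\gamma\Delta u+\Delta u_x+uu_x-\partial_x^5u=0\quad\text{in }D\times(0,\infty),$$ $$u|_{\partial D}=0,\quad u_{yy}(x,0,t)=u_{yy}(x,B,t)=0,\quad u_x(0,y,t)=u_x(L,y,t)=u_{xx}(L,y,t)=0,$$ $$u(x,y,0)=u_0(x,y),\quad (x,y)\in D,$$ satisfies, for all $t\ge 0$, $$\|u\|^2(t)\le\|u_0\|^2e^{-\chi t},\qquad \chi=2\Big\{\frac{|\gamma|}{a}+1\Big\}a^2.$$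
   Context: Functions are real valued, $\Delta=\partial_x^2+\partial_y^2$, subscripts denote partial derivatives, $H^k(D)$ is the usual $L^2$-based Sobolev space, and $\|u\|(t)=\|u(\cdot,\cdot,t)\|_{L^2(D)}$. A global regular solution is a function such that for every $T>0$: $u\in L^\infty(0,T;H^2(D))\cap L^2(0,T;H^4(D))$, $\partial_x^5u\in L^2(0,T;L^2(D))$, $u_t\in L^\infty(0,T;L^2(D))\cap L^2(0,T;H^2(D))$, the equation holds a.e. in $D\times(0,T)$, the boundary conditions hold in the sense of traces for a.e. $t$, and the initial condition holds in $L^2(D)$. *)

theory Defs
  imports "HOL-Analysis.Analysis"
begin

section \<open>Iterated partial derivatives and test functions\<close>

definition partial_deriv :: "'a::euclidean_space \<Rightarrow> ('a \<Rightarrow> real) \<Rightarrow> 'a \<Rightarrow> real" where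
  "partial_deriv b \<phi> x = frechet_derivative \<phi> (at x) b"

text \<open>A multi-index is given as the list of the directions (basis vectors) of differentiation;
  its order is the length of the list.\<close>

definition partial_derivs :: "'a::euclidean_space list \<Rightarrow> ('a \<Rightarrow> real) \<Rightarrow> 'a \<Rightarrow> real" where
  "partial_derivs bs \<phi> = foldr partial_deriv bs \<phi>"

primrec C_k :: "nat \<Rightarrow> ('a::euclidean_space \<Rightarrow> real) \<Rightarrow> bool" where
  "C_k 0 \<phi> \<longleftrightarrow> continuous_on UNIV \<phi>"
| "C_k (Suc k) \<phi> \<longleftrightarrow> \<phi> differentiable_on UNIV \<and> (\<forall>b\<in>Basis. C_k k (partial_deriv b \<phi>))"

definition smooth :: "('a::euclidean_space \<Rightarrow> real) \<Rightarrow> bool" where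
  "smooth \<phi> \<longleftrightarrow> (\<forall>k. C_k k \<phi>)"

definition test_function :: "'a::euclidean_space set \<Rightarrow> ('a \<Rightarrow> real) \<Rightarrow> bool" where
  "test_function \<Omega> \<phi> \<longleftrightarrow> smooth \<phi> \<and> (\<exists>K. compact K \<and> K \<subseteq> \<Omega> \<and> (\<forall>x. x \<notin> K \<longrightarrow> \<phi> x = 0))"


section \<open>Lebesgue and Sobolev spaces\<close>

text \<open>Elements of Lebesgue and Sobolev spaces are represented by functions that are Borel
  measurable on the domain (every class contains one); values outside the domain are irrelevant.\<close>

definition L2 :: "'a::euclidean_space set \<Rightarrow> ('a \<Rightarrow> real) \<Rightarrow> bool" where
  "L2 \<Omega> f \<longleftrightarrow> set_borel_measurable lborel \<Omega> f \<and> set_integrable lborel \<Omega> (\<lambda>z. (f z)\<^sup>2)"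

definition L2_norm :: "'a::euclidean_space set \<Rightarrow> ('a \<Rightarrow> real) \<Rightarrow> real" where
  "L2_norm \<Omega> f = sqrt (LINT z:\<Omega>|lborel. (f z)\<^sup>2)"

definition locally_integrable :: "'a::euclidean_space set \<Rightarrow> ('a \<Rightarrow> real) \<Rightarrow> bool" where
  "locally_integrable \<Omega> f \<longleftrightarrow> (\<forall>K. compact K \<and> K \<subseteq> \<Omega> \<longrightarrow> set_integrable lborel K f)"

definition has_weak_deriv ::
    "'a::euclidean_space set \<Rightarrow> 'a list \<Rightarrow> ('a \<Rightarrow> real) \<Rightarrow> ('a \<Rightarrow> real) \<Rightarrow> bool" where
  "has_weak_deriv \<Omega> bs f g \<longleftrightarrow>
     locally_integrable \<Omega> f \<and> locally_integrable \<Omega> g \<and>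
     (\<forall>\<phi>. test_function \<Omega> \<phi> \<longrightarrow>
        (LINT z:\<Omega>|lborel. f z * partial_derivs bs \<phi> z)
          = (- 1) ^ length bs * (LINT z:\<Omega>|lborel. g z * \<phi> z))"

text \<open>Well defined up to a null set, if the weak derivative exists.\<close>

definition weak_deriv :: "'a::euclidean_space set \<Rightarrow> 'a list \<Rightarrow> ('a \<Rightarrow> real) \<Rightarrow> 'a \<Rightarrow> real" where
  "weak_deriv \<Omega> bs f = (SOME g. has_weak_deriv \<Omega> bs f g)"

definition multi_indices :: "nat \<Rightarrow> 'a::euclidean_space list set" where
  "multi_indices k = {bs. set bs \<subseteq> Basis \<and> length bs \<le> k}"

definition sobolev :: "nat \<Rightarrow> 'a::euclidean_space set \<Rightarrow> ('a \<Rightarrow> real) \<Rightarrow> bool" where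
  "sobolev k \<Omega> f \<longleftrightarrow> (\<forall>bs \<in> multi_indices k. \<exists>g. has_weak_deriv \<Omega> bs f g \<and> L2 \<Omega> g)"

text \<open>\<open>dxy i j\<close> stands for \<open>\<partial>\<^sub>x\<^sup>i \<partial>\<^sub>y\<^sup>j\<close>.\<close>

definition dxy :: "nat \<Rightarrow> nat \<Rightarrow> (real \<times> real) list" where
  "dxy i j = replicate i (1, 0) @ replicate j (0, 1)"


section \<open>Traces\<close>

text \<open>\<open>g\<close> is the trace of the \<open>H\<^sup>1\<close> function \<open>f\<close> on a straight boundary edge, parametrized by arc
  length through \<open>e\<close> on \<open>I\<close>. The trace operator is the continuous extension to \<open>H\<^sup>1(\<Omega>)\<close> of the
  restriction \<open>\<phi> \<mapsto> \<phi> \<circ> e \<in> L\<^sup>2(I)\<close> of functions \<open>\<phi>\<close> that are smooth up to the boundary.\<close>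

definition has_trace :: "(real \<times> real) set \<Rightarrow> (real \<Rightarrow> real \<times> real) \<Rightarrow> real set \<Rightarrow>
    (real \<times> real \<Rightarrow> real) \<Rightarrow> (real \<Rightarrow> real) \<Rightarrow> bool" where
  "has_trace \<Omega> e I f g \<longleftrightarrow> sobolev 1 \<Omega> f \<and> L2 I g \<and>
     (\<exists>\<phi>. (\<forall>n. smooth (\<phi> n)) \<and>
        (\<forall>bs \<in> multi_indices 1.
           (\<lambda>n. L2_norm \<Omega> (\<lambda>z. partial_derivs bs (\<phi> n) z - weak_deriv \<Omega> bs f z)) \<longlonglongrightarrow> 0) \<and>
        (\<lambda>n. L2_norm I (\<lambda>s. \<phi> n (e s) - g s)) \<longlonglongrightarrow> 0)"

definition rect :: "real \<Rightarrow> real \<Rightarrow> (real \<times> real) set" where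
  "rect L B = {0<..<L} \<times> {0<..<B}"

definition vanishes_on_x :: "real \<Rightarrow> real \<Rightarrow> real \<Rightarrow> (real \<times> real \<Rightarrow> real) \<Rightarrow> bool" where
  "vanishes_on_x L B c f \<longleftrightarrow> has_trace (rect L B) (\<lambda>y. (c, y)) {0<..<B} f (\<lambda>_. 0)"

definition vanishes_on_y :: "real \<Rightarrow> real \<Rightarrow> real \<Rightarrow> (real \<times> real \<Rightarrow> real) \<Rightarrow> bool" where
  "vanishes_on_y L B c f \<longleftrightarrow> has_trace (rect L B) (\<lambda>x. (x, c)) {0<..<L} f (\<lambda>_. 0)"

definition boundary_conditions :: "real \<Rightarrow> real \<Rightarrow> (real \<times> real \<Rightarrow> real) \<Rightarrow> bool" where
  "boundary_conditions L B f \<longleftrightarrow>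
     (let d = (\<lambda>i j. weak_deriv (rect L B) (dxy i j) f) in
       vanishes_on_x L B 0 f \<and> vanishes_on_x L B L f \<and>
       vanishes_on_y L B 0 f \<and> vanishes_on_y L B B f \<and>
       vanishes_on_y L B 0 (d 0 2) \<and> vanishes_on_y L B B (d 0 2) \<and>
       vanishes_on_x L B 0 (d 1 0) \<and> vanishes_on_x L B L (d 1 0) \<and>
       vanishes_on_x L B L (d 2 0))"


section \<open>Functions of time with values in Sobolev spaces\<close>

text \<open>A map \<open>t \<mapsto> u t\<close> with \<open>u t \<in> H\<^sup>k\<close> for almost every \<open>t\<close> is strongly measurable iff all its
  spatial derivatives of order at most \<open>k\<close> are strongly measurable into \<open>L\<^sup>2\<close>, that is, are given
  by jointly measurable functions of \<open>(t, z)\<close>. Below, \<open>v\<close> is such a jointly measurable version of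
  a spatial derivative of \<open>u\<close> on \<open>(0,T) \<times> \<Omega>\<close>.\<close>

definition has_spatial_deriv :: "real \<Rightarrow> 'a::euclidean_space set \<Rightarrow> 'a list \<Rightarrow>
    (real \<Rightarrow> 'a \<Rightarrow> real) \<Rightarrow> (real \<Rightarrow> 'a \<Rightarrow> real) \<Rightarrow> bool" where
  "has_spatial_deriv T \<Omega> bs u v \<longleftrightarrow>
     set_borel_measurable lborel ({0<..<T} \<times> \<Omega>) (\<lambda>(t, z). v t z) \<and>
     (AE t in lborel. t \<in> {0<..<T} \<longrightarrow> has_weak_deriv \<Omega> bs (u t) (v t))"

definition spatial_deriv :: "real \<Rightarrow> 'a::euclidean_space set \<Rightarrow> 'a list \<Rightarrow>
    (real \<Rightarrow> 'a \<Rightarrow> real) \<Rightarrow> real \<Rightarrow> 'a \<Rightarrow> real" where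
  "spatial_deriv T \<Omega> bs u = (SOME v. has_spatial_deriv T \<Omega> bs u v)"

definition L2_spacetime ::
    "real \<Rightarrow> 'a::euclidean_space set \<Rightarrow> (real \<Rightarrow> 'a \<Rightarrow> real) \<Rightarrow> bool" where
  "L2_spacetime T \<Omega> v \<longleftrightarrow> L2 ({0<..<T} \<times> \<Omega>) (\<lambda>(t, z). v t z)"

text \<open>\<open>u \<in> L\<^sup>2(0,T;H\<^sup>k(\<Omega>))\<close>; by Tonelli the squared norm of each derivative in \<open>L\<^sup>2(0,T;L\<^sup>2(\<Omega>))\<close>
  is its squared norm in \<open>L\<^sup>2((0,T) \<times> \<Omega>)\<close>.\<close>

definition L2_sobolev ::
    "nat \<Rightarrow> real \<Rightarrow> 'a::euclidean_space set \<Rightarrow> (real \<Rightarrow> 'a \<Rightarrow> real) \<Rightarrow> bool" where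
  "L2_sobolev k T \<Omega> u \<longleftrightarrow>
     (\<forall>bs \<in> multi_indices k. \<exists>v. has_spatial_deriv T \<Omega> bs u v \<and> L2_spacetime T \<Omega> v)"

text \<open>\<open>u \<in> L\<^sup>\<infinity>(0,T;H\<^sup>k(\<Omega>))\<close>\<close>

definition Linf_sobolev ::
    "nat \<Rightarrow> real \<Rightarrow> 'a::euclidean_space set \<Rightarrow> (real \<Rightarrow> 'a \<Rightarrow> real) \<Rightarrow> bool" where
  "Linf_sobolev k T \<Omega> u \<longleftrightarrow>
     (\<forall>bs \<in> multi_indices k. \<exists>v. has_spatial_deriv T \<Omega> bs u v \<and>
        (\<exists>C. AE t in lborel. t \<in> {0<..<T} \<longrightarrow> L2 \<Omega> (v t) \<and> L2_norm \<Omega> (v t) \<le> C))"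

definition has_time_deriv :: "real \<Rightarrow> 'a::euclidean_space set \<Rightarrow>
    (real \<Rightarrow> 'a \<Rightarrow> real) \<Rightarrow> (real \<Rightarrow> 'a \<Rightarrow> real) \<Rightarrow> bool" where
  "has_time_deriv T \<Omega> u w \<longleftrightarrow>
     has_weak_deriv ({0<..<T} \<times> \<Omega>) [(1, 0)] (\<lambda>(t, z). u t z) (\<lambda>(t, z). w t z)"

definition time_deriv :: "real \<Rightarrow> 'a::euclidean_space set \<Rightarrow>
    (real \<Rightarrow> 'a \<Rightarrow> real) \<Rightarrow> real \<Rightarrow> 'a \<Rightarrow> real" where
  "time_deriv T \<Omega> u = (SOME w. has_time_deriv T \<Omega> u w)"


section \<open>The initial-boundary value problem\<close>

definition equation_ae ::
    "real \<Rightarrow> real \<Rightarrow> (real \<times> real) set \<Rightarrow> (real \<Rightarrow> real \<times> real \<Rightarrow> real) \<Rightarrow> bool" where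
  "equation_ae \<gamma> T \<Omega> u \<longleftrightarrow>
     (let d = (\<lambda>i j. spatial_deriv T \<Omega> (dxy i j) u) in
       AE (t, z) in lborel. (t, z) \<in> {0<..<T} \<times> \<Omega> \<longrightarrow>
         time_deriv T \<Omega> u t z
         + (d 4 0 t z + 2 * d 2 2 t z + d 0 4 t z)
         + \<gamma> * (d 2 0 t z + d 0 2 t z)
         + (d 3 0 t z + d 1 2 t z)
         + u t z * d 1 0 t z
         - d 5 0 t z = 0)"

text \<open>Since \<open>u, u\<^sub>t \<in> L\<^sup>\<infinity>(0,T;L\<^sup>2)\<close>, the class of \<open>u\<close> has exactly one representative that is continuous
  in time with values in \<open>L\<^sup>2\<close>. As usual, \<open>u\<close> denotes this representative, which gives a meaning to
  the initial condition and to \<open>\<parallel>u\<parallel>(t)\<close> for every \<open>t \<ge> 0\<close>.\<close>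

definition global_regular_solution :: "real \<Rightarrow> real \<Rightarrow> real \<Rightarrow> (real \<times> real \<Rightarrow> real) \<Rightarrow>
    (real \<Rightarrow> real \<times> real \<Rightarrow> real) \<Rightarrow> bool" where
  "global_regular_solution \<gamma> L B u0 u \<longleftrightarrow>
     (let D = rect L B in
       (\<forall>t\<ge>0. L2 D (u t) \<and>
          ((\<lambda>s. L2_norm D (\<lambda>z. u s z - u t z)) \<longlongrightarrow> 0) (at t within {0..})) \<and>
       (\<forall>T>0.
          Linf_sobolev 2 T D u \<and> L2_sobolev 4 T D u \<and>
          (\<exists>v. has_spatial_deriv T D (dxy 5 0) u v \<and> L2_spacetime T D v) \<and>
          (\<exists>w. has_time_deriv T D u w) \<and>
          Linf_sobolev 0 T D (time_deriv T D u) \<and> L2_sobolev 2 T D (time_deriv T D u) \<and>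
          equation_ae \<gamma> T D u) \<and>
       (AE t in lborel. t > 0 \<longrightarrow> boundary_conditions L B (u t)) \<and>
       (AE z in lborel. z \<in> D \<longrightarrow> u 0 z = u0 z))"

definition J_w :: "real \<Rightarrow> real \<Rightarrow> (real \<times> real \<Rightarrow> real) \<Rightarrow> ennreal" where
  "J_w L B u0 =
     (let D = rect L B; d = (\<lambda>i j. weak_deriv D (dxy i j) u0) in
       \<integral>\<^sup>+z\<in>D. ennreal (
          (d 4 0 z + 2 * d 2 2 z + d 0 4 z)\<^sup>2
          + (d 2 0 z + d 0 2 z)\<^sup>2
          + (u0 z)\<^sup>2 * (d 1 0 z)\<^sup>2
          + (d 5 0 z)\<^sup>2) \<partial>lborel)"

end

theory Submission
  imports Defs "HOL-Real_Asymp.Real_Asymp"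
begin

text \<open>Testing the equation with \<open>u\<close> gives
  \<open>1/2 (d/dt) \<parallel>u\<parallel>\<^sup>2 + \<parallel>u\<^sub>x\<^sub>x\<parallel>\<^sup>2 + 2 \<parallel>u\<^sub>x\<^sub>y\<parallel>\<^sup>2 + \<parallel>u\<^sub>y\<^sub>y\<parallel>\<^sup>2
    + \<bar>\<gamma>\<bar> (\<parallel>u\<^sub>x\<parallel>\<^sup>2 + \<parallel>u\<^sub>y\<parallel>\<^sup>2) \<le> 0\<close>:
  the terms \<open>\<Delta>u\<^sub>x\<close> and \<open>u u\<^sub>x\<close> contribute nothing, and the term with five \<open>x\<close>-derivatives
  contributes \<open>1/2 \<integral> u\<^sub>x\<^sub>x(0, y)\<^sup>2 dy\<close> on the favourable side. Wirtinger's inequality in both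
  variables bounds the dissipation from below by \<open>(a\<^sup>2 + \<bar>\<gamma>\<bar> a) \<parallel>u\<parallel>\<^sup>2\<close>, and Gronwall's
  argument concludes.

  All integrations by parts are one-dimensional: a function with a weak partial derivative is absolutely
  continuous on almost every line in that direction, and a vanishing trace means that this continuous
  representative vanishes at the end point of almost every line. In this way no density theorem, no trace
  theory and no Sobolev embedding is needed; in particular \<open>u\<^sup>2 u\<^sub>x\<close> is integrable because the
  equation expresses it by products of square integrable functions.\<close>

section \<open>Smooth functions and bump functions\<close>

text \<open>With \<open>k = (pi / L)\<^sup>2\<close>, \<open>l = (pi / B)\<^sup>2\<close> and a = k
  + l, the square a^2 in the rate is assembled term by term: the squared norms of u_xx, u_xy and
  u_yy are at least k^2, k l and l^2 times that of u, and the mixed norm enters twice. Two of these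
  bounds meet an obstacle at the boundary. For u_xy one needs u_y = 0 at both ends of the x-lines,
  which is not among the boundary conditions and has to be derived from u = 0 there. For u_yy
  Wirtinger's inequality cannot be iterated, since u_y is not prescribed at y = 0 and y = B; the
  identity between the squared norm of u_y and the integral of - u u_yy takes its place.

  A second obstacle is the meaning of the derivatives. \<open>weak_deriv\<close>,
  \<open>spatial_deriv\<close> and \<open>time_deriv\<close> are arbitrary choices, fixed only up to
  null sets, and made separately for single times and for space-time. Almost everywhere uniqueness
  has to reconcile them before the equation can be tested at a single time. Finally, the energy is
  identified with an absolutely continuous function only for almost every t, whereas the claim
  concerns every t; continuity in time with values in L2 closes this gap.\<close>

lemma partial_deriv_eq:
  assumes "(\<phi> has_derivative \<phi>') (at x)"
  shows "partial_deriv b \<phi> x = \<phi>' b"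
  using frechet_derivative_at[OF assms] by (simp add: partial_deriv_def)

lemma C_k_imp_differentiable:
  assumes "C_k (Suc k) \<phi>"
  shows "(\<phi> has_derivative frechet_derivative \<phi> (at x)) (at x)"
  using assms frechet_derivative_works[of \<phi> "at x"]
  by (auto simp: differentiable_on_eq_differentiable_at)

lemma C_k_imp_continuous: "C_k k \<phi> \<Longrightarrow> continuous_on UNIV \<phi>"
  by (cases k) (auto intro: differentiable_imp_continuous_on)

lemma C_k_SucD: "C_k (Suc k) \<phi> \<Longrightarrow> C_k k \<phi>"
proof (induction k arbitrary: \<phi>)
  case 0
  then show ?case by (auto intro: differentiable_imp_continuous_on)
next
  case (Suc k)
  then show ?case by (metis C_k.simps(2))
qed

text \<open>Derivatives are unique, so any explicitly exhibited derivative determines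
  \<open>partial_deriv\<close>.\<close>

lemma C_k_Suc_I:
  assumes "\<And>x. (\<phi> has_derivative \<phi>' x) (at x)"
    and "\<And>b. b \<in> Basis \<Longrightarrow> C_k k (\<lambda>x. \<phi>' x b)"
  shows "C_k (Suc k) \<phi>"
proof -
  have "partial_deriv b \<phi> = (\<lambda>x. \<phi>' x b)" for b
    using partial_deriv_eq[OF assms(1)] by auto
  moreover have "\<phi> differentiable_on UNIV"
    using assms(1) by (auto simp: differentiable_on_def differentiable_def)
  ultimately show ?thesis using assms(2) by simp
qed

lemma C_k_const: "C_k k (\<lambda>_. c)"
proof (induction k arbitrary: c)
  case (Suc k)
  show ?case by (rule C_k_Suc_I[where \<phi>' = "\<lambda>_ _. 0"]) (auto simp: Suc)
qed auto

lemma C_k_add: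
  assumes "C_k k f" "C_k k g"
  shows "C_k k (\<lambda>x. f x + g x)"
  using assms
proof (induction k arbitrary: f g)
  case 0
  then show ?case by (auto intro: continuous_intros)
next
  case (Suc k)
  show ?case
  proof (rule C_k_Suc_I)
    show "((\<lambda>x. f x + g x) has_derivative
      (\<lambda>h. frechet_derivative f (at x) h + frechet_derivative g (at x) h)) (at x)" for x
      using Suc.prems by (intro has_derivative_add C_k_imp_differentiable)
  next
    fix b :: 'a assume "b \<in> Basis"
    with Suc show "C_k k (\<lambda>x. frechet_derivative f (at x) b + frechet_derivative g (at x) b)"
      unfolding partial_deriv_def[symmetric] by auto
  qed
qed

lemma C_k_mult:
  assumes "C_k k f" "C_k k g"
  shows "C_k k (\<lambda>x. f x * g x)"
  using assms
proof (induction k arbitrary: f g)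
  case 0
  then show ?case by (auto intro: continuous_intros)
next
  case (Suc k)
  show ?case
  proof (rule C_k_Suc_I)
    show "((\<lambda>x. f x * g x) has_derivative
      (\<lambda>h. f x * frechet_derivative g (at x) h + frechet_derivative f (at x) h * g x)) (at x)" for x
      using Suc.prems by (intro has_derivative_mult C_k_imp_differentiable)
  next
    fix b :: 'a assume b: "b \<in> Basis"
    have "C_k k f" "C_k k g" using Suc.prems by (auto intro: C_k_SucD simp del: C_k.simps)
    moreover have "C_k k (partial_deriv b f)" "C_k k (partial_deriv b g)"
      using Suc.prems b by auto
    ultimately show "C_k k (\<lambda>x. f x * frechet_derivative g (at x) b + frechet_derivative f (at x) b * g x)"
      unfolding partial_deriv_def[symmetric] by (intro C_k_add Suc.IH)
  qed
qed

lemma C_k_prod: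
  assumes "\<And>i. i \<in> I \<Longrightarrow> C_k k (f i)"
  shows "C_k k (\<lambda>x. \<Prod>i\<in>I. f i x)"
  using assms
  by (induction I rule: infinite_finite_induct) (auto intro: C_k_mult C_k_const)

text \<open>As \<open>A\<close> maps each basis vector to a basis vector or to 0, the chain rule
  yields a single partial derivative of \<open>f\<close> or nothing, and the induction closes
  without sums over the basis. This covers projections, coordinates and the exchange of two
  coordinates.\<close>

lemma C_k_compose_linear:
  fixes A :: "'b::euclidean_space \<Rightarrow> 'a::euclidean_space"
  assumes "C_k k f" "bounded_linear A" "\<And>b. b \<in> Basis \<Longrightarrow> A b \<in> insert 0 Basis"
  shows "C_k k (\<lambda>x. f (A x))"
  using assms(1)
proof (induction k arbitrary: f)
  case 0
  show ?case
    using 0 linear_continuous_on[OF assms(2)] by (auto intro: continuous_on_compose2)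
next
  case (Suc k)
  show ?case
  proof (rule C_k_Suc_I)
    show "((\<lambda>x. f (A x)) has_derivative (\<lambda>h. frechet_derivative f (at (A x)) (A h))) (at x)" for x
      using has_derivative_compose[OF bounded_linear_imp_has_derivative[OF assms(2)]
          C_k_imp_differentiable[OF Suc.prems]] .
  next
    fix b :: 'b assume b: "b \<in> Basis"
    show "C_k k (\<lambda>x. frechet_derivative f (at (A x)) (A b))"
    proof (cases "A b = 0")
      case True
      have "linear (frechet_derivative f (at y))" for y
        using C_k_imp_differentiable[OF Suc.prems] has_derivative_linear by blast
      then show ?thesis by (simp add: True linear_0 C_k_const)
    next
      case False
      then have "A b \<in> Basis" using assms(3)[OF b] by auto
      then have "C_k k (partial_deriv (A b) f)" using Suc.prems by auto
      from Suc.IH[OF this] show ?thesis by (simp add: partial_deriv_def)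
    qed
  qed
qed

lemma smooth_partial_deriv: "smooth f \<Longrightarrow> b \<in> Basis \<Longrightarrow> smooth (partial_deriv b f)"
  unfolding smooth_def by (metis C_k.simps(2))

lemma smooth_imp_differentiable:
  "smooth f \<Longrightarrow> (f has_derivative frechet_derivative f (at x)) (at x)"
  by (rule C_k_imp_differentiable[where k = 0]) (simp only: smooth_def)

lemma smooth_imp_continuous: "smooth f \<Longrightarrow> continuous_on S f"
  unfolding smooth_def by (metis C_k_imp_continuous continuous_on_subset subset_UNIV)

lemma smooth_measurable [measurable_dest]: "smooth f \<Longrightarrow> f \<in> borel_measurable borel"
  by (rule borel_measurable_continuous_onI) (rule smooth_imp_continuous)

section \<open>Smooth functions of one real variable\<close>

lemma C_k_real_has_derivative:
  fixes f :: "real \<Rightarrow> real"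
  assumes "C_k (Suc k) f"
  shows "(f has_real_derivative partial_deriv 1 f x) (at x)"
proof -
  note d = C_k_imp_differentiable[OF assms, of x]
  obtain c where c: "frechet_derivative f (at x) = (*) c"
    by (rule real_linearD[OF has_derivative_linear[OF d]])
  show ?thesis
    using d unfolding has_field_derivative_def partial_deriv_def c by simp
qed

lemma smooth_real_has_derivative:
  fixes f :: "real \<Rightarrow> real"
  shows "smooth f \<Longrightarrow> (f has_real_derivative partial_deriv 1 f x) (at x)"
  by (rule C_k_real_has_derivative[where k = 0]) (simp only: smooth_def)

lemma C_k_Suc_realI:
  fixes f :: "real \<Rightarrow> real"
  assumes "\<And>x. (f has_real_derivative f' x) (at x)" "C_k k f'"
  shows "C_k (Suc k) f"
  by (rule C_k_Suc_I[where \<phi>' = "\<lambda>x h. f' x * h"])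
    (use assms in \<open>auto simp: has_field_derivative_def\<close>)

lemma C_k_compose_affine:
  fixes f :: "real \<Rightarrow> real"
  assumes "C_k k f"
  shows "C_k k (\<lambda>x. f (c * x + d))"
  using assms
proof (induction k arbitrary: f)
  case 0
  then show ?case by (auto intro!: continuous_on_compose2[of UNIV f] continuous_intros)
next
  case (Suc k)
  let ?f' = "partial_deriv 1 f"
  show ?case
  proof (rule C_k_Suc_realI)
    show "((\<lambda>x. f (c * x + d)) has_real_derivative ?f' (c * x + d) * c) (at x)" for x
      by (rule DERIV_chain2[OF C_k_real_has_derivative[OF Suc.prems]]) (auto intro!: derivative_eq_intros)
    show "C_k k (\<lambda>x. ?f' (c * x + d) * c)"
      using Suc by (intro C_k_mult Suc.IH[of ?f'] C_k_const) auto
  qed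
qed

text \<open>The classical flat function exp(-1/x) is the case \<open>m = 0\<close>. The powers of
  1/x are included because the family is then closed under differentiation up to linear
  combinations, so that one induction on the order of differentiability handles all members.\<close>

definition exp_recip :: "nat \<Rightarrow> real \<Rightarrow> real" where
  "exp_recip m x = (if x > 0 then (1 / x) ^ m * exp (- 1 / x) else 0)"

text \<open>With y = 1/x the limit from the right becomes that of y^m / exp y at infinity.\<close>

lemma exp_recip_tendsto_0: "(exp_recip m \<longlongrightarrow> 0) (at 0)"
proof -
  have "((\<lambda>x. (inverse x) ^ m / exp (inverse x)) \<longlongrightarrow> (0::real)) (at_right 0)"
    using tendsto_power_div_exp_0 filterlim_inverse_at_top_right by (rule filterlim_compose)
  then have "(exp_recip m \<longlongrightarrow> 0) (at_right 0)"
    by (rule Lim_transform_eventually)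
      (auto simp: eventually_at_filter exp_recip_def divide_inverse exp_minus)
  moreover have "(exp_recip m \<longlongrightarrow> 0) (at_left 0)"
    by (rule Lim_transform_eventually[OF tendsto_const]) (auto simp: eventually_at_filter exp_recip_def)
  ultimately show ?thesis by (simp add: filterlim_split_at_real)
qed

lemma exp_recip_has_derivative:
  "(exp_recip m has_real_derivative (- real m * exp_recip (Suc m) x + exp_recip (m + 2) x)) (at x)"
proof -
  consider "x > 0" | "x < 0" | "x = 0" by linarith
  then show ?thesis
  proof cases
    case 1
    have "((\<lambda>x. (1 / x) ^ m * exp (- 1 / x)) has_real_derivative
        (- real m * exp_recip (Suc m) x + exp_recip (m + 2) x)) (at x)"
      using 1 by (cases m) (auto intro!: derivative_eq_intros
          simp: exp_recip_def divide_inverse power2_eq_square algebra_simps,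
          metis Suc_pred not_gr_zero power_Suc)
    then show ?thesis
      by (rule has_field_derivative_transform_within_open[where S = "{0<..}"]) (auto simp: 1 exp_recip_def)
  next
    case 2
    have "((\<lambda>_. 0) has_real_derivative
        (- real m * exp_recip (Suc m) x + exp_recip (m + 2) x)) (at x)"
      using 2 by (auto simp: exp_recip_def)
    then show ?thesis
      by (rule has_field_derivative_transform_within_open[where S = "{..<0}"]) (auto simp: 2 exp_recip_def)
  next
    case 3
    \<comment> \<open>At 0 the difference quotient of \<open>exp_recip m\<close> is
      \<open>exp_recip (Suc m)\<close>, which tends to 0.\<close>
    have "((\<lambda>h. (exp_recip m (0 + h) - exp_recip m 0) / h) \<longlongrightarrow> 0) (at 0)"
      using exp_recip_tendsto_0[of "Suc m"]
      by (rule Lim_transform_eventually) (auto simp: eventually_at_filter exp_recip_def)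
    then show ?thesis using 3 by (simp add: DERIV_def exp_recip_def)
  qed
qed

lemma C_k_exp_recip: "C_k k (exp_recip m)"
proof (induction k arbitrary: m)
  case 0
  show ?case using exp_recip_has_derivative
    by (auto intro!: continuous_at_imp_continuous_on DERIV_isCont)
next
  case (Suc k)
  show ?case
    by (rule C_k_Suc_realI[OF exp_recip_has_derivative]) (intro C_k_add C_k_mult C_k_const Suc)
qed

text \<open>The shift by 1 confines the support to [p + 1/n, q - 1/n], which is compact in the open
  interval, and the factor n makes the bumps converge to its indicator. For \<open>n = 0\<close>
  both arguments equal -1 and the function is 0.\<close>

definition bump :: "real \<Rightarrow> real \<Rightarrow> nat \<Rightarrow> real \<Rightarrow> real" where
  "bump p q n x = exp_recip 0 (n * (x - p) - 1) * exp_recip 0 (n * (q - x) - 1)"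

lemma exp_recip_0_bounds: "0 \<le> exp_recip 0 x" "exp_recip 0 x \<le> 1"
  by (auto simp: exp_recip_def)

lemma bump_bounds: "0 \<le> bump p q n x" "bump p q n x \<le> 1"
  by (auto simp: bump_def exp_recip_0_bounds mult_le_one)

lemma smooth_bump: "smooth (bump p q n)"
proof -
  have "C_k k (\<lambda>x. exp_recip 0 (real n * x + (- n * p - 1)) * exp_recip 0 (- real n * x + (n * q - 1)))" for k
    by (intro C_k_mult C_k_compose_affine[of _ "exp_recip 0"] C_k_exp_recip)
  moreover have "bump p q n = (\<lambda>x. exp_recip 0 (real n * x + (- n * p - 1)) * exp_recip 0 (- real n * x + (n * q - 1)))"
    by (auto simp: bump_def fun_eq_iff algebra_simps)
  ultimately show ?thesis unfolding smooth_def by metis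
qed

lemma bump_eq_0:
  assumes "x \<notin> {p + 1 / real n .. q - 1 / real n}"
  shows "bump p q n x = 0"
proof (cases "n = 0")
  case False
  then have "n * (x - p) - 1 \<le> 0 \<or> n * (q - x) - 1 \<le> 0"
    using assms by (auto simp: field_simps)
  then show ?thesis by (auto simp: bump_def exp_recip_def)
qed (auto simp: bump_def exp_recip_def)

lemma bump_eq_0': 
  assumes "x \<notin> {p<..<q}"
  shows "bump p q n x = 0"
proof -
  have "n * (x - p) - 1 \<le> 0 \<or> n * (q - x) - 1 \<le> 0"
    using assms mult_nonneg_nonpos[of "real n" "x - p"] mult_nonneg_nonpos[of "real n" "q - x"]
    by (auto simp: not_less)
  then show ?thesis by (auto simp: bump_def exp_recip_def)
qed

lemma bump_tendsto: "(\<lambda>n. bump p q n x) \<longlonglongrightarrow> indicator {p<..<q} x"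
proof (cases "x \<in> {p<..<q}")
  case True
  have *: "(\<lambda>n. exp_recip 0 (real n * d - 1)) \<longlonglongrightarrow> 1" if "d > 0" for d
  proof -
    have 1: "filterlim (\<lambda>n. real n * d - 1) at_top sequentially"
      using that by real_asymp
    have "((\<lambda>y::real. exp (- 1 / y)) \<longlongrightarrow> 1) at_top" by real_asymp
    then have lim: "(\<lambda>n. exp (- 1 / (real n * d - 1))) \<longlonglongrightarrow> 1"
      using 1 by (rule filterlim_compose)
    have "\<forall>\<^sub>F n in sequentially. real n * d - 1 > 0"
      using 1 unfolding filterlim_at_top_dense by blast
    then have "\<forall>\<^sub>F n in sequentially. exp (- 1 / (real n * d - 1)) = exp_recip 0 (real n * d - 1)"
      by eventually_elim (simp add: exp_recip_def)
    with lim show ?thesis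
      by (rule Lim_transform_eventually)
  qed
  have "(\<lambda>n. bump p q n x) \<longlonglongrightarrow> 1 * 1"
    unfolding bump_def using True by (intro tendsto_mult *) auto
  then show ?thesis using True by simp
qed (simp add: bump_eq_0')

text \<open>A product over the coordinates, so that the bump of a product of boxes factors into
  bumps of the factors.\<close>

definition box_bump :: "'a::euclidean_space \<Rightarrow> 'a \<Rightarrow> nat \<Rightarrow> 'a \<Rightarrow> real" where
  "box_bump p q n x = (\<Prod>b\<in>Basis. bump (p \<bullet> b) (q \<bullet> b) n (x \<bullet> b))"

lemma box_bump_bounds: "0 \<le> box_bump p q n x" "box_bump p q n x \<le> 1"
  by (auto simp: box_bump_def bump_bounds intro!: prod_nonneg prod_le_1)

lemma box_bump_eq_0: "x \<notin> box p q \<Longrightarrow> box_bump p q n x = 0"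
  by (auto simp: box_bump_def mem_box intro!: prod_zero bump_eq_0')

lemma box_bump_tendsto: "(\<lambda>n. box_bump p q n x) \<longlonglongrightarrow> indicator (box p q) x"
proof -
  have "(\<lambda>n. box_bump p q n x) \<longlonglongrightarrow> (\<Prod>b\<in>Basis. indicator {p \<bullet> b<..<q \<bullet> b} (x \<bullet> b))"
    unfolding box_bump_def by (intro tendsto_prod bump_tendsto)
  also have "(\<Prod>b\<in>Basis. indicator {p \<bullet> b<..<q \<bullet> b} (x \<bullet> b)) = (indicator (box p q) x :: real)"
    by (auto simp: mem_box indicator_def prod_eq_1_iff prod_zero_iff intro!: prod.neutral)
  finally show ?thesis .
qed

lemma test_function_box_bump: "test_function (box p q) (box_bump p q n)"
proof -
  have "C_k k (\<lambda>x. bump (p \<bullet> b) (q \<bullet> b) n (x \<bullet> b))" if "b \<in> Basis" for k and b :: 'a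
    using that smooth_bump
    by (intro C_k_compose_linear[where A = "\<lambda>x. x \<bullet> b" and f = "bump (p \<bullet> b) (q \<bullet> b) n"]
        bounded_linear_inner_left)
      (auto simp: smooth_def inner_Basis)
  then have s: "smooth (box_bump p q n)"
    unfolding smooth_def box_bump_def by (intro allI C_k_prod)
  \<comment> \<open>All coordinates of this vector are 1/n; the support lies in the closed box
    shrunk by it on every side.\<close>
  let ?i = "\<Sum>b\<in>Basis. (1 / real n) *\<^sub>R (b::'a)"
  have i: "?i \<bullet> b = 1 / real n" if "b \<in> Basis" for b
    using that by (simp add: inner_sum_left inner_Basis if_distrib sum.delta cong: if_cong)
  show ?thesis
  proof (cases "n = 0")
    case True
    have "box_bump p q n x = 0" for x
      unfolding box_bump_def bump_def exp_recip_def True by (auto simp: prod_zero_iff)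
    then show ?thesis
      unfolding test_function_def using s by (intro conjI exI[of _ "{}"]) auto
  next
    case False
    then have n: "1 / real n > 0" by simp
    have "cbox (p + ?i) (q - ?i) \<subseteq> box p q"
    proof
      fix x assume "x \<in> cbox (p + ?i) (q - ?i)"
      then have "p \<bullet> b + 1 / real n \<le> x \<bullet> b \<and> x \<bullet> b \<le> q \<bullet> b - 1 / real n" if "b \<in> Basis" for b
        using that by (auto simp: mem_box inner_add_left inner_diff_left i)
      then show "x \<in> box p q"
        unfolding mem_box using n by (meson less_add_same_cancel1 diff_less_eq less_le_trans le_less_trans)
    qed
    moreover have "box_bump p q n x = 0" if "x \<notin> cbox (p + ?i) (q - ?i)" for x
      using that by (auto simp: box_bump_def mem_box inner_add_left inner_diff_left i
          intro!: prod_zero bump_eq_0)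
    ultimately show ?thesis
      unfolding test_function_def using s by (intro conjI exI[of _ "cbox (p + ?i) (q - ?i)"]) auto
  qed
qed

section \<open>Tensor products of test functions\<close>

definition tensor :: "('a \<Rightarrow> real) \<Rightarrow> ('b \<Rightarrow> real) \<Rightarrow> 'a \<times> 'b \<Rightarrow> real" where
  "tensor \<theta> \<psi> z = \<theta> (fst z) * \<psi> (snd z)"

lemma tensor_Pair [simp]: "tensor \<theta> \<psi> (x, y) = \<theta> x * \<psi> y"
  by (simp add: tensor_def)

lemma smooth_tensor:
  fixes \<theta> :: "'a::euclidean_space \<Rightarrow> real" and \<psi> :: "'b::euclidean_space \<Rightarrow> real"
  assumes "smooth \<theta>" "smooth \<psi>"
  shows "smooth (tensor \<theta> \<psi>)"
  unfolding smooth_def tensor_def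
proof (intro allI C_k_mult)
  show "C_k k (\<lambda>z::'a \<times> 'b. \<theta> (fst z))" for k
    using assms by (intro C_k_compose_linear[of _ \<theta> fst] bounded_linear_fst) (auto simp: smooth_def Basis_prod_def)
  show "C_k k (\<lambda>z::'a \<times> 'b. \<psi> (snd z))" for k
    using assms by (intro C_k_compose_linear[of _ \<psi> snd] bounded_linear_snd) (auto simp: smooth_def Basis_prod_def)
qed

lemma test_function_tensor:
  fixes \<theta> :: "'a::euclidean_space \<Rightarrow> real" and \<psi> :: "'b::euclidean_space \<Rightarrow> real"
  assumes "test_function X \<theta>" "test_function Z \<psi>"
  shows "test_function (X \<times> Z) (tensor \<theta> \<psi>)"
proof -
  obtain K1 K2 where "compact K1" "K1 \<subseteq> X" "\<And>x. x \<notin> K1 \<Longrightarrow> \<theta> x = 0"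
      "compact K2" "K2 \<subseteq> Z" "\<And>x. x \<notin> K2 \<Longrightarrow> \<psi> x = 0"
    using assms unfolding test_function_def by metis
  then have "compact (K1 \<times> K2) \<and> K1 \<times> K2 \<subseteq> X \<times> Z \<and> (\<forall>x. x \<notin> K1 \<times> K2 \<longrightarrow> tensor \<theta> \<psi> x = 0)"
    by (auto simp: tensor_def intro: compact_Times)
  moreover have "smooth (tensor \<theta> \<psi>)"
    using assms by (intro smooth_tensor) (auto simp: test_function_def)
  ultimately show ?thesis unfolding test_function_def by (intro conjI exI[of _ "K1 \<times> K2"]) auto
qed

lemma partial_deriv_tensor:
  fixes \<theta> :: "'a::euclidean_space \<Rightarrow> real" and \<psi> :: "'b::euclidean_space \<Rightarrow> real"
  assumes "smooth \<theta>" "smooth \<psi>"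
  shows "partial_deriv (b, 0) (tensor \<theta> \<psi>) = tensor (partial_deriv b \<theta>) \<psi>"
    and "partial_deriv (0, c) (tensor \<theta> \<psi>) = tensor \<theta> (partial_deriv c \<psi>)"
proof -
  have d1: "(\<theta> has_derivative frechet_derivative \<theta> (at x)) (at x)" for x
    using assms by (intro smooth_imp_differentiable)
  have d2: "(\<psi> has_derivative frechet_derivative \<psi> (at x)) (at x)" for x
    using assms by (intro smooth_imp_differentiable)
  have "(tensor \<theta> \<psi> has_derivative (\<lambda>h. \<theta> (fst z) * frechet_derivative \<psi> (at (snd z)) (snd h)
      + frechet_derivative \<theta> (at (fst z)) (fst h) * \<psi> (snd z))) (at z)" for z
    unfolding tensor_def
    by (intro has_derivative_mult has_derivative_compose[OF _ d1] has_derivative_compose[OF _ d2]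
        bounded_linear_imp_has_derivative bounded_linear_fst bounded_linear_snd)
  note * = partial_deriv_eq[OF this]
  have "frechet_derivative \<theta> (at x) 0 = 0" "frechet_derivative \<psi> (at y) 0 = 0" for x y
    using d1 d2 has_derivative_linear linear_0 by blast+
  then show "partial_deriv (b, 0) (tensor \<theta> \<psi>) = tensor (partial_deriv b \<theta>) \<psi>"
    and "partial_deriv (0, c) (tensor \<theta> \<psi>) = tensor \<theta> (partial_deriv c \<psi>)"
    unfolding fun_eq_iff * by (auto simp: tensor_def partial_deriv_def)
qed

lemma test_function_partial_deriv:
  assumes "test_function X \<theta>" "b \<in> Basis"
  shows "test_function X (partial_deriv b \<theta>)"
proof -
  obtain K where K: "compact K" "K \<subseteq> X" "\<And>x. x \<notin> K \<Longrightarrow> \<theta> x = 0"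
    using assms unfolding test_function_def by metis
  have "partial_deriv b \<theta> x = 0" if "x \<notin> K" for x
  proof -
    \<comment> \<open>The complement of the compact support is open, so near \<open>x\<close> the
      function is constantly 0.\<close>
    have "((\<lambda>_. 0) has_derivative (\<lambda>_. 0)) (at x)" by simp
    then have "(\<theta> has_derivative (\<lambda>_. 0)) (at x)"
      by (rule has_derivative_transform_within_open[where s = "- K"])
        (use K that in \<open>simp_all add: open_Compl compact_imp_closed\<close>)
    then show ?thesis by (rule partial_deriv_eq)
  qed
  then have "\<exists>K. compact K \<and> K \<subseteq> X \<and> (\<forall>x. x \<notin> K \<longrightarrow> partial_deriv b \<theta> x = 0)"
    using K by (intro exI[of _ K]) simp
  moreover have "smooth (partial_deriv b \<theta>)"
    using assms by (intro smooth_partial_deriv) (auto simp: test_function_def)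
  ultimately show ?thesis
    by (simp add: test_function_def)
qed

section \<open>The fundamental lemma of the calculus of variations\<close>

text \<open>Boxes are an intersection-stable generator of the Borel sets, and the sets over which
  \<open>h\<close> integrates to 0 are closed under complements and countable disjoint unions. Hence
  \<open>h\<close> integrates to 0 over every Borel set, like the density 0.\<close>

lemma AE_zero_if_box_integrals_zero:
  fixes h :: "'a::euclidean_space \<Rightarrow> real"
  assumes h: "integrable lborel h" and box: "\<And>p q. (LBINT x:box p q. h x) = 0"
  shows "AE x in lborel. h x = 0"
proof -
  have si: "set_integrable lborel A h" if "A \<in> sets borel" for A
    unfolding set_integrable_def using that h by (intro integrable_mult_indicator) auto
  \<comment> \<open>Complements require the integral over the whole space, which is the limit along
    growing boxes.\<close>
  have UNIV: "(LBINT x. h x) = 0"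
  proof -
    let ?B = "\<lambda>n::nat. box (- (real n *\<^sub>R One)) (real n *\<^sub>R One) :: 'a set"
    have "(\<lambda>n. LBINT x:?B n. h x) \<longlonglongrightarrow> (LBINT x:(\<Union>n. ?B n). h x)"
      by (rule set_integral_cont_up) (auto simp: incseq_def mem_box intro!: si, fastforce+)
    then have "(LBINT x:(\<Union>n. ?B n). h x) = 0" by (simp add: box LIMSEQ_const_iff)
    then show ?thesis by (simp add: UN_box_eq_UNIV set_lebesgue_integral_def)
  qed
  have Int: "Int_stable (range (\<lambda>(a, b). box a b :: 'a set))"
    unfolding Int_stable_def by (auto simp: Int_interval box_Int_box)
  have sets: "A \<in> sigma_sets UNIV (range (\<lambda>(a, b). box a b)) \<Longrightarrow> A \<in> sets borel" for A :: "'a set"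
    by (simp add: borel_eq_box)
  have "(LBINT x:A. h x) = 0" if "A \<in> sets borel" for A
  proof -
    have "range (\<lambda>(a, b). box a b) \<subseteq> Pow (UNIV :: 'a set)" by simp
    note Int this
    moreover have "A \<in> sigma_sets UNIV (range (\<lambda>(a, b). box a b))"
      using that by (simp add: borel_eq_box)
    ultimately show ?thesis
    proof (induction rule: sigma_sets_induct_disjoint)
      case (basic A)
      then show ?case using box by auto
    next
      case empty
      then show ?case by (simp add: set_lebesgue_integral_def)
    next
      case (compl A)
      have "(LBINT x:A \<union> (UNIV - A). h x) = (LBINT x:A. h x) + (LBINT x:UNIV - A. h x)"
        using sets[OF compl(1)] by (intro set_integral_Un si) auto
      then show ?case using UNIV compl by (simp add: set_lebesgue_integral_def)
    next
      case (union A)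
      then have "A i \<in> sets borel" for i by (auto intro: sets)
      then have "(LBINT x:(\<Union>i. A i). h x) = (\<Sum>i. LBINT x:A i. h x)"
        using union by (intro lebesgue_integral_countable_add si) (auto simp: disjoint_family_on_def)
      then show ?case using union by simp
    qed
  qed
  then show ?thesis
    using density_unique_real[OF h, of "\<lambda>_. 0"] by simp
qed

lemma test_function_mono: "test_function X \<phi> \<Longrightarrow> X \<subseteq> Y \<Longrightarrow> test_function Y \<phi>"
  unfolding test_function_def by (meson order_trans)

lemma test_function_eq_0: "test_function X \<phi> \<Longrightarrow> x \<notin> X \<Longrightarrow> \<phi> x = 0"
  unfolding test_function_def by (meson subsetD)

lemma test_function_smooth: "test_function X \<phi> \<Longrightarrow> smooth \<phi>"
  by (simp add: test_function_def)

lemma test_function_bounded: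
  assumes "test_function X \<phi>"
  obtains C where "\<And>x. \<bar>\<phi> x\<bar> \<le> C"
proof -
  obtain K where K: "compact K" "\<And>x. x \<notin> K \<Longrightarrow> \<phi> x = 0"
    using assms unfolding test_function_def by metis
  have "bounded (\<phi> ` K)"
    using K(1) smooth_imp_continuous[OF test_function_smooth[OF assms]]
    by (intro compact_imp_bounded compact_continuous_image)
  then obtain C where C: "\<And>x. x \<in> K \<Longrightarrow> \<bar>\<phi> x\<bar> \<le> C" by (auto simp: bounded_iff)
  have "\<bar>\<phi> x\<bar> \<le> max C 0" for x
    using C[of x] K(2)[of x] by (cases "x \<in> K") auto
  then show thesis by (rule that)
qed

text \<open>Only the bump functions of boxes serve as test functions, since on a product domain these are
  tensor products.\<close>

lemma AE_zero_if_orthogonal_to_bumps: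
  fixes h :: "'a::euclidean_space \<Rightarrow> real"
  assumes "open \<Omega>" and h: "locally_integrable \<Omega> h"
    and orth: "\<And>p q n. cbox p q \<subseteq> \<Omega> \<Longrightarrow> (LBINT z:\<Omega>. h z * box_bump p q n z) = 0"
  shows "AE z\<in>\<Omega> in lborel. h z = 0"
proof -
  \<comment> \<open>\<open>h\<close> is only locally integrable, so it is first cut off to a closed
    box inside \<Omega>.\<close>
  have *: "AE z in lborel. indicator (cbox P Q) z * h z = 0" if PQ: "cbox P Q \<subseteq> \<Omega>" for P Q :: 'a
  proof (rule AE_zero_if_box_integrals_zero)
    have hK: "set_integrable lborel (cbox P Q) h"
      using h PQ by (simp add: locally_integrable_def)
    then show "integrable lborel (\<lambda>z. indicator (cbox P Q) z * h z)"
      by (simp add: set_integrable_def)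
    \<comment> \<open>The bumps are bounded by 1 and converge to the indicator of the open box, with
      \<open>h\<close> on the closed box as dominating function.\<close>
    have zero: "(LBINT z:box p q. h z) = 0" if pq: "cbox p q \<subseteq> \<Omega>" for p q :: 'a
    proof -
      have hpq: "integrable lborel (\<lambda>z. indicator (cbox p q) z * h z)"
        using h pq by (simp add: locally_integrable_def set_integrable_def)
      have eq: "indicator \<Omega> z *\<^sub>R (h z * box_bump p q n z) = indicator (cbox p q) z * h z * box_bump p q n z"
        for n z
        using box_bump_eq_0[of z p q n] pq box_subset_cbox[of p q] by (cases "z \<in> box p q") (auto split: split_indicator)
      have [measurable]: "box_bump p q n \<in> borel_measurable borel" for n
        using test_function_smooth[OF test_function_box_bump] by measurable
      have "(\<lambda>n. LBINT z. indicator (cbox p q) z * h z * box_bump p q n z) \<longlonglongrightarrow>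
          (LBINT z. indicator (cbox p q) z * h z * indicator (box p q) z)"
      proof (rule integral_dominated_convergence[where w = "\<lambda>z. \<bar>indicator (cbox p q) z * h z\<bar>"])
        show "AE z in lborel. norm (indicator (cbox p q) z * h z * box_bump p q n z)
          \<le> \<bar>indicator (cbox p q) z * h z\<bar>" for n
          using box_bump_bounds[of p q n] by (auto simp: abs_mult intro!: mult_left_le)
      qed (use hpq in \<open>auto intro!: tendsto_intros box_bump_tendsto\<close>)
      moreover have "(LBINT z. indicator (cbox p q) z * h z * box_bump p q n z) = 0" for n
        using orth[OF pq, of n] unfolding set_lebesgue_integral_def eq .
      ultimately have "(LBINT z. indicator (cbox p q) z * h z * indicator (box p q) z) = 0"
        by (simp add: LIMSEQ_const_iff)
      also have "(\<lambda>z. indicator (cbox p q) z * h z * indicator (box p q) z) = (\<lambda>z. indicator (box p q) z *\<^sub>R h z)"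
        using box_subset_cbox[of p q] by (auto simp: fun_eq_iff split: split_indicator)
      finally show ?thesis by (simp add: set_lebesgue_integral_def)
    qed
    fix p q :: 'a
    obtain r s where rs: "box p q \<inter> box P Q = box r s"
      unfolding box_Int_box by blast
    have "(LBINT z:box p q. indicator (cbox P Q) z * h z)
        = (LBINT z. indicator (box p q \<inter> cbox P Q) z * h z)"
      unfolding set_lebesgue_integral_def by (simp add: indicator_inter_arith mult.assoc)
    \<comment> \<open>Dropping the null boundary of the cut-off box makes the intersection an open
      box again, to which \<open>zero\<close> applies.\<close>
    also have "\<dots> = (LBINT z. indicator (box p q \<inter> box P Q) z * h z)"
    proof (rule integral_cong_AE)
      have "AE z in lborel. z \<notin> cbox P Q - box P Q"
        by (rule AE_not_in) (auto simp: null_sets_def emeasure_lborel_cbox_eq emeasure_Diff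
            emeasure_lborel_box_eq box_subset_cbox)
      then show "AE z in lborel. indicator (box p q \<inter> cbox P Q) z * h z = indicator (box p q \<inter> box P Q) z * h z"
        by eventually_elim (use box_subset_cbox[of P Q] in \<open>auto split: split_indicator\<close>)
      have m: "(\<lambda>z. indicator (cbox P Q) z * h z) \<in> borel_measurable borel"
        using hK by (auto simp: set_integrable_def dest!: borel_measurable_integrable)
      have "(\<lambda>z. indicator (box p q) z * (indicator (cbox P Q) z * h z)) \<in> borel_measurable lborel"
        using m by measurable
      then show "(\<lambda>z. indicator (box p q \<inter> cbox P Q) z * h z) \<in> borel_measurable lborel"
        by (simp add: indicator_inter_arith mult.assoc)
      have "(\<lambda>z. indicator (box p q \<inter> box P Q) z * (indicator (cbox P Q) z * h z)) \<in> borel_measurable lborel"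
        using m by measurable
      also have "(\<lambda>z. indicator (box p q \<inter> box P Q) z * (indicator (cbox P Q) z * h z))
          = (\<lambda>z. indicator (box p q \<inter> box P Q) z * h z)"
        using box_subset_cbox[of P Q] by (auto simp: fun_eq_iff split: split_indicator)
      finally show "(\<lambda>z. indicator (box p q \<inter> box P Q) z * h z) \<in> borel_measurable lborel" .
    qed
    also have "\<dots> = (LBINT z:box r s. h z)"
      by (simp add: rs set_lebesgue_integral_def)
    also have "\<dots> = 0"
    proof (cases "box r s = {}")
      case True
      then show ?thesis by (simp add: set_lebesgue_integral_def)
    next
      case False
      have "box r s \<subseteq> cbox P Q" using rs box_subset_cbox by blast
      then have "cbox r s \<subseteq> cbox P Q"
        using False closure_box[OF False] closed_cbox[of P Q] closure_minimal by metis
      with PQ show ?thesis by (intro zero) auto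
    qed
    finally show "(LBINT z:box p q. indicator (cbox P Q) z * h z) = 0" .
  qed
  \<comment> \<open>Countably many closed boxes exhaust \<Omega>, so the exceptional null sets can
    be united.\<close>
  obtain D where D: "countable D" "D \<subseteq> Pow \<Omega>" "\<And>X. X \<in> D \<Longrightarrow> \<exists>a b. X = cbox a b" "\<Union>D = \<Omega>"
    using open_countable_Union_open_cbox[OF \<open>open \<Omega>\<close>] by metis
  have "AE z in lborel. \<forall>X\<in>D. indicator X z * h z = 0"
    unfolding AE_ball_countable[OF D(1)] using D(2,3) * by blast
  then show ?thesis
    by eventually_elim (use D(4) in \<open>auto simp: indicator_def\<close>)
qed

lemma box_bump_Pair:
  fixes p1 q1 x :: "'a::euclidean_space" and p2 q2 y :: "'b::euclidean_space"
  shows   "box_bump (p1, p2) (q1, q2) n (x, y) = box_bump p1 q1 n x * box_bump p2 q2 n y"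
proof -
  have [simp]: "inj_on (\<lambda>u::'a. (u, 0::'b)) Basis" "inj_on (\<lambda>v::'b. (0::'a, v)) Basis"
    by (auto simp: inj_on_def)
  show ?thesis
    unfolding box_bump_def Basis_prod_def
    by (subst prod.union_disjoint) (auto simp: prod.reindex o_def)
qed

lemma AE_zero_if_orthogonal_to_tensors:
  fixes h :: "'a::euclidean_space \<times> 'b::euclidean_space \<Rightarrow> real"
  assumes "open X" "open Z" and h: "locally_integrable (X \<times> Z) h"
    and orth: "\<And>\<theta> \<psi>. test_function X \<theta> \<Longrightarrow> test_function Z \<psi> \<Longrightarrow>
      (LBINT z:X \<times> Z. h z * tensor \<theta> \<psi> z) = 0"
  shows "AE z\<in>X \<times> Z in lborel. h z = 0"
proof (rule AE_zero_if_orthogonal_to_bumps[OF open_Times[OF assms(1,2)] h])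
  fix p q :: "'a \<times> 'b" and n
  assume sub: "cbox p q \<subseteq> X \<times> Z"
  obtain p1 p2 q1 q2 where pq: "p = (p1, p2)" "q = (q1, q2)" by (metis surj_pair)
  show "(LBINT z:X \<times> Z. h z * box_bump p q n z) = 0"
  proof (cases "cbox p q = {}")
    case True
    then have "box_bump p q n z = 0" for z
      using box_subset_cbox[of p q] box_bump_eq_0 by blast
    then show ?thesis by simp
  next
    case False
    \<comment> \<open>Nonemptiness matters: an empty product box lies in the domain even when one of
      its factors does not lie in \<open>X\<close> or \<open>Z\<close>.\<close>
    then have "cbox p1 q1 \<subseteq> X" "cbox p2 q2 \<subseteq> Z"
      using sub by (auto simp: pq cbox_Pair_eq)
    then have "test_function X (box_bump p1 q1 n)" "test_function Z (box_bump p2 q2 n)"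
      using box_subset_cbox by (metis order_trans test_function_box_bump test_function_mono)+
    moreover have "box_bump p q n z = tensor (box_bump p1 q1 n) (box_bump p2 q2 n) z" for z
      by (cases z) (simp add: pq box_bump_Pair)
    ultimately show ?thesis using orth by simp
  qed
qed

section \<open>Absolutely continuous functions on an interval\<close>

lemma set_integrable_measurable:
  "set_integrable M A f \<Longrightarrow> set_borel_measurable M A f"
  unfolding set_integrable_def set_borel_measurable_def by (rule borel_measurable_integrable)

text \<open>Absolute continuity in the form of the fundamental theorem of calculus, so that no
  pointwise derivative of \<open>F\<close> is ever taken. The closed interval in the second clause
  is essential: \<open>F a\<close> and \<open>F b\<close> will play the role of traces.\<close>

definition ac_on :: "real \<Rightarrow> real \<Rightarrow> (real \<Rightarrow> real) \<Rightarrow> (real \<Rightarrow> real) \<Rightarrow> bool" where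
  "ac_on a b F f \<longleftrightarrow> set_integrable lborel {a<..<b} f \<and>
     (\<forall>x\<in>{a..b}. F x = F a + (LBINT s:{a<..<x}. f s))"

lemma ac_onD:
  assumes "ac_on a b F f"
  shows "set_integrable lborel {a<..<b} f"
    and "x \<in> {a..b} \<Longrightarrow> F x = F a + (LBINT s:{a<..<x}. f s)"
  using assms unfolding ac_on_def by blast+

lemma set_integral_greaterThanLessThan_combine:
  fixes f :: "real \<Rightarrow> real"
  assumes f: "set_integrable lborel {a<..<b} f" and "a \<le> s" "s \<le> t" "t \<le> b"
  shows "(LBINT x:{a<..<t}. f x) = (LBINT x:{a<..<s}. f x) + (LBINT x:{s<..<t}. f x)"
proof -
  have si: "set_integrable lborel A f" if "A \<subseteq> {a<..<b}" "A \<in> sets borel" for A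
    using f by (rule set_integrable_subset) (use that in auto)
  have "(LBINT x:{a<..<t}. f x) = (LBINT x:{a<..<s} \<union> {s<..<t}. f x)"
  proof (rule set_integral_cong_set)
    show "AE x in lborel. (x \<in> {a<..<s} \<union> {s<..<t}) = (x \<in> {a<..<t})"
      using AE_lborel_singleton[of s] by eventually_elim (use assms in auto)
    show "set_borel_measurable lborel {a<..<t} f" "set_borel_measurable lborel ({a<..<s} \<union> {s<..<t}) f"
      using assms by (auto intro!: set_integrable_measurable si)
  qed
  also have "\<dots> = (LBINT x:{a<..<s}. f x) + (LBINT x:{s<..<t}. f x)"
    using assms by (intro set_integral_Un si) auto
  finally show ?thesis .
qed

lemma ac_on_diff:
  assumes "ac_on a b F f" "a \<le> s" "s \<le> t" "t \<le> b"
  shows "F t - F s = (LBINT x:{s<..<t}. f x)"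
  using ac_onD(2)[OF assms(1), of t] ac_onD(2)[OF assms(1), of s] assms
    set_integral_greaterThanLessThan_combine[OF ac_onD(1)[OF assms(1)] assms(2,3,4)]
  by auto

lemma integral_indicator_lessThan_measurable:
  fixes f :: "real \<Rightarrow> real"
  assumes [measurable]: "f \<in> borel_measurable borel"
  shows "(\<lambda>x. LBINT s. indicator {s. s < x} s * f s) \<in> borel_measurable borel"
proof -
  have "(\<lambda>x. LBINT s. of_bool (s < x) * f s) \<in> borel_measurable borel"
    by measurable
  then show ?thesis by (simp add: indicator_def)
qed

text \<open>Up to the constant \<open>F a\<close>, the function is an integral of \<open>f\<close>
  over a set depending measurably on the parameter \<open>x\<close>.\<close>

lemma ac_on_measurable:
  assumes "ac_on a b F f"
  shows "set_borel_measurable lborel {a<..<b} F"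
proof -
  let ?f = "\<lambda>s. indicator {a<..<b} s * f s"
  have [measurable]: "?f \<in> borel_measurable borel"
    using ac_onD(1)[OF assms] by (auto simp: set_integrable_def dest!: borel_measurable_integrable)
  have "indicator {a<..<b} x *\<^sub>R F x = indicator {a<..<b} x * (F a + (LBINT s. indicator {s. s < x} s * ?f s))" for x
  proof (cases "x \<in> {a<..<b}")
    case True
    then have "(\<lambda>s. indicator {a<..<x} s * f s) = (\<lambda>s. indicator {s. s < x} s * ?f s)"
      by (auto simp: fun_eq_iff split: split_indicator)
    then show ?thesis
      using ac_onD(2)[OF assms, of x] True by (simp add: set_lebesgue_integral_def)
  qed simp
  then have eq: "(\<lambda>x. indicator {a<..<b} x *\<^sub>R F x)
      = (\<lambda>x. indicator {a<..<b} x * (F a + (LBINT s. indicator {s. s < x} s * ?f s)))"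
    by (rule ext)
  have [measurable]: "(\<lambda>x. LBINT s. indicator {s. s < x} s * ?f s) \<in> borel_measurable borel"
    by (rule integral_indicator_lessThan_measurable) measurable
  show ?thesis unfolding set_borel_measurable_def eq by measurable
qed

lemma ac_on_bounded:
  assumes "ac_on a b F f"
  obtains C where "\<And>x. x \<in> {a..b} \<Longrightarrow> \<bar>F x\<bar> \<le> C"
proof
  fix x assume x: "x \<in> {a..b}"
  have i: "set_integrable lborel {a<..<b} (\<lambda>s. \<bar>f s\<bar>)"
    using ac_onD(1)[OF assms] by (rule set_integrable_abs)
  have ix: "set_integrable lborel {a<..<x} f"
    using ac_onD(1)[OF assms] by (rule set_integrable_subset) (use x in auto)
  have "\<bar>LBINT s:{a<..<x}. f s\<bar> \<le> (LBINT s:{a<..<x}. \<bar>f s\<bar>)"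
    using set_integral_norm_bound[OF ix] by simp
  also have "\<dots> \<le> (LBINT s:{a<..<b}. \<bar>f s\<bar>)"
    unfolding set_lebesgue_integral_def using x i set_integrable_abs[OF ix]
    by (intro integral_mono) (auto simp: set_integrable_def split: split_indicator)
  finally show "\<bar>F x\<bar> \<le> \<bar>F a\<bar> + (LBINT s:{a<..<b}. \<bar>f s\<bar>)"
    using ac_onD(2)[OF assms x] by linarith
qed

lemma set_integrable_bounded_mult:
  fixes f g :: "'a \<Rightarrow> real"
  assumes f: "set_borel_measurable M A f" and A: "A \<in> sets M" and b: "\<And>x. x \<in> A \<Longrightarrow> \<bar>f x\<bar> \<le> C"
    and g: "set_integrable M A g"
  shows "set_integrable M A (\<lambda>x. f x * g x)"
  unfolding set_integrable_def
proof (rule Bochner_Integration.integrable_bound)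
  show "integrable M (\<lambda>x. \<bar>C\<bar> * (indicator A x *\<^sub>R g x))"
    using g by (intro integrable_mult_right) (simp add: set_integrable_def)
  have "(\<lambda>x. (indicator A x *\<^sub>R f x) * (indicator A x *\<^sub>R g x)) \<in> borel_measurable M"
    using f g by (intro borel_measurable_times) (auto simp: set_borel_measurable_def set_integrable_def)
  also have "(\<lambda>x. (indicator A x *\<^sub>R f x) * (indicator A x *\<^sub>R g x)) = (\<lambda>x. indicator A x *\<^sub>R (f x * g x))"
    by (auto simp: fun_eq_iff split: split_indicator)
  finally show "(\<lambda>x. indicator A x *\<^sub>R (f x * g x)) \<in> borel_measurable M" .
  have "\<bar>f x\<bar> * \<bar>g x\<bar> \<le> \<bar>C\<bar> * \<bar>g x\<bar>" if "x \<in> A" for x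
    using b[OF that] by (intro mult_right_mono) auto
  then show "AE x in M. norm (indicator A x *\<^sub>R (f x * g x)) \<le> norm (\<bar>C\<bar> * (indicator A x *\<^sub>R g x))"
    by (auto simp: abs_mult split: split_indicator)
qed

lemma ac_on_mult_integrable:
  assumes "ac_on a b F f" "set_integrable lborel {a<..<b} g"
  shows "set_integrable lborel {a<..<b} (\<lambda>x. F x * g x)"
proof -
  obtain C where "\<And>x. x \<in> {a..b} \<Longrightarrow> \<bar>F x\<bar> \<le> C" using ac_on_bounded[OF assms(1)] by blast
  then show ?thesis
    by (intro set_integrable_bounded_mult[OF ac_on_measurable[OF assms(1)] _ _ assms(2), of C]) auto
qed

lemma integrable_tensor:
  fixes f :: "'a::euclidean_space \<Rightarrow> real" and g :: "'b::euclidean_space \<Rightarrow> real"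
  assumes f: "integrable lborel f" and g: "integrable lborel g"
  shows "integrable lborel (tensor f g)"
proof -
  note [measurable] = borel_measurable_integrable[OF f] borel_measurable_integrable[OF g]
  have "integrable (lborel \<Otimes>\<^sub>M lborel) (\<lambda>(s, t). f s * g t)"
  proof (rule lborel_pair.Fubini_integrable)
    show "integrable lborel (\<lambda>s. LBINT t. norm (case (s, t) of (s, t) \<Rightarrow> f s * g t))"
      using f by (simp add: abs_mult)
    show "AE s in lborel. integrable lborel (\<lambda>t. case (s, t) of (s, t) \<Rightarrow> f s * g t)"
      using g by simp
  qed measurable
  then show ?thesis by (simp add: lborel_prod tensor_def[abs_def] case_prod_unfold)
qed

text \<open>The product is a double integral over the plane, cut along the diagonal, which meets
  every line in a single point. This is the analytic content of the product rule for
  \<open>ac_on\<close>.\<close>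

lemma integral_mult_integral_split:
  fixes f g :: "real \<Rightarrow> real"
  assumes f: "integrable lborel f" and g: "integrable lborel g"
  shows "(LBINT s. f s) * (LBINT t. g t) =
    (LBINT s. f s * (LBINT t. indicator {t. t < s} t * g t)) +
    (LBINT t. (LBINT s. indicator {s. s < t} s * f s) * g t)"
proof -
  note [measurable] = borel_measurable_integrable[OF f] borel_measurable_integrable[OF g]
  have H: "integrable (lborel \<Otimes>\<^sub>M lborel) (\<lambda>(s, t). f s * g t)"
    using integrable_tensor[OF f g] by (simp add: lborel_prod tensor_def[abs_def] case_prod_unfold)
  have H1: "integrable (lborel \<Otimes>\<^sub>M lborel) (\<lambda>(s, t). of_bool (t < s) * (f s * g t))"
    by (rule Bochner_Integration.integrable_bound[OF H]) (auto simp: abs_mult)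
  have H2: "integrable (lborel \<Otimes>\<^sub>M lborel) (\<lambda>(s, t). of_bool (s < t) * (f s * g t))"
    by (rule Bochner_Integration.integrable_bound[OF H]) (auto simp: abs_mult)
  have "(LBINT s. f s * (LBINT t. indicator {t. t < s} t * g t))
      = (LBINT s. LBINT t. of_bool (t < s) * (f s * g t))"
    by (simp add: indicator_def mult.left_commute flip: integral_mult_right_zero)
  moreover have "(LBINT t. (LBINT s. indicator {s. s < t} s * f s) * g t)
      = (LBINT t. LBINT s. of_bool (s < t) * (f s * g t))"
    by (simp add: indicator_def mult.assoc flip: integral_mult_left_zero)
  moreover have "\<dots> = (LBINT s. LBINT t. of_bool (s < t) * (f s * g t))"
    by (rule lborel_pair.Fubini_integral[OF H2])
  moreover have "(LBINT s. LBINT t. of_bool (t < s) * (f s * g t)) +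
      (LBINT s. LBINT t. of_bool (s < t) * (f s * g t)) = (LBINT s. LBINT t. f s * g t)"
  proof (subst Bochner_Integration.integral_add[symmetric])
    show "integrable lborel (\<lambda>s. LBINT t. of_bool (t < s) * (f s * g t))"
      using lborel_pair.integrable_fst[OF H1] .
    show "integrable lborel (\<lambda>s. LBINT t. of_bool (s < t) * (f s * g t))"
      using lborel_pair.integrable_fst[OF H2] .
    have "(LBINT t. of_bool (t < s) * (f s * g t)) + (LBINT t. of_bool (s < t) * (f s * g t)) = (LBINT t. f s * g t)" for s
    proof -
      have i: "integrable lborel (\<lambda>t. f s * g t)" using g by simp
      have "AE t in lborel. t \<noteq> s" by (rule AE_lborel_singleton)
      then have "(LBINT t. f s * g t) = (LBINT t. of_bool (t < s) * (f s * g t) + of_bool (s < t) * (f s * g t))"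
        by (intro integral_cong_AE) auto
      also have "\<dots> = (LBINT t. of_bool (t < s) * (f s * g t)) + (LBINT t. of_bool (s < t) * (f s * g t))"
        by (intro Bochner_Integration.integral_add Bochner_Integration.integrable_bound[OF i]) (auto simp: abs_mult)
      finally show ?thesis by simp
    qed
    then show "(LBINT s. (LBINT t. of_bool (t < s) * (f s * g t)) + (LBINT t. of_bool (s < t) * (f s * g t)))
      = (LBINT s. LBINT t. f s * g t)" by simp
  qed
  ultimately show ?thesis by simp
qed

text \<open>Write F = F a + P and G = G a + Q with indefinite integrals P and Q. Fubini on the
  square over (a, x), split along its diagonal, turns P(x) Q(x) into the integrals of f Q and P
  g.\<close>

lemma ac_on_mult:
  assumes F: "ac_on a b F f" and G: "ac_on a b G g"
  shows "ac_on a b (\<lambda>x. F x * G x) (\<lambda>x. f x * G x + F x * g x)"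
proof -
  have iFg: "set_integrable lborel {a<..<b} (\<lambda>x. F x * g x)"
    using ac_on_mult_integrable[OF F ac_onD(1)[OF G]] .
  have iGf: "set_integrable lborel {a<..<b} (\<lambda>x. f x * G x)"
    using ac_on_mult_integrable[OF G ac_onD(1)[OF F]] by (simp add: mult.commute)
  have "F x * G x = F a * G a + (LBINT s:{a<..<x}. f s * G s + F s * g s)" if x: "x \<in> {a..b}" for x
  proof -
    have sub: "set_integrable lborel {a<..<x} h" if "set_integrable lborel {a<..<b} h" for h :: "real \<Rightarrow> real"
      using that by (rule set_integrable_subset) (use x in auto)
    define f0 where "f0 = (\<lambda>s. indicator {a<..<x} s * f s)"
    define g0 where "g0 = (\<lambda>s. indicator {a<..<x} s * g s)"
    have i0: "integrable lborel f0" "integrable lborel g0"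
      using sub[OF ac_onD(1)[OF F]] sub[OF ac_onD(1)[OF G]] by (simp_all add: f0_def g0_def set_integrable_def)
    have P: "F s = F a + (LBINT t. indicator {t. t < s} t * f0 t)" if "s \<in> {a<..<x}" for s
    proof -
      have "(\<lambda>t. indicator {a<..<s} t * f t) = (\<lambda>t. indicator {t. t < s} t * f0 t)"
        using that by (auto simp: f0_def fun_eq_iff split: split_indicator)
      then show ?thesis using ac_onD(2)[OF F, of s] that x by (simp add: set_lebesgue_integral_def)
    qed
    have Q: "G s = G a + (LBINT t. indicator {t. t < s} t * g0 t)" if "s \<in> {a<..<x}" for s
    proof -
      have "(\<lambda>t. indicator {a<..<s} t * g t) = (\<lambda>t. indicator {t. t < s} t * g0 t)"
        using that by (auto simp: g0_def fun_eq_iff split: split_indicator)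
      then show ?thesis using ac_onD(2)[OF G, of s] that x by (simp add: set_lebesgue_integral_def)
    qed
    define P0 where "P0 = (LBINT s. f0 s)"
    define Q0 where "Q0 = (LBINT s. g0 s)"
    have Fx: "F x = F a + P0" and Gx: "G x = G a + Q0"
      using ac_onD(2)[OF F x] ac_onD(2)[OF G x]
      by (simp_all add: P0_def Q0_def f0_def g0_def set_lebesgue_integral_def)
    \<comment> \<open>Removing the contributions of the constants \<open>G a\<close> and
      \<open>F a\<close> leaves exactly the integrands over the two triangles.\<close>
    have e1: "indicator {a<..<x} s *\<^sub>R (f s * G s) - G a * f0 s = f0 s * (LBINT t. indicator {t. t < s} t * g0 t)" for s
      using Q[of s] by (auto simp: f0_def algebra_simps split: split_indicator)
    have e2: "indicator {a<..<x} s *\<^sub>R (F s * g s) - F a * g0 s = (LBINT t. indicator {t. t < s} t * f0 t) * g0 s" for s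
      using P[of s] by (auto simp: g0_def algebra_simps split: split_indicator)
    have "P0 * Q0 = (LBINT s. indicator {a<..<x} s *\<^sub>R (f s * G s) - G a * f0 s)
        + (LBINT s. indicator {a<..<x} s *\<^sub>R (F s * g s) - F a * g0 s)"
      unfolding e1 e2 P0_def Q0_def by (rule integral_mult_integral_split[OF i0])
    also have "\<dots> = (LBINT s:{a<..<x}. f s * G s) - G a * P0 + ((LBINT s:{a<..<x}. F s * g s) - F a * Q0)"
      using i0 sub[OF iFg] sub[OF iGf]
      by (simp add: P0_def Q0_def set_lebesgue_integral_def set_integrable_def)
    also have "\<dots> = (LBINT s:{a<..<x}. f s * G s + F s * g s) - G a * P0 - F a * Q0"
      using sub[OF iFg] sub[OF iGf] by simp
    finally show ?thesis by (simp add: Fx Gx algebra_simps)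
  qed
  then show ?thesis
    unfolding ac_on_def using set_integral_add(1)[OF iGf iFg] by blast
qed

lemma ac_on_C1:
  assumes "\<And>x. x \<in> {a..b} \<Longrightarrow> (F has_real_derivative f x) (at x)" "continuous_on {a..b} f"
  shows "ac_on a b F f"
proof -
  have "set_integrable lborel {a..b} f"
    using borel_integrable_compact[OF compact_Icc assms(2)] by (simp add: set_integrable_def)
  then have i: "set_integrable lborel {a<..<b} f"
    by (rule set_integrable_subset) auto
  have "F x = F a + (LBINT s:{a<..<x}. f s)" if x: "x \<in> {a..b}" for x
  proof -
    have "(LBINT s:{a..x}. f s) = F x - F a"
      unfolding set_lebesgue_integral_def
    proof (rule integral_FTC_atLeastAtMost)
      show "continuous_on {a..x} f" using assms(2) by (rule continuous_on_subset) (use x in auto)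
      show "(F has_vector_derivative f s) (at s within {a..x})" if "a \<le> s" "s \<le> x" for s
        using assms(1)[of s] that x
        by (auto simp flip: has_real_derivative_iff_has_vector_derivative intro: has_field_derivative_at_within)
    qed (use x in auto)
    moreover have "(LBINT s:{a<..<x}. f s) = (LBINT s:{a..x}. f s)"
    proof (rule set_integral_cong_set)
      show "AE s in lborel. (s \<in> {a..x}) = (s \<in> {a<..<x})"
        using AE_lborel_singleton[of a] AE_lborel_singleton[of x] by eventually_elim (use x in auto)
      have "set_integrable lborel {a..x} f" "set_integrable lborel {a<..<x} f"
        using \<open>set_integrable lborel {a..b} f\<close> by (rule set_integrable_subset; use x in auto)+
      then show "set_borel_measurable lborel {a..x} f" "set_borel_measurable lborel {a<..<x} f"
        by (auto intro: set_integrable_measurable)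
    qed
    ultimately show ?thesis by simp
  qed
  with i show ?thesis unfolding ac_on_def by blast
qed

text \<open>Jacobi's trick: with \<open>T = c tan (c (x - L/2))\<close> one has \<open>T' = c\<^sup>2 + T\<^sup>2\<close>, hence
  \<open>(v + T V)\<^sup>2 = v\<^sup>2 - c\<^sup>2 V\<^sup>2 + (T V\<^sup>2)'\<close>. Taking \<open>c < pi / L\<close> keeps \<open>T\<close> bounded on \<open>[0, L]\<close>.\<close>

lemma wirtinger_aux:
  assumes V: "ac_on 0 L V v" and "V 0 = 0" "V L = 0" and v2: "set_integrable lborel {0<..<L} (\<lambda>x. (v x)\<^sup>2)"
    and "L > 0" "0 < c" "c < pi / L"
  shows "c\<^sup>2 * (LBINT x:{0<..<L}. (V x)\<^sup>2) \<le> (LBINT x:{0<..<L}. (v x)\<^sup>2)"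
proof -
  define T where "T = (\<lambda>x. c * tan (c * (x - L / 2)))"
  have cL: "c * L < pi" using assms by (simp add: field_simps)
  have cos: "cos (c * (x - L / 2)) > 0" if "x \<in> {0..L}" for x
  proof (rule cos_gt_zero_pi)
    have "c * x \<le> c * L" "0 \<le> c * x" using that \<open>0 < c\<close> by auto
    then show "- (pi / 2) < c * (x - L / 2)" "c * (x - L / 2) < pi / 2"
      using cL by (auto simp: algebra_simps)
  qed
  have T: "ac_on 0 L T (\<lambda>x. c\<^sup>2 + (T x)\<^sup>2)"
  proof (rule ac_on_C1)
    fix x assume "x \<in> {0..L}"
    then have c: "cos (c * (x - L / 2)) \<noteq> 0" using cos by fastforce
    have "(T has_real_derivative c * (inverse ((cos (c * (x - L / 2)))\<^sup>2) * (c * (1 - 0)))) (at x)"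
      unfolding T_def using c by (auto intro!: derivative_eq_intros)
    also have "inverse ((cos (c * (x - L / 2)))\<^sup>2) = 1 + (tan (c * (x - L / 2)))\<^sup>2"
      by (simp add: tan_sec[OF c] power_inverse)
    also have "c * ((1 + (tan (c * (x - L / 2)))\<^sup>2) * (c * (1 - 0))) = c\<^sup>2 + (T x)\<^sup>2"
      by (simp add: T_def power2_eq_square algebra_simps)
    finally show "(T has_real_derivative c\<^sup>2 + (T x)\<^sup>2) (at x)" .
  next
    show "continuous_on {0..L} (\<lambda>x. c\<^sup>2 + (T x)\<^sup>2)"
      unfolding T_def using cos by (intro continuous_intros) (auto dest!: less_imp_neq[OF cos, symmetric])
  qed
  have VV: "ac_on 0 L (\<lambda>x. V x * V x) (\<lambda>x. v x * V x + V x * v x)" by (rule ac_on_mult[OF V V])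
  define d where "d = (\<lambda>x. (c\<^sup>2 + (T x)\<^sup>2) * (V x * V x) + T x * (v x * V x + V x * v x))"
  have TVV: "ac_on 0 L (\<lambda>x. T x * (V x * V x)) d"
    unfolding d_def by (rule ac_on_mult[OF T VV])
  have d0: "(LBINT x:{0<..<L}. d x) = 0"
    using ac_onD(2)[OF TVV, of L] assms by simp
  have iV: "set_integrable lborel {0<..<L} (\<lambda>x. (V x)\<^sup>2)"
  proof -
    have one: "set_integrable lborel {0<..<L} (\<lambda>x. 1 :: real)"
      using ac_onD(1)[OF ac_on_C1[of 0 L "\<lambda>x. x" "\<lambda>x. 1"]] by auto
    show ?thesis using ac_on_mult_integrable[OF VV one] by (simp add: power2_eq_square)
  qed
  have "0 \<le> (LBINT x:{0<..<L}. (v x + T x * V x)\<^sup>2)"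
    unfolding set_lebesgue_integral_def by (intro Bochner_Integration.integral_nonneg) auto
  also have "(\<lambda>x. (v x + T x * V x)\<^sup>2) = (\<lambda>x. (v x)\<^sup>2 + d x - c\<^sup>2 * (V x)\<^sup>2)"
    by (auto simp: d_def fun_eq_iff power2_eq_square algebra_simps)
  also have "(LBINT x:{0<..<L}. (v x)\<^sup>2 + d x - c\<^sup>2 * (V x)\<^sup>2)
      = (LBINT x:{0<..<L}. (v x)\<^sup>2) + (LBINT x:{0<..<L}. d x) - c\<^sup>2 * (LBINT x:{0<..<L}. (V x)\<^sup>2)"
    using v2 iV ac_onD(1)[OF TVV] by simp
  finally show ?thesis using d0 by simp
qed

text \<open>The two integrals do not involve \<open>c\<close>, so \<open>c\<close> may increase to
  \<open>pi / L\<close>. The limit is unavoidable, because at \<open>c = pi / L\<close> the tangent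
  blows up at both ends.\<close>

lemma wirtinger:
  assumes "ac_on 0 L V v" "V 0 = 0" "V L = 0" "set_integrable lborel {0<..<L} (\<lambda>x. (v x)\<^sup>2)" "L > 0"
  shows "(pi / L)\<^sup>2 * (LBINT x:{0<..<L}. (V x)\<^sup>2) \<le> (LBINT x:{0<..<L}. (v x)\<^sup>2)"
proof (rule tendsto_upperbound[where F = "at_left (pi / L)"])
  show "((\<lambda>c. c\<^sup>2 * (LBINT x:{0<..<L}. (V x)\<^sup>2)) \<longlongrightarrow> (pi / L)\<^sup>2 * (LBINT x:{0<..<L}. (V x)\<^sup>2)) (at_left (pi / L))"
    by (intro tendsto_intros)
  have "0 < pi / L" using \<open>L > 0\<close> by simp
  then have "eventually (\<lambda>c. c \<in> {0<..<pi / L}) (at_left (pi / L))"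
    by (intro eventually_at_leftI) auto
  then show "\<forall>\<^sub>F c in at_left (pi / L). c\<^sup>2 * (LBINT x:{0<..<L}. (V x)\<^sup>2) \<le> (LBINT x:{0<..<L}. (v x)\<^sup>2)"
    by eventually_elim (use wirtinger_aux[OF assms] in auto)
qed simp

section \<open>Weak derivatives on lines\<close>

lemma set_integral_cong_AE2:
  fixes f g :: "'a \<Rightarrow> real"
  assumes "set_borel_measurable M A f" "set_borel_measurable M A g" "AE x\<in>A in M. f x = g x"
  shows "(LINT x:A|M. f x) = (LINT x:A|M. g x)"
  unfolding set_lebesgue_integral_def
  by (rule integral_cong_AE)
    (use assms in \<open>auto simp: set_borel_measurable_def elim!: eventually_mono split: split_indicator\<close>)

lemma set_integrable_imp_locally_integrable:
  assumes "set_integrable lborel \<Omega> f"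
  shows "locally_integrable \<Omega> f"
  unfolding locally_integrable_def
proof (intro allI impI)
  fix K assume "compact K \<and> K \<subseteq> \<Omega>"
  with assms show "set_integrable lborel K f"
    by (intro set_integrable_subset[OF assms]) (auto intro: borel_compact)
qed

lemma set_integral_slices:
  fixes f :: "'a::euclidean_space \<times> 'b::euclidean_space \<Rightarrow> real"
  assumes f: "set_integrable lborel (X \<times> Z) f"
  shows "AE z\<in>Z in lborel. set_integrable lborel X (\<lambda>x. f (x, z))"
    and "set_integrable lborel Z (\<lambda>z. LBINT x:X. f (x, z))"
    and "(LBINT p:X \<times> Z. f p) = (LBINT z:Z. LBINT x:X. f (x, z))"
proof -
  have i: "integrable (lborel \<Otimes>\<^sub>M lborel) (\<lambda>(x, z). indicator X x * (indicator Z z * f (x, z)))"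
    using f by (simp add: set_integrable_def lborel_prod indicator_times case_prod_unfold mult.assoc)
  have "AE z in lborel. integrable lborel (\<lambda>x. indicator X x * (indicator Z z * f (x, z)))"
    by (rule lborel_pair.AE_integrable_snd[OF i])
  then show "AE z\<in>Z in lborel. set_integrable lborel X (\<lambda>x. f (x, z))"
    by eventually_elim (auto simp: set_integrable_def)
  have eq: "(LBINT x. indicator X x * (indicator Z z * f (x, z))) = indicator Z z *\<^sub>R (LBINT x:X. f (x, z))"
    for z
    by (auto simp: set_lebesgue_integral_def split: split_indicator)
  show "set_integrable lborel Z (\<lambda>z. LBINT x:X. f (x, z))"
    unfolding set_integrable_def eq[symmetric] by (rule lborel_pair.integrable_snd[OF i])
  have "(LBINT p:X \<times> Z. f p) = (\<integral>(x, z). indicator X x * (indicator Z z * f (x, z)) \<partial>(lborel \<Otimes>\<^sub>M lborel))"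
    by (simp add: set_lebesgue_integral_def lborel_prod indicator_times case_prod_unfold mult.assoc)
  also have "\<dots> = (LBINT z. LBINT x. indicator X x * (indicator Z z * f (x, z)))"
    by (rule lborel_pair.integral_snd[OF i, symmetric])
  finally show "(LBINT p:X \<times> Z. f p) = (LBINT z:Z. LBINT x:X. f (x, z))"
    unfolding eq set_lebesgue_integral_def .
qed

lemma AE_slices:
  fixes P :: "'a::euclidean_space \<times> 'b::euclidean_space \<Rightarrow> bool"
  assumes "AE p in lborel. P p"
  shows "AE z in lborel. AE x in lborel. P (x, z)"
proof -
  have eq: "(lborel :: ('a \<times> 'b) measure) = distr (lborel \<Otimes>\<^sub>M lborel) (lborel \<Otimes>\<^sub>M lborel) (\<lambda>(x, y). (y, x))"
    using lborel_pair.distr_pair_swap[where ?'a = 'a and ?'b = 'b] by (simp only: lborel_prod)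
  have "AE p in lborel \<Otimes>\<^sub>M lborel. P (case p of (x, y) \<Rightarrow> (y, x))"
    using assms unfolding eq by (rule AE_distrD[rotated]) measurable
  then have "AE z in lborel. AE x in lborel. P (case (z, x) of (x, y) \<Rightarrow> (y, x))"
    by (rule lborel_pair.AE_pair)
  then show ?thesis by simp
qed

lemma AE_from_slices:
  fixes P :: "'a::euclidean_space \<times> 'b::euclidean_space \<Rightarrow> bool"
  assumes "{p. P p} \<in> sets borel" "AE z in lborel. AE x in lborel. P (x, z)"
  shows "AE p in lborel. P p"
proof -
  have m: "{p \<in> space (lborel \<Otimes>\<^sub>M (lborel :: 'b measure)). P (fst p, snd p)} \<in> sets (lborel \<Otimes>\<^sub>M (lborel :: 'b measure))"
    unfolding lborel_prod using assms(1) by simp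
  have "AE x in lborel. AE z in lborel. P (x, z)"
    using assms(2) lborel_pair.AE_commute[OF m] by simp
  then have "AE p in lborel \<Otimes>\<^sub>M lborel. P (fst p, snd p)"
    using lborel_pair.AE_pair_iff[OF m] by simp
  then show ?thesis unfolding lborel_prod by simp
qed

lemma set_integrable_mult_test_function:
  assumes "set_integrable lborel A f" "A \<in> sets borel" "test_function X \<phi>"
  shows "set_integrable lborel A (\<lambda>p. \<phi> p * f p)"
proof -
  obtain C where "\<And>x. \<bar>\<phi> x\<bar> \<le> C" using test_function_bounded[OF assms(3)] by blast
  moreover have "set_borel_measurable lborel A \<phi>"
    using assms(2) test_function_smooth[OF assms(3)] unfolding set_borel_measurable_def by measurable
  ultimately show ?thesis
    using assms by (intro set_integrable_bounded_mult[of _ _ _ C]) auto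
qed

lemma compact_subset_greaterThanLessThan:
  fixes a b :: real
  assumes "compact K" "K \<subseteq> {a<..<b}" "a < b"
  obtains p q where "K \<subseteq> {p..q}" "a < p" "q < b" "p \<le> q"
proof (cases "K = {}")
  case True
  have "K \<subseteq> {(a + b) / 2..(a + b) / 2}" using True by simp
  then show thesis by (rule that) (use \<open>a < b\<close> in auto)
next
  case False
  obtain p q where "p \<in> K" "\<And>x. x \<in> K \<Longrightarrow> p \<le> x" "q \<in> K" "\<And>x. x \<in> K \<Longrightarrow> x \<le> q"
    using compact_attains_inf[OF assms(1) False] compact_attains_sup[OF assms(1) False] by metis
  then show thesis using assms by (intro that[of p q]) auto
qed

lemma smooth_ac_on:
  assumes "smooth \<theta>"
  shows "ac_on a b \<theta> (partial_deriv 1 \<theta>)"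
  by (rule ac_on_C1)
    (use assms in \<open>auto intro!: smooth_real_has_derivative smooth_imp_continuous smooth_partial_deriv\<close>)

text \<open>The antiderivative that vanishes at \<open>a\<close> stays 0 up to the support of
  \<zeta> and is constant beyond it; the vanishing mean makes that constant 0.\<close>

lemma test_function_antiderivative:
  fixes a b :: real
  assumes \<zeta>: "test_function {a<..<b} \<zeta>" and "a < b" and int: "(LBINT x:{a<..<b}. \<zeta> x) = 0"
  obtains \<kappa> where "test_function {a<..<b} \<kappa>" "partial_deriv 1 \<kappa> = \<zeta>"
proof -
  have cont: "continuous_on A \<zeta>" for A using \<zeta> by (intro smooth_imp_continuous test_function_smooth)
  have "\<exists>F. \<forall>x::real. -\<infinity> < ereal x \<longrightarrow> ereal x < \<infinity> \<longrightarrow> (F has_vector_derivative \<zeta> x) (at x)"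
    by (rule einterval_antiderivative) (use cont[of UNIV] in \<open>auto simp: continuous_on_eq_continuous_at\<close>)
  then obtain F where F: "\<And>x. (F has_real_derivative \<zeta> x) (at x)"
    by (auto simp: has_real_derivative_iff_has_vector_derivative)
  have ac: "ac_on c d F \<zeta>" for c d by (rule ac_on_C1[OF F cont])
  define \<kappa> where "\<kappa> x = F x - F a" for x
  have d: "(\<kappa> has_real_derivative \<zeta> x) (at x)" for x
    unfolding \<kappa>_def by (auto intro!: derivative_eq_intros F)
  then have pd: "partial_deriv 1 \<kappa> = \<zeta>"
    using partial_deriv_eq[of \<kappa> "(*) (\<zeta> _)" _ 1] by (auto simp: has_field_derivative_def fun_eq_iff)
  have "C_k k \<kappa>" for k
    using C_k_Suc_realI[OF d] test_function_smooth[OF \<zeta>] C_k_SucD unfolding smooth_def by blast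
  then have s: "smooth \<kappa>" by (simp add: smooth_def)
  obtain K where K: "compact K" "K \<subseteq> {a<..<b}" "\<And>x. x \<notin> K \<Longrightarrow> \<zeta> x = 0"
    using \<zeta> unfolding test_function_def by metis
  obtain p q where pq: "K \<subseteq> {p..q}" "a < p" "q < b" "p \<le> q"
    by (rule compact_subset_greaterThanLessThan[OF K(1,2) \<open>a < b\<close>])
  have same: "F s = F t" if "s \<le> t" "{s<..<t} \<inter> {p..q} = {}" for s t
  proof -
    have "(LBINT x:{s<..<t}. \<zeta> x) = (LBINT x:{s<..<t}. 0)"
      using that(2) pq(1) K(3) by (intro set_lebesgue_integral_cong) (simp, blast)
    then show ?thesis using ac_on_diff[OF ac, of s s t t] that by simp
  qed
  have Fb: "F b = F a" using ac_on_diff[OF ac, of a a b b] \<open>a < b\<close> int by simp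
  have "\<kappa> x = 0" if "x \<notin> {p..q}" for x
  proof -
    have "x < p \<or> q < x" using that by (simp add: not_le)
    then consider "x \<le> a" | "a \<le> x" "x < p" | "q < x" "x \<le> b" | "b \<le> x"
      by (meson linear)
    then have "F x = F a"
    proof cases
      case 1
      then show ?thesis by (rule same) (use pq in auto)
    next
      case 2
      then show ?thesis by (intro same[symmetric]) (use pq in auto)
    next
      case 3
      then have "F x = F b" by (intro same) (use pq in auto)
      with Fb show ?thesis by (rule trans[rotated])
    next
      case 4
      then have "F b = F x" by (intro same) (use pq in auto)
      with Fb show ?thesis by (metis)
    qed
    then show ?thesis by (simp add: \<kappa>_def)
  qed
  then have "test_function {a<..<b} \<kappa>"
    unfolding test_function_def using s pq by (intro conjI exI[of _ "{p..q}"]) auto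
  with pd show thesis using that by blast
qed

lemma test_function_lincomb:
  assumes "test_function X \<phi>" "test_function X \<psi>"
  shows "test_function X (\<lambda>x. c * \<phi> x + d * \<psi> x)"
proof -
  obtain K1 K2 where "compact K1" "K1 \<subseteq> X" "\<And>x. x \<notin> K1 \<Longrightarrow> \<phi> x = 0"
      "compact K2" "K2 \<subseteq> X" "\<And>x. x \<notin> K2 \<Longrightarrow> \<psi> x = 0"
    using assms unfolding test_function_def by metis
  then have "compact (K1 \<union> K2) \<and> K1 \<union> K2 \<subseteq> X \<and> (\<forall>x. x \<notin> K1 \<union> K2 \<longrightarrow> c * \<phi> x + d * \<psi> x = 0)"
    by auto
  moreover have "smooth (\<lambda>x. c * \<phi> x + d * \<psi> x)"
    using assms unfolding test_function_def smooth_def by (auto intro!: C_k_add C_k_mult C_k_const)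
  ultimately show ?thesis unfolding test_function_def by blast
qed

lemma AE_Ioo_witness:
  assumes "AE x in lborel. x \<in> {a<..<b} \<longrightarrow> P x" "a < (b::real)"
  obtains x where "x \<in> {a<..<b}" "P x"
proof (rule ccontr)
  assume "\<not> thesis"
  with that have *: "\<not> P x" if "x \<in> {a<..<b}" for x using that by blast
  have "AE x in lborel. x \<notin> {a<..<b}" using assms(1) by eventually_elim (use * in blast)
  then have "{a<..<b} \<in> null_sets lborel" by (subst AE_iff_null_sets) auto
  then have "emeasure lborel {a<..<b} = 0" by auto
  then show False using assms(2) by simp
qed

text \<open>If every test function had integral 0, the constant 1 would be orthogonal to all bumps
  and hence vanish almost everywhere. This spares computing the integral of a bump; normalising does
  the rest.\<close>

lemma test_function_integral_1:
  assumes "a < (b::real)"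
  obtains \<omega> where "test_function {a<..<b} \<omega>" "(LBINT x:{a<..<b}. \<omega> x) = 1"
proof -
  have "\<exists>\<theta>. test_function {a<..<b} \<theta> \<and> (LBINT x:{a<..<b}. \<theta> x) \<noteq> 0"
  proof (rule ccontr)
    assume *: "\<not> ?thesis"
    have "AE x in lborel. x \<in> {a<..<b} \<longrightarrow> (1::real) = 0"
    proof (rule AE_zero_if_orthogonal_to_bumps)
      show "locally_integrable {a<..<b} (\<lambda>_. 1 :: real)"
        unfolding locally_integrable_def set_integrable_def
        by (intro allI impI borel_integrable_compact continuous_on_const) auto
      fix p q :: real and n assume "cbox p q \<subseteq> {a<..<b}"
      then have "test_function {a<..<b} (box_bump p q n)"
        using box_subset_cbox by (metis order_trans test_function_box_bump test_function_mono)
      then show "(LBINT x:{a<..<b}. 1 * box_bump p q n x) = 0" using * by simp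
    qed simp
    then show False
      by (rule AE_Ioo_witness[OF _ assms]) simp
  qed
  then obtain \<theta> where \<theta>: "test_function {a<..<b} \<theta>" "(LBINT x:{a<..<b}. \<theta> x) \<noteq> 0" by blast
  have "test_function {a<..<b} (\<lambda>x. 1 / (LBINT x:{a<..<b}. \<theta> x) * \<theta> x + 0 * \<theta> x)"
    by (rule test_function_lincomb) (rule \<theta>)+
  then show thesis
    by (rule that) (use \<theta>(2) in simp)
qed

text \<open>The function \<open>h(x, z) = f(x, z) - \<integral>\<^sub>a\<^sup>x g(s, z) ds\<close> has vanishing weak
  derivative, so it agrees with its average \<open>c(z)\<close> against a fixed weight \<open>\<omega>\<close>.\<close>

theorem weak_deriv_imp_ac_on_lines:
  fixes f g :: "real \<times> 'b::euclidean_space \<Rightarrow> real"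
  assumes "a < b" "open Z"
    and f: "set_integrable lborel ({a<..<b} \<times> Z) f" and g: "set_integrable lborel ({a<..<b} \<times> Z) g"
    and weak: "\<And>\<theta> \<psi>. test_function {a<..<b} \<theta> \<Longrightarrow> test_function Z \<psi> \<Longrightarrow>
      (LBINT p:{a<..<b} \<times> Z. f p * tensor (partial_deriv 1 \<theta>) \<psi> p)
        = - (LBINT p:{a<..<b} \<times> Z. g p * tensor \<theta> \<psi> p)"
  shows "AE z\<in>Z in lborel.
    (\<exists>F. ac_on a b F (\<lambda>x. g (x, z)) \<and> (AE x in lborel. x \<in> {a<..<b} \<longrightarrow> f (x, z) = F x))"
proof -
  let ?I = "{a<..<b}" and ?\<Omega> = "{a<..<b} \<times> Z"
  have [measurable]: "Z \<in> sets borel" "?\<Omega> \<in> sets borel"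
    using \<open>open Z\<close> by (auto intro!: borel_open open_Times)
  define G where "G p = (LBINT s:{a<..<fst p}. g (s, snd p))" for p
  have G_ac: "ac_on a b (\<lambda>x. G (x, z)) (\<lambda>x. g (x, z))" if "set_integrable lborel ?I (\<lambda>x. g (x, z))" for z
    using that by (auto simp: ac_on_def G_def set_lebesgue_integral_def)
  have g_int: "AE z\<in>Z in lborel. set_integrable lborel ?I (\<lambda>x. g (x, z))"
    by (rule set_integral_slices(1)[OF g])
  have one: "integrable lborel (\<lambda>x. indicator ?I x :: real)"
    by (rule integrable_real_indicator) (use \<open>a < b\<close> in auto)
  \<comment> \<open>Dominated by the tensor product of the indicator of the interval with the
    function z -> integral of |g(s, z)| over s. Joint measurability comes from writing the upper
    limit as a factor \<open>of_bool (s < fst p)\<close> under the integral.\<close>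
  have G: "set_integrable lborel ?\<Omega> G"
    unfolding set_integrable_def
  proof (rule Bochner_Integration.integrable_bound)
    let ?\<gamma> = "\<lambda>z. LBINT x:?I. \<bar>g (x, z)\<bar>"
    have "set_integrable lborel Z ?\<gamma>"
      using set_integral_slices(2)[OF set_integrable_abs[OF g]] .
    then show "integrable lborel (tensor (\<lambda>x. indicator ?I x) (\<lambda>z. indicator Z z *\<^sub>R ?\<gamma> z))"
      by (intro integrable_tensor one) (simp add: set_integrable_def)
    have g0: "(\<lambda>p. indicator ?\<Omega> p * g p) \<in> borel_measurable (lborel \<Otimes>\<^sub>M lborel)"
      using g by (auto simp: set_integrable_def lborel_prod dest!: borel_measurable_integrable)
    have "(\<lambda>p. indicator ?\<Omega> p *\<^sub>R G p) = (\<lambda>p. indicator ?\<Omega> p *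
        (LBINT s. of_bool (s < fst p) * (indicator ?\<Omega> (s, snd p) * g (s, snd p))))"
    proof
      fix p :: "real \<times> 'b"
      show "indicator ?\<Omega> p *\<^sub>R G p = indicator ?\<Omega> p *
        (LBINT s. of_bool (s < fst p) * (indicator ?\<Omega> (s, snd p) * g (s, snd p)))"
      proof (cases "p \<in> ?\<Omega>")
        case True
        then have "(\<lambda>s. indicator {a<..<fst p} s *\<^sub>R g (s, snd p))
            = (\<lambda>s. of_bool (s < fst p) * (indicator ?\<Omega> (s, snd p) * g (s, snd p)))"
          by (auto simp: fun_eq_iff split: split_indicator)
        then show ?thesis unfolding G_def set_lebesgue_integral_def by simp
      qed simp
    qed
    moreover have "(\<lambda>p. LBINT s. of_bool (s < fst p) * (indicator ?\<Omega> (s, snd p) * g (s, snd p)))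
        \<in> borel_measurable (lborel \<Otimes>\<^sub>M lborel)"
    proof (rule lborel.borel_measurable_lebesgue_integral)
      let ?M = "(lborel \<Otimes>\<^sub>M lborel) \<Otimes>\<^sub>M lborel :: ((real \<times> 'b) \<times> real) measure"
      have "(\<lambda>q. indicator ?\<Omega> (snd q, snd (fst q)) * g (snd q, snd (fst q)))
          \<in> borel_measurable ((lborel \<Otimes>\<^sub>M lborel) \<Otimes>\<^sub>M lborel)"
        by (rule measurable_compose[OF _ g0]) measurable
      moreover have "(\<lambda>q. of_bool (snd q < fst (fst q)) :: real) \<in> borel_measurable ?M"
      proof -
        have [measurable]: "(\<lambda>q. fst (fst q)) \<in> borel_measurable ?M"
          using measurable_compose[OF measurable_fst measurable_fst, of lborel lborel lborel]
          by (simp only: measurable_lborel1)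
        have [measurable]: "snd \<in> borel_measurable ?M"
          using measurable_snd[of "lborel \<Otimes>\<^sub>M lborel" lborel] by (simp only: measurable_lborel1)
        have "Measurable.pred ?M (\<lambda>q. snd q < fst (fst q))"
          by (rule borel_measurable_pred_less) (simp_all only: \<open>snd \<in> _\<close> \<open>(\<lambda>q. fst (fst q)) \<in> _\<close>)
        then show ?thesis by (rule measurable_compose[OF _ measurable_of_bool])
      qed
      ultimately show "(\<lambda>(p, s). of_bool (s < fst p) * (indicator ?\<Omega> (s, snd p) * g (s, snd p)))
          \<in> borel_measurable ((lborel \<Otimes>\<^sub>M lborel) \<Otimes>\<^sub>M lborel)"
        unfolding case_prod_unfold by (rule borel_measurable_times[rotated])
    qed
    ultimately show "(\<lambda>p. indicator ?\<Omega> p *\<^sub>R G p) \<in> borel_measurable lborel"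
      by (simp add: lborel_prod)
    have [measurable]: "(\<lambda>p. indicator ?\<Omega> p *\<^sub>R G p) \<in> borel_measurable borel"
      using \<open>(\<lambda>p. indicator ?\<Omega> p *\<^sub>R G p) \<in> borel_measurable lborel\<close> by simp
    have [measurable]: "tensor (\<lambda>x. indicator ?I x) (\<lambda>z. indicator Z z *\<^sub>R ?\<gamma> z) \<in> borel_measurable borel"
      using borel_measurable_integrable[OF \<open>integrable lborel (tensor _ _)\<close>] by simp
    show "AE p in lborel. norm (indicator ?\<Omega> p *\<^sub>R G p)
        \<le> norm (tensor (\<lambda>x. indicator ?I x) (\<lambda>z. indicator Z z *\<^sub>R ?\<gamma> z) p)"
    proof (rule AE_from_slices)
      show "AE z in lborel. AE x in lborel. norm (indicator ?\<Omega> (x, z) *\<^sub>R G (x, z))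
          \<le> norm (tensor (\<lambda>x. indicator ?I x) (\<lambda>z. indicator Z z *\<^sub>R ?\<gamma> z) (x, z))"
        using g_int
      proof eventually_elim
        case (elim z)
        have "\<bar>G (x, z)\<bar> \<le> \<bar>?\<gamma> z\<bar>" if "x \<in> ?I" "z \<in> Z" for x
        proof -
          have i: "set_integrable lborel ?I (\<lambda>x. g (x, z))" using elim that by simp
          have ix: "set_integrable lborel {a<..<x} (\<lambda>x. g (x, z))"
            using i by (rule set_integrable_subset) (use that in auto)
          have "\<bar>G (x, z)\<bar> \<le> (LBINT s:{a<..<x}. \<bar>g (s, z)\<bar>)"
            using set_integral_norm_bound[OF ix] by (simp add: G_def)
          also have "\<dots> \<le> ?\<gamma> z"
            unfolding set_lebesgue_integral_def using that set_integrable_abs[OF i] set_integrable_abs[OF ix]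
            by (intro integral_mono) (auto simp: set_integrable_def split: split_indicator)
          finally show ?thesis by simp
        qed
        then show ?case by (auto split: split_indicator)
      qed
    qed measurable
  qed
  define H where "H p = f p - G p" for p
  have H: "set_integrable lborel ?\<Omega> H"
    unfolding H_def using f G by (rule set_integral_diff)
  have int_mult: "set_integrable lborel ?\<Omega> (\<lambda>p. k p * tensor \<theta> \<psi> p)"
    if "set_integrable lborel ?\<Omega> k" "test_function ?I \<theta>" "test_function Z \<psi>" for k \<theta> \<psi>
    using set_integrable_mult_test_function[OF that(1) _ test_function_tensor[OF that(2,3)]]
    by (simp add: mult.commute)
  have pd: "test_function ?I (partial_deriv 1 \<theta>)" if "test_function ?I \<theta>" for \<theta>
    using that by (rule test_function_partial_deriv) simp
  \<comment> \<open>Both \<open>f\<close> and \<open>G\<close> have weak derivative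
    \<open>g\<close>. For \<open>G\<close> this is the product rule with \<theta> on each line,
    where \<theta> vanishes at both ends.\<close>
  have H_weak: "(LBINT p:?\<Omega>. H p * tensor (partial_deriv 1 \<theta>) \<psi> p) = 0"
    if \<theta>: "test_function ?I \<theta>" and \<psi>: "test_function Z \<psi>" for \<theta> \<psi>
  proof -
    have eq: "(LBINT x:?I. G (x, z) * tensor (partial_deriv 1 \<theta>) \<psi> (x, z))
        = - (LBINT x:?I. g (x, z) * tensor \<theta> \<psi> (x, z))"
      if "set_integrable lborel ?I (\<lambda>x. g (x, z))" for z
    proof -
      note ac = G_ac[OF that] smooth_ac_on[OF test_function_smooth[OF \<theta>], of a b]
      have "0 = (LBINT x:?I. g (x, z) * \<theta> x + G (x, z) * partial_deriv 1 \<theta> x)"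
        using ac_onD(2)[OF ac_on_mult[OF ac], of b] \<open>a < b\<close> test_function_eq_0[OF \<theta>, of a] test_function_eq_0[OF \<theta>, of b]
        by simp
      also have "\<dots> = (LBINT x:?I. g (x, z) * \<theta> x) + (LBINT x:?I. G (x, z) * partial_deriv 1 \<theta> x)"
        using ac_on_mult_integrable[OF ac(2) that]
          ac_on_mult_integrable[OF ac(1) ac_onD(1)[OF ac(2)]]
        by (intro set_integral_add) (simp_all add: mult.commute)
      finally have "(LBINT x:?I. G (x, z) * partial_deriv 1 \<theta> x) = - (LBINT x:?I. g (x, z) * \<theta> x)"
        by simp
      then show ?thesis by (simp add: mult.assoc[symmetric])
    qed
    have "(LBINT p:?\<Omega>. G p * tensor (partial_deriv 1 \<theta>) \<psi> p)
        = (LBINT z:Z. LBINT x:?I. G (x, z) * tensor (partial_deriv 1 \<theta>) \<psi> (x, z))"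
      by (rule set_integral_slices(3)[OF int_mult[OF G pd[OF \<theta>] \<psi>]])
    also have "\<dots> = (LBINT z:Z. - (LBINT x:?I. g (x, z) * tensor \<theta> \<psi> (x, z)))"
    proof (rule set_integral_cong_AE2)
      show "AE z\<in>Z in lborel. (LBINT x:?I. G (x, z) * tensor (partial_deriv 1 \<theta>) \<psi> (x, z))
          = - (LBINT x:?I. g (x, z) * tensor \<theta> \<psi> (x, z))"
        using g_int by eventually_elim (use eq in blast)
      show "set_borel_measurable lborel Z (\<lambda>z. LBINT x:?I. G (x, z) * tensor (partial_deriv 1 \<theta>) \<psi> (x, z))"
        by (intro set_integrable_measurable set_integral_slices(2) int_mult G pd \<theta> \<psi>)
      have "set_integrable lborel Z (\<lambda>z. - 1 * (LBINT x:?I. g (x, z) * tensor \<theta> \<psi> (x, z)))"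
        by (intro set_integrable_mult_right set_integral_slices(2) int_mult g \<theta> \<psi>)
      then show "set_borel_measurable lborel Z (\<lambda>z. - (LBINT x:?I. g (x, z) * tensor \<theta> \<psi> (x, z)))"
        by (intro set_integrable_measurable) simp
    qed
    also have "\<dots> = - (LBINT p:?\<Omega>. g p * tensor \<theta> \<psi> p)"
      using set_integral_slices(2,3)[OF int_mult[OF g \<theta> \<psi>]] by (simp add: set_integral_uminus)
    finally show ?thesis
      using weak[OF \<theta> \<psi>] int_mult[OF G pd[OF \<theta>] \<psi>] int_mult[OF f pd[OF \<theta>] \<psi>]
      by (simp add: H_def left_diff_distrib)
  qed
  obtain \<omega> where \<omega>: "test_function ?I \<omega>" "(LBINT x:?I. \<omega> x) = 1"
    using test_function_integral_1[OF \<open>a < b\<close>] by blast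
  define c where "c z = (LBINT x:?I. \<omega> x * H (x, z))" for z
  have \<omega>H: "set_integrable lborel ?\<Omega> (\<lambda>p. \<omega> (fst p) * H p)"
  proof -
    obtain C where "\<And>x. \<bar>\<omega> x\<bar> \<le> C" using test_function_bounded[OF \<omega>(1)] by blast
    moreover have "set_borel_measurable lborel ?\<Omega> (\<lambda>p. \<omega> (fst p))"
    proof -
      have "continuous_on UNIV (\<lambda>p. \<omega> (fst p :: real))"
        using smooth_imp_continuous[OF test_function_smooth[OF \<omega>(1)], of UNIV]
        by (rule continuous_on_compose2) (auto intro: continuous_intros)
      then have "(\<lambda>p :: real \<times> 'b. \<omega> (fst p)) \<in> borel_measurable borel"
        by (rule borel_measurable_continuous_onI)
      then show ?thesis unfolding set_borel_measurable_def by measurable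
    qed
    ultimately show ?thesis
      using H by (intro set_integrable_bounded_mult[of _ _ _ C]) auto
  qed
  have c: "set_integrable lborel Z c"
    using set_integral_slices(2)[OF \<omega>H] by (simp add: c_def[abs_def])
  have c_snd: "set_integrable lborel ?\<Omega> (\<lambda>p. c (snd p))"
  proof -
    have "(\<lambda>p. indicator ?\<Omega> p *\<^sub>R c (snd p)) = tensor (\<lambda>x. indicator ?I x) (\<lambda>z. indicator Z z *\<^sub>R c z)"
      by (auto simp: fun_eq_iff split: split_indicator)
    moreover have "integrable lborel (\<lambda>z. indicator Z z *\<^sub>R c z)"
      using c by (simp add: set_integrable_def)
    ultimately show ?thesis
      using integrable_tensor[OF one] by (simp only: set_integrable_def)
  qed
  have "AE p\<in>?\<Omega> in lborel. H p - c (snd p) = 0"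
  proof (rule AE_zero_if_orthogonal_to_tensors)
    have "set_integrable lborel ?\<Omega> (\<lambda>p. H p - c (snd p))"
      using H c_snd by (rule set_integral_diff)
    then show "locally_integrable ?\<Omega> (\<lambda>p. H p - c (snd p))"
      by (rule set_integrable_imp_locally_integrable)
    fix \<theta> \<psi> assume \<theta>: "test_function ?I \<theta>" and \<psi>: "test_function Z \<psi>"
    define m where "m = (LBINT x:?I. \<theta> x)"
    have i1: "set_integrable lborel ?I \<phi>" if "test_function ?I \<phi>" for \<phi> :: "real \<Rightarrow> real"
      using set_integrable_mult_test_function[OF _ _ that, of ?I "\<lambda>_. 1"] one by (simp add: set_integrable_def)
    \<comment> \<open>Subtracting \<open>m\<close> times the weight \<omega> gives mean 0, so
      \<zeta> is the derivative of a test function. As \<open>H\<close> is orthogonal to such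
      derivatives, testing with \<theta> amounts to testing with \<open>m\<close> times \<omega>,
      that is, to testing \<open>c\<close>.\<close>
    let ?\<zeta> = "\<lambda>x. 1 * \<theta> x + (- m) * \<omega> x"
    have \<zeta>: "test_function ?I ?\<zeta>" by (rule test_function_lincomb[OF \<theta> \<omega>(1)])
    have "(LBINT x:?I. ?\<zeta> x) = 0"
      using i1[OF \<theta>] i1[OF \<omega>(1)] \<omega>(2) by (simp add: m_def set_integral_diff)
    then obtain \<kappa> where \<kappa>: "test_function ?I \<kappa>" "partial_deriv 1 \<kappa> = ?\<zeta>"
      using test_function_antiderivative[OF \<zeta> \<open>a < b\<close>] by blast
    have "0 = (LBINT p:?\<Omega>. H p * tensor \<theta> \<psi> p - m * (H p * tensor \<omega> \<psi> p))"
      using H_weak[OF \<kappa>(1) \<psi>] unfolding \<kappa>(2) by (simp add: tensor_def algebra_simps)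
    also have "\<dots> = (LBINT p:?\<Omega>. H p * tensor \<theta> \<psi> p) - m * (LBINT p:?\<Omega>. H p * tensor \<omega> \<psi> p)"
      using int_mult[OF H \<theta> \<psi>] int_mult[OF H \<omega>(1) \<psi>] by simp
    finally have 1: "(LBINT p:?\<Omega>. H p * tensor \<theta> \<psi> p) = m * (LBINT p:?\<Omega>. H p * tensor \<omega> \<psi> p)"
      by simp
    have "(LBINT p:?\<Omega>. c (snd p) * tensor \<theta> \<psi> p)
        = (LBINT z:Z. LBINT x:?I. (c z * \<psi> z) * \<theta> x)"
      using set_integral_slices(3)[OF int_mult[OF c_snd \<theta> \<psi>]] by (simp add: mult_ac)
    also have "\<dots> = m * (LBINT z:Z. c z * \<psi> z)"
      by (simp add: m_def mult.commute)
    also have "(LBINT z:Z. c z * \<psi> z) = (LBINT z:Z. LBINT x:?I. H (x, z) * tensor \<omega> \<psi> (x, z))"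
      by (simp add: c_def mult_ac flip: set_integral_mult_right set_integral_mult_left)
    also have "\<dots> = (LBINT p:?\<Omega>. H p * tensor \<omega> \<psi> p)"
      by (rule set_integral_slices(3)[OF int_mult[OF H \<omega>(1) \<psi>], symmetric])
    finally show "(LBINT p:?\<Omega>. (H p - c (snd p)) * tensor \<theta> \<psi> p) = 0"
      using int_mult[OF H \<theta> \<psi>] int_mult[OF c_snd \<theta> \<psi>] 1 by (simp add: left_diff_distrib)
  qed (use \<open>open Z\<close> in auto)
  then have "AE z in lborel. AE x in lborel. (x, z) \<in> ?\<Omega> \<longrightarrow> H (x, z) - c (snd (x, z)) = 0"
    by (rule AE_slices)
  with g_int show ?thesis
  proof eventually_elim
    case (elim z)
    show ?case
    proof
      assume z: "z \<in> Z"
      define F where "F x = c z + G (x, z)" for x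
      have "ac_on a b F (\<lambda>x. g (x, z))"
        using G_ac[of z] elim(1) z unfolding ac_on_def F_def by (auto simp: G_def set_lebesgue_integral_def)
      moreover have "AE x\<in>?I in lborel. f (x, z) = F x"
        using elim(2) by eventually_elim (use z in \<open>auto simp: H_def F_def\<close>)
      ultimately show "\<exists>F. ac_on a b F (\<lambda>x. g (x, z)) \<and> (AE x\<in>?I in lborel. f (x, z) = F x)"
        by blast
    qed
  qed
qed

section \<open>Square integrable functions\<close>

lemma set_borel_measurable_add:
  fixes f g :: "'a \<Rightarrow> real"
  assumes "set_borel_measurable M A f" "set_borel_measurable M A g"
  shows "set_borel_measurable M A (\<lambda>x. f x + g x)"
proof -
  have "(\<lambda>x. indicator A x *\<^sub>R (f x + g x)) = (\<lambda>x. indicator A x *\<^sub>R f x + indicator A x *\<^sub>R g x)"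
    by (simp add: fun_eq_iff algebra_simps)
  then show ?thesis using assms unfolding set_borel_measurable_def by simp
qed

lemma set_borel_measurable_mult:
  fixes f g :: "'a \<Rightarrow> real"
  assumes "set_borel_measurable M A f" "set_borel_measurable M A g"
  shows "set_borel_measurable M A (\<lambda>x. f x * g x)"
proof -
  have "(\<lambda>x. indicator A x *\<^sub>R (f x * g x)) = (\<lambda>x. (indicator A x *\<^sub>R f x) * (indicator A x *\<^sub>R g x))"
    by (auto simp: fun_eq_iff split: split_indicator)
  then show ?thesis using assms unfolding set_borel_measurable_def by simp
qed

lemma set_borel_measurable_cmult:
  fixes f :: "'a \<Rightarrow> real"
  assumes "set_borel_measurable M A f"
  shows "set_borel_measurable M A (\<lambda>x. c * f x)"
proof -
  have "(\<lambda>x. indicator A x *\<^sub>R (c * f x)) = (\<lambda>x. c * (indicator A x *\<^sub>R f x))"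
    by (simp add: mult_ac)
  then show ?thesis using assms unfolding set_borel_measurable_def by simp
qed

lemma set_integrable_bound_real:
  fixes f g :: "'a \<Rightarrow> real"
  assumes "set_integrable M A g" "set_borel_measurable M A f"
    and "AE x\<in>A in M. \<bar>f x\<bar> \<le> g x"
  shows "set_integrable M A f"
  unfolding set_integrable_def
  by (rule Bochner_Integration.integrable_bound[OF assms(1)[unfolded set_integrable_def]
        assms(2)[unfolded set_borel_measurable_def]])
    (use assms(3) in \<open>auto elim!: eventually_mono split: split_indicator\<close>)

lemma L2_measurable: "L2 \<Omega> f \<Longrightarrow> set_borel_measurable lborel \<Omega> f"
  by (simp add: L2_def)

lemma L2_square_integrable: "L2 \<Omega> f \<Longrightarrow> set_integrable lborel \<Omega> (\<lambda>z. (f z)\<^sup>2)"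
  by (simp add: L2_def)

lemma L2_mult_integrable:
  assumes "L2 \<Omega> f" "L2 \<Omega> g"
  shows "set_integrable lborel \<Omega> (\<lambda>z. f z * g z)"
proof (rule set_integrable_bound_real)
  show "set_integrable lborel \<Omega> (\<lambda>z. (f z)\<^sup>2 + (g z)\<^sup>2)"
    using assms by (intro set_integral_add L2_square_integrable)
  show "set_borel_measurable lborel \<Omega> (\<lambda>z. f z * g z)"
    using assms by (intro set_borel_measurable_mult L2_measurable)
  have "\<bar>f z * g z\<bar> \<le> (f z)\<^sup>2 + (g z)\<^sup>2" for z
    using sum_squares_bound[of "\<bar>f z\<bar>" "\<bar>g z\<bar>"] mult_nonneg_nonneg[OF abs_ge_zero abs_ge_zero, of "f z" "g z"]
    unfolding abs_mult power2_abs by linarith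
  then show "AE z\<in>\<Omega> in lborel. \<bar>f z * g z\<bar> \<le> (f z)\<^sup>2 + (g z)\<^sup>2" by simp
qed

lemma L2_cmult: "L2 \<Omega> f \<Longrightarrow> L2 \<Omega> (\<lambda>z. c * f z)"
  unfolding L2_def by (auto simp: power_mult_distrib intro: set_borel_measurable_cmult)

lemma L2_add:
  assumes "L2 \<Omega> f" "L2 \<Omega> g"
  shows "L2 \<Omega> (\<lambda>z. f z + g z)"
proof -
  have "set_integrable lborel \<Omega> (\<lambda>z. ((f z)\<^sup>2 + (g z)\<^sup>2) + 2 * (f z * g z))"
    using assms by (intro set_integral_add set_integrable_mult_right L2_square_integrable L2_mult_integrable)
  then show ?thesis
    using assms unfolding L2_def by (auto simp: power2_sum mult.assoc intro: set_borel_measurable_add)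
qed

lemma L2_diff: "L2 \<Omega> f \<Longrightarrow> L2 \<Omega> g \<Longrightarrow> L2 \<Omega> (\<lambda>z. f z - g z)"
  using L2_add[of \<Omega> f "\<lambda>z. - 1 * g z"] L2_cmult[of \<Omega> g "- 1"] by simp

lemma L2_cong_AE:
  assumes "L2 \<Omega> f" "set_borel_measurable lborel \<Omega> g" "AE z\<in>\<Omega> in lborel. f z = g z"
  shows "L2 \<Omega> g"
proof -
  have "set_borel_measurable lborel \<Omega> (\<lambda>z. (g z)\<^sup>2)"
    unfolding power2_eq_square using assms(2) by (intro set_borel_measurable_mult)
  then have "set_integrable lborel \<Omega> (\<lambda>z. (g z)\<^sup>2)"
    by (rule set_integrable_bound_real[OF L2_square_integrable[OF assms(1)]])
      (use assms(3) in \<open>auto elim!: eventually_mono\<close>)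
  with assms(2) show ?thesis by (simp add: L2_def)
qed

lemma L2_bounded:
  assumes "set_borel_measurable lborel \<Omega> f" "\<And>z. z \<in> \<Omega> \<Longrightarrow> \<bar>f z\<bar> \<le> C"
    and "\<Omega> \<in> sets borel" "emeasure lborel \<Omega> < \<infinity>"
  shows "L2 \<Omega> f"
proof -
  have "set_integrable lborel \<Omega> (\<lambda>_. C\<^sup>2)"
    unfolding set_integrable_def using assms by (intro integrable_scaleR_left integrable_real_indicator) auto
  moreover have "set_borel_measurable lborel \<Omega> (\<lambda>z. (f z)\<^sup>2)"
    unfolding power2_eq_square using assms(1) by (intro set_borel_measurable_mult)
  moreover have "AE z\<in>\<Omega> in lborel. \<bar>(f z)\<^sup>2\<bar> \<le> C\<^sup>2"
  proof -
    have "(f z)\<^sup>2 \<le> C\<^sup>2" if "z \<in> \<Omega>" for z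
      using power_mono[OF assms(2)[OF that] abs_ge_zero, of 2] by simp
    then show ?thesis by simp
  qed
  ultimately have "set_integrable lborel \<Omega> (\<lambda>z. (f z)\<^sup>2)"
    by (rule set_integrable_bound_real)
  with assms(1) show ?thesis by (simp add: L2_def)
qed

lemma L2_const:
  assumes "\<Omega> \<in> sets borel" "emeasure lborel \<Omega> < \<infinity>"
  shows "L2 \<Omega> (\<lambda>_. c)"
proof (rule L2_bounded)
  show "set_borel_measurable lborel \<Omega> (\<lambda>_. c)"
    using assms by (simp add: set_borel_measurable_def)
qed (use assms in auto)

lemma L2_imp_set_integrable:
  assumes "L2 \<Omega> f" "\<Omega> \<in> sets borel" "emeasure lborel \<Omega> < \<infinity>"
  shows "set_integrable lborel \<Omega> f"
  using L2_mult_integrable[OF assms(1) L2_const[OF assms(2,3), of 1]] by simp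

lemma set_integral_nonneg_AE:
  fixes f :: "'a \<Rightarrow> real"
  assumes "AE z\<in>A in M. 0 \<le> f z"
  shows "0 \<le> (LINT z:A|M. f z)"
  unfolding set_lebesgue_integral_def
  by (rule integral_nonneg_AE) (use assms in \<open>auto elim!: eventually_mono split: split_indicator\<close>)

lemma L2_norm_nonneg: "0 \<le> L2_norm \<Omega> f"
  unfolding L2_norm_def by (intro real_sqrt_ge_zero set_integral_nonneg_AE) auto

lemma L2_norm_square: "(L2_norm \<Omega> f)\<^sup>2 = (LBINT z:\<Omega>. (f z)\<^sup>2)"
  unfolding L2_norm_def by (intro real_sqrt_pow2 set_integral_nonneg_AE) auto

lemma L2_norm_cong_AE:
  assumes "set_borel_measurable lborel \<Omega> f" "set_borel_measurable lborel \<Omega> g"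
    and "AE z\<in>\<Omega> in lborel. f z = g z"
  shows "L2_norm \<Omega> f = L2_norm \<Omega> g"
proof -
  have "(LBINT z:\<Omega>. (f z)\<^sup>2) = (LBINT z:\<Omega>. (g z)\<^sup>2)"
    by (rule set_integral_cong_AE2)
      (use assms in \<open>auto simp: power2_eq_square intro: set_borel_measurable_mult elim!: eventually_mono\<close>)
  then show ?thesis by (simp add: L2_norm_def)
qed

text \<open>A weakened Cauchy-Schwarz inequality, sufficient for passing to the limit in \<open>f\<close>.\<close>

lemma L2_abs_mult_bound:
  assumes f: "L2 \<Omega> f" and g: "L2 \<Omega> g"
  shows "2 * (LBINT z:\<Omega>. \<bar>f z * g z\<bar>) \<le> L2_norm \<Omega> f * (1 + (L2_norm \<Omega> g)\<^sup>2)"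
proof -
  let ?a = "L2_norm \<Omega> f" and ?b = "(L2_norm \<Omega> g)\<^sup>2" and ?I = "LBINT z:\<Omega>. \<bar>f z * g z\<bar>"
  note int = L2_square_integrable[OF f] L2_square_integrable[OF g] set_integrable_abs[OF L2_mult_integrable[OF f g]]
  \<comment> \<open>Young's inequality with a weight \<open>k\<close> that is optimised
    afterwards.\<close>
  have *: "2 * ?I \<le> ?a\<^sup>2 / k + k * ?b" if "k > 0" for k
  proof -
    have "2 * ?I = (LBINT z:\<Omega>. 2 * \<bar>f z * g z\<bar>)" by simp
    also have "\<dots> \<le> (LBINT z:\<Omega>. (f z)\<^sup>2 / k + k * (g z)\<^sup>2)"
    proof (rule set_integral_mono)
      fix z
      have "0 \<le> (\<bar>f z\<bar> - k * \<bar>g z\<bar>)\<^sup>2 / k" using that by simp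
      also have "\<dots> = (f z)\<^sup>2 / k + k * (g z)\<^sup>2 - 2 * \<bar>f z * g z\<bar>"
        using that by (simp add: power2_diff abs_mult field_simps power2_eq_square)
      finally show "2 * \<bar>f z * g z\<bar> \<le> (f z)\<^sup>2 / k + k * (g z)\<^sup>2" by simp
    qed (use int in \<open>auto intro!: set_integral_add\<close>)
    also have "\<dots> = ?a\<^sup>2 / k + k * ?b"
      using int by (simp add: L2_norm_square)
    finally show ?thesis .
  qed
  show ?thesis
  proof (rule field_le_epsilon)
    fix e :: real assume "e > 0"
    \<comment> \<open>The natural choice is the norm of \<open>f\<close>, which may be 0; the added
      term keeps \<open>k\<close> positive and costs exactly \<open>e\<close> in the final
      bound.\<close>
    define k where "k = ?a + e / (1 + ?b)"
    have b: "1 + ?b > 0" by (smt (verit) zero_le_power2)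
    have k: "k > 0" using L2_norm_nonneg[of \<Omega> f] \<open>e > 0\<close> b by (simp add: k_def add_nonneg_pos)
    have "?a\<^sup>2 / k \<le> k"
    proof -
      have "?a \<le> k" using \<open>e > 0\<close> b by (simp add: k_def)
      then have "?a\<^sup>2 \<le> k * k"
        using L2_norm_nonneg[of \<Omega> f] unfolding power2_eq_square by (intro mult_mono) auto
      then show ?thesis using k by (simp add: field_simps)
    qed
    then have "2 * ?I \<le> k * (1 + ?b)" using *[OF k] by (simp add: algebra_simps)
    also have "\<dots> = ?a * (1 + ?b) + e" using b by (simp add: k_def field_simps)
    finally show "2 * ?I \<le> ?a * (1 + ?b) + e" .
  qed
qed

text \<open>\<open>L2_abs_mult_bound\<close> against the constant 1, which is square integrable on a
  set of finite measure.\<close>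

lemma L2_norm_tendsto_0_imp_L1:
  assumes "\<And>n. L2 \<Omega> (f n)" "\<Omega> \<in> sets borel" "emeasure lborel \<Omega> < \<infinity>" "(\<lambda>n. L2_norm \<Omega> (f n)) \<longlonglongrightarrow> 0"
  shows "(\<lambda>n. LBINT z:\<Omega>. \<bar>f n z\<bar>) \<longlonglongrightarrow> 0"
proof (rule tendsto_sandwich[OF _ _ tendsto_const])
  let ?c = "1 + (L2_norm \<Omega> (\<lambda>_. 1))\<^sup>2"
  show "(\<lambda>n. L2_norm \<Omega> (f n) * ?c / 2) \<longlonglongrightarrow> 0"
    using tendsto_mult_right[OF assms(4), of "?c / 2"] by simp
  show "\<forall>\<^sub>F n in sequentially. (LBINT z:\<Omega>. \<bar>f n z\<bar>) \<le> L2_norm \<Omega> (f n) * ?c / 2"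
    using L2_abs_mult_bound[OF assms(1) L2_const[OF assms(2,3), of 1]]
    by (intro always_eventually allI) (simp add: mult.commute)
  show "\<forall>\<^sub>F n in sequentially. 0 \<le> (LBINT z:\<Omega>. \<bar>f n z\<bar>)"
    by (simp add: set_integral_nonneg_AE)
qed

text \<open>An open set is the increasing union of compact finite unions of boxes, so
  \<open>f\<close> on \<Omega> is a pointwise limit of measurable cut-offs.\<close>

lemma locally_integrable_measurable:
  fixes f :: "'a::euclidean_space \<Rightarrow> real"
  assumes "locally_integrable \<Omega> f" "open \<Omega>"
  shows "set_borel_measurable lborel \<Omega> f"
proof (cases "\<Omega> = {}")
  case False
  obtain D where D: "countable D" "D \<subseteq> Pow \<Omega>" "\<And>X. X \<in> D \<Longrightarrow> \<exists>a b. X = cbox a b" "\<Union>D = \<Omega>"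
    using open_countable_Union_open_cbox[OF \<open>open \<Omega>\<close>] by metis
  with False have "D \<noteq> {}" by auto
  define K where "K n = (\<Union>i\<le>n. from_nat_into D i)" for n
  have in_D: "from_nat_into D i \<in> D" for i using from_nat_into[OF \<open>D \<noteq> {}\<close>] .
  have cpt: "compact (from_nat_into D i)" "from_nat_into D i \<subseteq> \<Omega>" for i
    using D(2) D(3)[OF in_D[of i]] in_D[of i] by (metis compact_cbox, blast)
  have K: "compact (K n)" "K n \<subseteq> \<Omega>" for n
    unfolding K_def using cpt by (auto intro!: compact_UN)
  have "set_integrable lborel (K n) f" for n
    using assms(1) K unfolding locally_integrable_def by blast
  then have m: "(\<lambda>z. indicator (K n) z *\<^sub>R f z) \<in> borel_measurable lborel" for n
    by (intro set_integrable_measurable[unfolded set_borel_measurable_def])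
  show ?thesis
    unfolding set_borel_measurable_def
  proof (rule borel_measurable_LIMSEQ_real[OF _ m])
    fix z :: 'a
    show "(\<lambda>n. indicator (K n) z *\<^sub>R f z) \<longlonglongrightarrow> indicator \<Omega> z *\<^sub>R f z"
    proof (cases "z \<in> \<Omega>")
      case True
      then obtain X where "X \<in> D" "z \<in> X" using D(4) by auto
      then obtain i where i: "z \<in> from_nat_into D i" using from_nat_into_surj[OF D(1)] by metis
      have "\<forall>\<^sub>F n in sequentially. indicator \<Omega> z *\<^sub>R f z = indicator (K n) z *\<^sub>R f z"
        using eventually_ge_at_top[of i] by eventually_elim (use i True in \<open>auto simp: K_def indicator_def\<close>)
      then show ?thesis by (rule Lim_transform_eventually[OF tendsto_const])
    next
      case False
      then have "z \<notin> K n" for n using K(2) by auto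
      with False show ?thesis by simp
    qed
  qed
qed (simp add: set_borel_measurable_def)

lemma rect_measurable [measurable]: "rect L B \<in> sets borel"
  unfolding rect_def by (intro borel_open open_Times open_greaterThanLessThan)

lemma open_rect: "open (rect L B)"
  unfolding rect_def by (intro open_Times open_greaterThanLessThan)

lemma rect_eq_box: "rect L B = box (0, 0) (L, B)"
  by (auto simp: rect_def mem_box Basis_prod_def)

lemma emeasure_rect: "emeasure lborel (rect L B) < \<infinity>"
  unfolding rect_eq_box using emeasure_lborel_box_finite by (simp add: less_top)

lemma emeasure_Ioo_finite: "emeasure lborel {a<..<b::real} < \<infinity>"
  by (cases "a \<le> b") auto

lemma L2_rect_imp_set_integrable: "L2 (rect L B) f \<Longrightarrow> set_integrable lborel (rect L B) f"
  by (rule L2_imp_set_integrable[OF _ rect_measurable emeasure_rect])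

lemma continuous_on_UNIV_L2:
  fixes f :: "'a::euclidean_space \<Rightarrow> real"
  assumes "continuous_on UNIV f" "\<Omega> \<subseteq> cbox a b" "\<Omega> \<in> sets borel"
  shows "L2 \<Omega> f"
proof -
  have "bounded (f ` cbox a b)"
    using assms(1) continuous_on_subset by (intro compact_imp_bounded compact_continuous_image) auto
  then obtain C where C: "\<And>z. z \<in> cbox a b \<Longrightarrow> \<bar>f z\<bar> \<le> C"
    by (auto simp: bounded_iff)
  have "f \<in> borel_measurable borel" using assms(1) by (rule borel_measurable_continuous_onI)
  moreover have "emeasure lborel \<Omega> \<le> emeasure lborel (cbox a b)"
    using assms by (intro emeasure_mono) auto
  then have "emeasure lborel \<Omega> < \<infinity>"
    using emeasure_lborel_cbox_finite[of a b] by (auto simp: less_top top_unique)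
  ultimately show ?thesis
    using C assms by (intro L2_bounded[of _ _ C]) (auto simp: set_borel_measurable_def)
qed

lemma continuous_on_UNIV_L2_rect: "continuous_on UNIV f \<Longrightarrow> L2 (rect L B) f"
  by (rule continuous_on_UNIV_L2[where a = "(0, 0)" and b = "(L, B)"])
    (simp_all add: rect_eq_box box_subset_cbox)

lemma continuous_on_UNIV_L2_Ioo: "continuous_on UNIV f \<Longrightarrow> L2 {a<..<b::real} f"
  by (rule continuous_on_UNIV_L2[where a = a and b = b]) auto

section \<open>Integration by parts on a rectangle\<close>

lemma partial_derivs_Nil [simp]: "partial_derivs [] \<phi> = \<phi>"
  by (simp add: partial_derivs_def)

lemma partial_derivs_Cons [simp]: "partial_derivs (b # bs) \<phi> = partial_deriv b (partial_derivs bs \<phi>)"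
  by (simp add: partial_derivs_def)

lemma partial_derivs_append: "partial_derivs (bs @ cs) \<phi> = partial_derivs bs (partial_derivs cs \<phi>)"
  by (simp add: partial_derivs_def)

lemma smooth_iterated_deriv: "smooth \<eta> \<Longrightarrow> smooth ((partial_deriv (1::real) ^^ n) \<eta>)"
  by (induction n) (auto intro: smooth_partial_deriv)

lemma partial_derivs_tensor:
  assumes "smooth \<eta>" "smooth \<zeta>"
  shows "partial_derivs (dxy i j) (tensor \<eta> \<zeta>) =
    tensor ((partial_deriv 1 ^^ i) \<eta>) ((partial_deriv 1 ^^ j) \<zeta>)"
proof -
  have "partial_derivs (replicate j (0, 1)) (tensor \<eta> \<zeta>) = tensor \<eta> ((partial_deriv 1 ^^ j) \<zeta>)"
    using assms by (induction j) (simp_all add: partial_deriv_tensor smooth_iterated_deriv)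
  moreover have "partial_derivs (replicate i (1, 0)) (tensor \<eta> \<xi>) = tensor ((partial_deriv 1 ^^ i) \<eta>) \<xi>"
    if "smooth \<xi>" for \<xi>
    using assms(1) that by (induction i) (simp_all add: partial_deriv_tensor smooth_iterated_deriv)
  from this[OF smooth_iterated_deriv[OF assms(2)]] calculation show ?thesis
    by (simp add: dxy_def partial_derivs_append)
qed

text \<open>This is what allows the arbitrary choice in \<open>weak_deriv\<close> to be replaced by
  any concrete version of the derivative.\<close>

lemma has_weak_deriv_unique:
  assumes "open \<Omega>" "has_weak_deriv \<Omega> bs f g" "has_weak_deriv \<Omega> bs f h"
  shows "AE z\<in>\<Omega> in lborel. g z = h z"
proof -
  have g: "locally_integrable \<Omega> g" and h: "locally_integrable \<Omega> h"
    using assms by (auto simp: has_weak_deriv_def)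
  have "AE z\<in>\<Omega> in lborel. g z - h z = 0"
  proof (rule AE_zero_if_orthogonal_to_bumps[OF \<open>open \<Omega>\<close>])
    show "locally_integrable \<Omega> (\<lambda>z. g z - h z)"
      using g h unfolding locally_integrable_def by (auto intro: set_integral_diff)
    fix p q :: 'a and n assume pq: "cbox p q \<subseteq> \<Omega>"
    \<comment> \<open>The functions are only locally integrable; the bump, supported in a compact
      box, makes the products integrable.\<close>
    have int: "set_integrable lborel \<Omega> (\<lambda>z. k z * box_bump p q n z)" if "locally_integrable \<Omega> k" for k
    proof -
      have "set_integrable lborel (cbox p q) k"
        using that pq compact_cbox unfolding locally_integrable_def by blast
      then have "set_integrable lborel (cbox p q) (\<lambda>z. box_bump p q n z * k z)"
        by (rule set_integrable_mult_test_function[OF _ _ test_function_box_bump]) simp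
      moreover have "(\<lambda>z. indicator (cbox p q) z *\<^sub>R (box_bump p q n z * k z)) = (\<lambda>z. indicator \<Omega> z *\<^sub>R (k z * box_bump p q n z))"
      proof
        fix z
        show "indicator (cbox p q) z *\<^sub>R (box_bump p q n z * k z) = indicator \<Omega> z *\<^sub>R (k z * box_bump p q n z)"
          using pq box_subset_cbox[of p q] box_bump_eq_0[of z p q n]
          by (cases "z \<in> box p q") (auto split: split_indicator)
      qed
      ultimately show ?thesis by (simp only: set_integrable_def)
    qed
    have "test_function \<Omega> (box_bump p q n)"
      using pq box_subset_cbox by (metis order_trans test_function_box_bump test_function_mono)
    then have "(- 1) ^ length bs * (LBINT z:\<Omega>. g z * box_bump p q n z)
        = (- 1) ^ length bs * (LBINT z:\<Omega>. h z * box_bump p q n z)"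
      using assms(2,3) unfolding has_weak_deriv_def by metis
    then have "(LBINT z:\<Omega>. g z * box_bump p q n z) = (LBINT z:\<Omega>. h z * box_bump p q n z)"
      by simp
    then show "(LBINT z:\<Omega>. (g z - h z) * box_bump p q n z) = 0"
      using int[OF g] int[OF h] by (simp add: left_diff_distrib)
  qed
  then show ?thesis by simp
qed

lemma has_weak_deriv_weak_deriv: "has_weak_deriv \<Omega> bs f g \<Longrightarrow> has_weak_deriv \<Omega> bs f (weak_deriv \<Omega> bs f)"
  unfolding weak_deriv_def by (rule someI[where P = "has_weak_deriv \<Omega> bs f"])

text \<open>The weak derivative in the x-direction, tested with tensor products alone: these suffice
  for the passage to lines and for uniqueness, and on them mixed derivatives split into derivatives
  of the two factors.\<close>

definition wdx :: "real \<Rightarrow> real \<Rightarrow> (real \<times> real \<Rightarrow> real) \<Rightarrow> (real \<times> real \<Rightarrow> real) \<Rightarrow> bool" where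
  "wdx L B f g \<longleftrightarrow> (\<forall>\<eta> \<zeta>. test_function {0<..<L} \<eta> \<longrightarrow> test_function {0<..<B} \<zeta> \<longrightarrow>
     (LBINT p:rect L B. f p * tensor (partial_deriv 1 \<eta>) \<zeta> p)
       = - (LBINT p:rect L B. g p * tensor \<eta> \<zeta> p))"

definition wdy :: "real \<Rightarrow> real \<Rightarrow> (real \<times> real \<Rightarrow> real) \<Rightarrow> (real \<times> real \<Rightarrow> real) \<Rightarrow> bool" where
  "wdy L B f g \<longleftrightarrow> (\<forall>\<eta> \<zeta>. test_function {0<..<L} \<eta> \<longrightarrow> test_function {0<..<B} \<zeta> \<longrightarrow>
     (LBINT p:rect L B. f p * tensor \<eta> (partial_deriv 1 \<zeta>) p)
       = - (LBINT p:rect L B. g p * tensor \<eta> \<zeta> p))"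

lemma has_weak_deriv_tensor:
  assumes "has_weak_deriv (rect L B) (dxy i j) f g" "test_function {0<..<L} \<eta>" "test_function {0<..<B} \<zeta>"
  shows "(LBINT p:rect L B. g p * tensor \<eta> \<zeta> p) = (- 1) ^ (i + j) *
    (LBINT p:rect L B. f p * tensor ((partial_deriv 1 ^^ i) \<eta>) ((partial_deriv 1 ^^ j) \<zeta>) p)"
proof -
  have "test_function (rect L B) (tensor \<eta> \<zeta>)"
    unfolding rect_def by (rule test_function_tensor[OF assms(2,3)])
  then have "(LBINT p:rect L B. f p * partial_derivs (dxy i j) (tensor \<eta> \<zeta>) p)
      = (- 1) ^ length (dxy i j) * (LBINT p:rect L B. g p * tensor \<eta> \<zeta> p)"
    using assms(1) unfolding has_weak_deriv_def by blast
  moreover have "length (dxy i j) = i + j" by (simp add: dxy_def)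
  ultimately show ?thesis
    using assms(2,3)[THEN test_function_smooth] by (simp add: partial_derivs_tensor flip: mult.assoc power_add)
qed

text \<open>Both sides reduce to the integral of \<open>f\<close> against the same tensor product,
  with \<open>Suc i\<close> derivatives on the first factor and \<open>j\<close> on the second; the
  signs differ by one factor -1. In particular the order of the directions in \<open>dxy\<close> is
  harmless.\<close>

lemma has_weak_deriv_imp_wdx:
  assumes "has_weak_deriv (rect L B) (dxy i j) f g" "has_weak_deriv (rect L B) (dxy (Suc i) j) f h"
  shows "wdx L B g h"
  unfolding wdx_def
proof (intro allI impI)
  fix \<eta> \<zeta> assume t: "test_function {0<..<L} \<eta>" "test_function {0<..<B} \<zeta>"
  show "(LBINT p:rect L B. g p * tensor (partial_deriv 1 \<eta>) \<zeta> p) = - (LBINT p:rect L B. h p * tensor \<eta> \<zeta> p)"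
    using has_weak_deriv_tensor[OF assms(1) test_function_partial_deriv[OF t(1), of 1] t(2)]
      has_weak_deriv_tensor[OF assms(2) t] by (simp add: funpow_Suc_right del: funpow.simps)
qed

lemma has_weak_deriv_imp_wdy:
  assumes "has_weak_deriv (rect L B) (dxy i j) f g" "has_weak_deriv (rect L B) (dxy i (Suc j)) f h"
  shows "wdy L B g h"
  unfolding wdy_def
proof (intro allI impI)
  fix \<eta> \<zeta> assume t: "test_function {0<..<L} \<eta>" "test_function {0<..<B} \<zeta>"
  show "(LBINT p:rect L B. g p * tensor \<eta> (partial_deriv 1 \<zeta>) p) = - (LBINT p:rect L B. h p * tensor \<eta> \<zeta> p)"
    using has_weak_deriv_tensor[OF assms(1) t(1) test_function_partial_deriv[OF t(2), of 1]]
      has_weak_deriv_tensor[OF assms(2) t] by (simp add: funpow_Suc_right del: funpow.simps)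
qed

section \<open>Exchange of the two coordinates, which reduces the y-direction to the
  x-direction\<close>

lemma lborel_swap: "distr lborel borel prod.swap = (lborel :: ('a::euclidean_space \<times> 'b::euclidean_space) measure)"
proof -
  have "(lborel :: ('a \<times> 'b) measure) = distr (lborel \<Otimes>\<^sub>M lborel) (lborel \<Otimes>\<^sub>M lborel) (\<lambda>(x, y). (y, x))"
    using lborel_pair.distr_pair_swap[where ?'a = 'a and ?'b = 'b] by (simp only: lborel_prod)
  also have "\<dots> = distr lborel borel prod.swap"
    unfolding lborel_prod by (rule distr_cong) auto
  finally show ?thesis by simp
qed

lemma measurable_swap_borel [measurable]:
  "prod.swap \<in> borel_measurable (borel :: ('a::euclidean_space \<times> 'b::euclidean_space) measure)"
  by (rule borel_measurable_continuous_onI) (rule continuous_on_swap)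

lemma indicator_rect_swap: "indicator (rect B L) (prod.swap p) = (indicator (rect L B) p :: real)"
  by (cases p) (auto simp: rect_def split: split_indicator)

lemma set_integrable_rect_swap:
  fixes f :: "real \<times> real \<Rightarrow> real"
  shows "set_integrable lborel (rect L B) f \<Longrightarrow> set_integrable lborel (rect B L) (\<lambda>p. f (prod.swap p))"
  using integrable_distr[of prod.swap lborel borel "\<lambda>p. indicator (rect L B) p *\<^sub>R f p"]
  by (simp add: set_integrable_def lborel_swap indicator_rect_swap)

lemma set_integral_rect_swap:
  fixes f :: "real \<times> real \<Rightarrow> real"
  assumes "set_borel_measurable lborel (rect L B) f"
  shows "(LBINT p:rect B L. f (prod.swap p)) = (LBINT p:rect L B. f p)"
proof -
  have "(LBINT p:rect L B. f p) = (LINT p|distr lborel borel prod.swap. indicator (rect L B) p *\<^sub>R f p)"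
    by (simp add: lborel_swap set_lebesgue_integral_def)
  also have "\<dots> = (LBINT p:rect B L. f (prod.swap p))"
    using assms integral_distr[of prod.swap lborel borel "\<lambda>p. indicator (rect L B) p *\<^sub>R f p"]
    by (simp add: set_borel_measurable_def set_lebesgue_integral_def indicator_rect_swap)
  finally show ?thesis ..
qed

lemma AE_swap:
  fixes P :: "'a::euclidean_space \<times> 'b::euclidean_space \<Rightarrow> bool"
  assumes "AE p in lborel. P p"
  shows "AE p in lborel. P (prod.swap p)"
proof (rule AE_distrD[where f = prod.swap and M' = borel and P = P])
  show "AE p in distr lborel borel prod.swap. P p"
    unfolding lborel_swap by (rule assms)
qed measurable

lemma L2_rect_swap: "L2 (rect L B) f \<Longrightarrow> L2 (rect B L) (\<lambda>p. f (prod.swap p))"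
  unfolding L2_def set_borel_measurable_def
proof safe
  assume "(\<lambda>p. indicator (rect L B) p *\<^sub>R f p) \<in> borel_measurable lborel"
  then have "(\<lambda>p. indicator (rect L B) (prod.swap p) *\<^sub>R f (prod.swap p)) \<in> borel_measurable lborel"
    by simp
  then show "(\<lambda>p. indicator (rect B L) p *\<^sub>R f (prod.swap p)) \<in> borel_measurable lborel"
    by (simp add: indicator_rect_swap)
qed (rule set_integrable_rect_swap)

text \<open>\<open>Q\<close> records what is known about the end values of the absolutely continuous
  representative, and thereby replaces boundary conditions in the sense of traces. It is a relation
  because trace arguments naturally produce linear relations between the two values.\<close>

definition x_lines :: "real \<Rightarrow> real \<Rightarrow> (real \<Rightarrow> real \<Rightarrow> bool) \<Rightarrow>
    (real \<times> real \<Rightarrow> real) \<Rightarrow> (real \<times> real \<Rightarrow> real) \<Rightarrow> bool" where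
  "x_lines L B Q f g \<longleftrightarrow> (AE y in lborel. y \<in> {0<..<B} \<longrightarrow>
     (\<exists>F. ac_on 0 L F (\<lambda>x. g (x, y)) \<and> (AE x in lborel. x \<in> {0<..<L} \<longrightarrow> f (x, y) = F x) \<and> Q (F 0) (F L)))"

definition y_lines :: "real \<Rightarrow> real \<Rightarrow> (real \<Rightarrow> real \<Rightarrow> bool) \<Rightarrow>
    (real \<times> real \<Rightarrow> real) \<Rightarrow> (real \<times> real \<Rightarrow> real) \<Rightarrow> bool" where
  "y_lines L B Q f g \<longleftrightarrow> x_lines B L Q (\<lambda>p. f (prod.swap p)) (\<lambda>p. g (prod.swap p))"

lemma x_lines_mono: "x_lines L B Q f g \<Longrightarrow> (\<And>p q. Q p q \<Longrightarrow> Q' p q) \<Longrightarrow> x_lines L B Q' f g"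
  unfolding x_lines_def by (erule eventually_mono) blast

lemma wdx_imp_x_lines:
  assumes "0 < L" "L2 (rect L B) f" "L2 (rect L B) g" "wdx L B f g"
  shows "x_lines L B (\<lambda>_ _. True) f g"
proof -
  have "AE y in lborel. y \<in> {0<..<B} \<longrightarrow>
      (\<exists>F. ac_on 0 L F (\<lambda>x. g (x, y)) \<and> (AE x in lborel. x \<in> {0<..<L} \<longrightarrow> f (x, y) = F x))"
    by (rule weak_deriv_imp_ac_on_lines)
      (use assms L2_rect_imp_set_integrable in \<open>auto simp: wdx_def rect_def\<close>)
  then show ?thesis by (simp add: x_lines_def)
qed

lemma wdy_imp_wdx:
  assumes "L2 (rect L B) f" "L2 (rect L B) g" "wdy L B f g"
  shows "wdx B L (\<lambda>p. f (prod.swap p)) (\<lambda>p. g (prod.swap p))"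
  unfolding wdx_def
proof (intro allI impI)
  fix \<eta> \<zeta> assume t: "test_function {0<..<B} \<eta>" "test_function {0<..<L} \<zeta>"
  have m: "set_borel_measurable lborel (rect L B) (\<lambda>p. h p * tensor \<alpha> \<beta> p)"
    if "L2 (rect L B) h" "smooth \<alpha>" "smooth \<beta>" for h \<alpha> \<beta>
  proof (rule set_borel_measurable_mult[OF L2_measurable[OF that(1)]])
    show "set_borel_measurable lborel (rect L B) (tensor \<alpha> \<beta>)"
      using smooth_measurable[OF smooth_tensor[OF that(2,3)]] by (simp add: set_borel_measurable_def)
  qed
  have s: "smooth \<eta>" "smooth \<zeta>" "smooth (partial_deriv 1 \<eta>)"
    using t by (auto intro: test_function_smooth smooth_partial_deriv)
  have sw: "h (prod.swap p) * tensor \<alpha> \<beta> p = h (prod.swap p) * tensor \<beta> \<alpha> (prod.swap p)" for h :: "real \<times> real \<Rightarrow> real" and \<alpha> \<beta> p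
    by (simp add: tensor_def)
  show "(LBINT p:rect B L. f (prod.swap p) * tensor (partial_deriv 1 \<eta>) \<zeta> p)
      = - (LBINT p:rect B L. g (prod.swap p) * tensor \<eta> \<zeta> p)"
    unfolding sw set_integral_rect_swap[OF m[OF assms(1) s(2,3)]] set_integral_rect_swap[OF m[OF assms(2) s(2,1)]]
    using assms(3) t unfolding wdy_def by blast
qed

lemma wdy_imp_y_lines:
  assumes "0 < B" "L2 (rect L B) f" "L2 (rect L B) g" "wdy L B f g"
  shows "y_lines L B (\<lambda>_ _. True) f g"
  unfolding y_lines_def using assms wdy_imp_wdx[OF assms(2-4)]
  by (intro wdx_imp_x_lines L2_rect_swap)

text \<open>The representative is unique: two of them have the same derivative and agree at some
  interior point, hence also at both ends. So separately obtained end conditions hold for one and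
  the same function.\<close>

lemma x_lines_conj:
  assumes "0 < L" "x_lines L B Q1 f g" "x_lines L B Q2 f g"
  shows "x_lines L B (\<lambda>p q. Q1 p q \<and> Q2 p q) f g"
  using assms(2,3) unfolding x_lines_def
proof eventually_elim
  case (elim y)
  show ?case
  proof
    assume y: "y \<in> {0<..<B}"
    obtain F where F: "ac_on 0 L F (\<lambda>x. g (x, y))" "AE x in lborel. x \<in> {0<..<L} \<longrightarrow> f (x, y) = F x" "Q1 (F 0) (F L)"
      using elim y by blast
    obtain G where G: "ac_on 0 L G (\<lambda>x. g (x, y))" "AE x in lborel. x \<in> {0<..<L} \<longrightarrow> f (x, y) = G x" "Q2 (G 0) (G L)"
      using elim y by blast
    have "AE x in lborel. x \<in> {0<..<L} \<longrightarrow> F x = G x"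
      using F(2) G(2) by eventually_elim auto
    then obtain x where x: "x \<in> {0<..<L}" "F x = G x"
      using \<open>0 < L\<close> by (rule AE_Ioo_witness)
    have mem: "x \<in> {0..L}" "L \<in> {0..L}" using x(1) \<open>0 < L\<close> by auto
    have "F 0 = G 0"
      using ac_onD(2)[OF F(1) mem(1)] ac_onD(2)[OF G(1) mem(1)] x(2) by linarith
    moreover from this have "F L = G L"
      using ac_onD(2)[OF F(1) mem(2)] ac_onD(2)[OF G(1) mem(2)] by linarith
    ultimately have "Q2 (F 0) (F L)" using G(3) by metis
    with F show "\<exists>F. ac_on 0 L F (\<lambda>x. g (x, y)) \<and> (AE x in lborel. x \<in> {0<..<L} \<longrightarrow> f (x, y) = F x) \<and>
        Q1 (F 0) (F L) \<and> Q2 (F 0) (F L)"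
      by (intro exI[of _ F] conjI)
  qed
qed

text \<open>The product rule on single lines. The end values appear only existentially, so their
  measurability in y never has to be discussed.\<close>

lemma x_lines_mult:
  assumes "0 < L" and f: "x_lines L B Q1 f f'" and g: "x_lines L B Q2 g g'"
    and int: "set_integrable lborel (rect L B) (\<lambda>z. f' z * g z + f z * g' z)"
  shows "AE y in lborel. y \<in> {0<..<B} \<longrightarrow> (\<exists>p q r s. Q1 p q \<and> Q2 r s \<and>
    (LBINT x:{0<..<L}. f' (x, y) * g (x, y) + f (x, y) * g' (x, y)) = q * s - p * r)"
  using f[unfolded x_lines_def] g[unfolded x_lines_def] set_integral_slices(1)[OF int[unfolded rect_def]]
proof eventually_elim
  case (elim y)
  show ?case
  proof
    assume y: "y \<in> {0<..<B}"
    obtain F where F: "ac_on 0 L F (\<lambda>x. f' (x, y))" "AE x in lborel. x \<in> {0<..<L} \<longrightarrow> f (x, y) = F x" "Q1 (F 0) (F L)"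
      using elim y by blast
    obtain G where G: "ac_on 0 L G (\<lambda>x. g' (x, y))" "AE x in lborel. x \<in> {0<..<L} \<longrightarrow> g (x, y) = G x" "Q2 (G 0) (G L)"
      using elim y by blast
    note FG = ac_on_mult[OF F(1) G(1)]
    have "(LBINT x:{0<..<L}. f' (x, y) * g (x, y) + f (x, y) * g' (x, y))
        = (LBINT x:{0<..<L}. f' (x, y) * G x + F x * g' (x, y))"
    proof (rule set_integral_cong_AE2)
      show "AE x in lborel. x \<in> {0<..<L} \<longrightarrow> f' (x, y) * g (x, y) + f (x, y) * g' (x, y) = f' (x, y) * G x + F x * g' (x, y)"
        using F(2) G(2) by eventually_elim auto
    qed (use elim y FG in \<open>auto intro: set_integrable_measurable ac_onD(1)\<close>)
    also have "\<dots> = F L * G L - F 0 * G 0"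
      using ac_onD(2)[OF FG, of L] \<open>0 < L\<close> by simp
    finally show "\<exists>p q r s. Q1 p q \<and> Q2 r s \<and>
        (LBINT x:{0<..<L}. f' (x, y) * g (x, y) + f (x, y) * g' (x, y)) = q * s - p * r"
      using F(3) G(3) by blast
  qed
qed

text \<open>The last hypothesis says that the boundary term cancels for all admissible end values.
  Thus a factor with no known end values (\<open>True\<close>) is allowed when its partner vanishes
  at both ends.\<close>

lemma x_lines_ibp:
  assumes "0 < L" and f: "x_lines L B Q1 f f'" and g: "x_lines L B Q2 g g'"
    and L2: "L2 (rect L B) f" "L2 (rect L B) f'" "L2 (rect L B) g" "L2 (rect L B) g'"
    and Q: "\<And>p q r s. Q1 p q \<Longrightarrow> Q2 r s \<Longrightarrow> q * s = p * r"
  shows "(LBINT z:rect L B. f z * g' z) = - (LBINT z:rect L B. f' z * g z)"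
proof -
  note int = L2_mult_integrable[OF L2(2,3)] L2_mult_integrable[OF L2(1,4)]
  note int_sum = set_integral_add(1)[OF int]
  have "(LBINT y:{0<..<B}. LBINT x:{0<..<L}. f' (x, y) * g (x, y) + f (x, y) * g' (x, y))
      = (LBINT y:{0<..<B}. 0)"
  proof (rule set_integral_cong_AE2)
    show "AE y in lborel. y \<in> {0<..<B} \<longrightarrow> (LBINT x:{0<..<L}. f' (x, y) * g (x, y) + f (x, y) * g' (x, y)) = 0"
      using x_lines_mult[OF \<open>0 < L\<close> f g int_sum] by eventually_elim (use Q in force)
    show "set_borel_measurable lborel {0<..<B} (\<lambda>y. LBINT x:{0<..<L}. f' (x, y) * g (x, y) + f (x, y) * g' (x, y))"
      by (rule set_integrable_measurable[OF set_integral_slices(2)[OF int_sum[unfolded rect_def]]])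
  qed (simp add: set_borel_measurable_def)
  then have "(LBINT z:rect L B. f' z * g z + f z * g' z) = 0"
    using set_integral_slices(3)[OF int_sum[unfolded rect_def]] by (simp add: rect_def)
  then show ?thesis
    using set_integral_add(2)[OF int] by linarith
qed

lemma y_lines_ibp:
  assumes "0 < B" and f: "y_lines L B Q1 f f'" and g: "y_lines L B Q2 g g'"
    and L2: "L2 (rect L B) f" "L2 (rect L B) f'" "L2 (rect L B) g" "L2 (rect L B) g'"
    and Q: "\<And>p q r s. Q1 p q \<Longrightarrow> Q2 r s \<Longrightarrow> q * s = p * r"
  shows "(LBINT z:rect L B. f z * g' z) = - (LBINT z:rect L B. f' z * g z)"
  using x_lines_ibp[OF \<open>0 < B\<close> f[unfolded y_lines_def] g[unfolded y_lines_def] L2[THEN L2_rect_swap] Q]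
    set_integral_rect_swap[OF set_integrable_measurable[OF L2_mult_integrable[OF L2(1,4)]]]
    set_integral_rect_swap[OF set_integrable_measurable[OF L2_mult_integrable[OF L2(2,3)]]]
  by simp

lemma x_lines_wirtinger:
  assumes "0 < L" and f: "x_lines L B (\<lambda>p q. p = 0 \<and> q = 0) f g" and L2: "L2 (rect L B) f" "L2 (rect L B) g"
  shows "(pi / L)\<^sup>2 * (LBINT z:rect L B. (f z)\<^sup>2) \<le> (LBINT z:rect L B. (g z)\<^sup>2)"
proof -
  note sq = L2_square_integrable[OF L2(1), unfolded rect_def] L2_square_integrable[OF L2(2), unfolded rect_def]
  have "AE y in lborel. y \<in> {0<..<B} \<longrightarrow>
      0 \<le> (LBINT x:{0<..<L}. (g (x, y))\<^sup>2) - (pi / L)\<^sup>2 * (LBINT x:{0<..<L}. (f (x, y))\<^sup>2)"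
    using f[unfolded x_lines_def] set_integral_slices(1)[OF sq(1)] set_integral_slices(1)[OF sq(2)]
  proof eventually_elim
    case (elim y)
    show ?case
    proof
      assume y: "y \<in> {0<..<B}"
      with elim obtain F where F: "ac_on 0 L F (\<lambda>x. g (x, y))"
        "AE x in lborel. x \<in> {0<..<L} \<longrightarrow> f (x, y) = F x" "F 0 = 0" "F L = 0" by blast
      have "(LBINT x:{0<..<L}. (f (x, y))\<^sup>2) = (LBINT x:{0<..<L}. (F x)\<^sup>2)"
      proof (rule set_integral_cong_AE2)
        show "set_borel_measurable lborel {0<..<L} (\<lambda>x. (F x)\<^sup>2)"
          unfolding power2_eq_square using ac_on_measurable[OF F(1)] by (intro set_borel_measurable_mult)
        show "AE x in lborel. x \<in> {0<..<L} \<longrightarrow> (f (x, y))\<^sup>2 = (F x)\<^sup>2"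
          using F(2) by eventually_elim auto
      qed (use elim y in \<open>auto intro: set_integrable_measurable\<close>)
      then show "0 \<le> (LBINT x:{0<..<L}. (g (x, y))\<^sup>2) - (pi / L)\<^sup>2 * (LBINT x:{0<..<L}. (f (x, y))\<^sup>2)"
        using wirtinger[OF F(1,3,4) _ \<open>0 < L\<close>] elim y by simp
    qed
  qed
  then have "0 \<le> (LBINT y:{0<..<B}. (LBINT x:{0<..<L}. (g (x, y))\<^sup>2)
      - (pi / L)\<^sup>2 * (LBINT x:{0<..<L}. (f (x, y))\<^sup>2))"
    by (rule set_integral_nonneg_AE)
  also have "\<dots> = (LBINT z:rect L B. (g z)\<^sup>2) - (pi / L)\<^sup>2 * (LBINT z:rect L B. (f z)\<^sup>2)"
    using set_integral_slices(2)[OF sq(1)] set_integral_slices(2)[OF sq(2)]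
      set_integral_slices(3)[OF sq(1)] set_integral_slices(3)[OF sq(2)] by (simp add: rect_def)
  finally show ?thesis by simp
qed

lemma y_lines_wirtinger:
  assumes "0 < B" and f: "y_lines L B (\<lambda>p q. p = 0 \<and> q = 0) f g" and L2: "L2 (rect L B) f" "L2 (rect L B) g"
  shows "(pi / B)\<^sup>2 * (LBINT z:rect L B. (f z)\<^sup>2) \<le> (LBINT z:rect L B. (g z)\<^sup>2)"
  using x_lines_wirtinger[OF \<open>0 < B\<close> f[unfolded y_lines_def] L2[THEN L2_rect_swap]]
    set_integral_rect_swap[OF set_integrable_measurable[OF L2_square_integrable[OF L2(1)]]]
    set_integral_rect_swap[OF set_integrable_measurable[OF L2_square_integrable[OF L2(2)]]]
  by simp

text \<open>Three times the integrand is the derivative of f^3, which vanishes at both ends.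
  Integrability is a hypothesis here, since it will be supplied by the differential
  equation.\<close>

lemma x_lines_integral_square_mult_deriv:
  assumes "0 < L" and f: "x_lines L B (\<lambda>p q. p = 0 \<and> q = 0) f g"
    and int: "set_integrable lborel (rect L B) (\<lambda>z. f z * (f z * g z))"
  shows "(LBINT z:rect L B. f z * (f z * g z)) = 0"
proof -
  have "AE y in lborel. y \<in> {0<..<B} \<longrightarrow> (LBINT x:{0<..<L}. f (x, y) * (f (x, y) * g (x, y))) = 0"
    using f[unfolded x_lines_def] set_integral_slices(1)[OF int[unfolded rect_def]]
  proof eventually_elim
    case (elim y)
    show ?case
    proof
      assume y: "y \<in> {0<..<B}"
      with elim obtain F where F: "ac_on 0 L F (\<lambda>x. g (x, y))"
        "AE x in lborel. x \<in> {0<..<L} \<longrightarrow> f (x, y) = F x" "F 0 = 0" "F L = 0" by blast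
      note FFF = ac_on_mult[OF F(1) ac_on_mult[OF F(1) F(1)]]
      have "3 * (LBINT x:{0<..<L}. f (x, y) * (f (x, y) * g (x, y))) = (LBINT x:{0<..<L}. 3 * (f (x, y) * (f (x, y) * g (x, y))))"
        by simp
      also have "\<dots> = (LBINT x:{0<..<L}. g (x, y) * (F x * F x) + F x * (g (x, y) * F x + F x * g (x, y)))"
      proof (rule set_integral_cong_AE2)
        show "AE x in lborel. x \<in> {0<..<L} \<longrightarrow> 3 * (f (x, y) * (f (x, y) * g (x, y))) = g (x, y) * (F x * F x) + F x * (g (x, y) * F x + F x * g (x, y))"
          using F(2) by eventually_elim (auto simp: algebra_simps)
      qed (use elim y ac_onD(1)[OF FFF] in \<open>auto intro: set_integrable_measurable\<close>)
      also have "\<dots> = 0" using ac_onD(2)[OF FFF, of L] F(3,4) \<open>0 < L\<close> by simp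
      finally show "(LBINT x:{0<..<L}. f (x, y) * (f (x, y) * g (x, y))) = 0" by simp
    qed
  qed
  then have "(LBINT y:{0<..<B}. LBINT x:{0<..<L}. f (x, y) * (f (x, y) * g (x, y))) = (LBINT y:{0<..<B}. 0)"
    using set_integral_slices(2)[OF int[unfolded rect_def]]
    by (intro set_integral_cong_AE2 set_integrable_measurable) (auto simp: set_integrable_def)
  then show ?thesis using set_integral_slices(3)[OF int[unfolded rect_def]] by (simp add: rect_def)
qed

section \<open>Traces\<close>

lemma wdx_unique:
  assumes L2: "L2 (rect L B) g" "L2 (rect L B) h" and "wdx L B f g" "wdx L B f h"
  shows "AE z\<in>rect L B in lborel. g z = h z"
proof -
  have "AE z in lborel. z \<in> {0<..<L} \<times> {0<..<B} \<longrightarrow> g z - h z = 0"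
  proof (rule AE_zero_if_orthogonal_to_tensors)
    show "locally_integrable ({0<..<L} \<times> {0<..<B}) (\<lambda>z. g z - h z)"
      using L2_rect_imp_set_integrable[OF L2_diff[OF L2]]
      by (intro set_integrable_imp_locally_integrable) (simp add: rect_def)
    fix \<eta> \<zeta> assume t: "test_function {0<..<L} \<eta>" "test_function {0<..<B} \<zeta>"
    have int: "set_integrable lborel (rect L B) (\<lambda>p. k p * tensor \<eta> \<zeta> p)" if "L2 (rect L B) k" for k
      using set_integrable_mult_test_function[OF L2_rect_imp_set_integrable[OF that] rect_measurable
          test_function_tensor[OF t]] by (simp add: mult.commute)
    have "(LBINT p:rect L B. g p * tensor \<eta> \<zeta> p) = (LBINT p:rect L B. h p * tensor \<eta> \<zeta> p)"
      using assms(3)[unfolded wdx_def, rule_format, OF t] assms(4)[unfolded wdx_def, rule_format, OF t] by simp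
    then have "(LBINT p:rect L B. (g p - h p) * tensor \<eta> \<zeta> p) = 0"
      using int[OF L2(1)] int[OF L2(2)] by (simp add: left_diff_distrib)
    then show "(LBINT p:{0<..<L} \<times> {0<..<B}. (g p - h p) * tensor \<eta> \<zeta> p) = 0"
      by (simp add: rect_def)
  qed auto
  then show ?thesis by (simp add: rect_def)
qed

lemma wdy_unique:
  assumes L2: "L2 (rect L B) g" "L2 (rect L B) h" and "L2 (rect L B) f" "wdy L B f g" "wdy L B f h"
  shows "AE z\<in>rect L B in lborel. g z = h z"
proof -
  have "AE z\<in>rect B L in lborel. g (prod.swap z) = h (prod.swap z)"
    using assms by (intro wdx_unique[where f = "\<lambda>p. f (prod.swap p)"] L2_rect_swap wdy_imp_wdx)
  from AE_swap[OF this] show ?thesis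
    by eventually_elim (auto simp: rect_def)
qed

lemma has_weak_deriv_refl: "locally_integrable \<Omega> f \<Longrightarrow> has_weak_deriv \<Omega> [] f f"
  by (simp add: has_weak_deriv_def)

text \<open>Square integrability of one version passes to the chosen one, whose measurability
  follows from local integrability.\<close>

lemma weak_deriv_L2:
  assumes "open \<Omega>" "has_weak_deriv \<Omega> bs f g" "L2 \<Omega> g"
  shows "L2 \<Omega> (weak_deriv \<Omega> bs f)"
proof (rule L2_cong_AE[OF assms(3)])
  note w = has_weak_deriv_weak_deriv[OF assms(2)]
  then show "set_borel_measurable lborel \<Omega> (weak_deriv \<Omega> bs f)"
    using assms(1) by (intro locally_integrable_measurable) (auto simp: has_weak_deriv_def)
  show "AE z\<in>\<Omega> in lborel. g z = weak_deriv \<Omega> bs f z"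
    by (rule has_weak_deriv_unique[OF assms(1,2) w])
qed

lemma smooth_partial_x:
  fixes \<phi> :: "real \<times> real \<Rightarrow> real"
  assumes "smooth \<phi>"
  shows "((\<lambda>x. \<phi> (x, y)) has_real_derivative partial_deriv (1, 0) \<phi> (x, y)) (at x)"
proof -
  note d = smooth_imp_differentiable[OF assms]
  have "((\<lambda>x. (x, y)) has_derivative (\<lambda>h. (h, 0))) (at x)"
    by (auto intro!: derivative_eq_intros)
  from has_derivative_compose[OF this d]
  have *: "((\<lambda>x. \<phi> (x, y)) has_derivative (\<lambda>h. frechet_derivative \<phi> (at (x, y)) (h, 0))) (at x)" .
  have "frechet_derivative \<phi> (at (x, y)) (h, 0) = partial_deriv (1, 0) \<phi> (x, y) * h" for h
    using linear_scale[OF has_derivative_linear[OF d], of _ h "(1, 0)"] by (simp add: partial_deriv_def)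
  then show ?thesis
    using * by (simp add: has_field_derivative_def)
qed

text \<open>The integrand in the hypothesis is the x-derivative of f times an affine weight, so its
  integral is the difference of the weighted end values. The weights L - x and x each isolate one
  end.\<close>

lemma x_lines_affine:
  assumes "0 < L" "L2 (rect L B) f" "L2 (rect L B) g" and lines: "x_lines L B (\<lambda>_ _. True) f g"
    and k: "AE y in lborel. y \<in> {0<..<B} \<longrightarrow> (LBINT x:{0<..<L}. f (x, y) * \<beta> + g (x, y) * (\<alpha> + \<beta> * x)) = 0"
  shows "x_lines L B (\<lambda>p q. (\<alpha> + \<beta> * L) * q = \<alpha> * p) f g"
proof -
  have c: "continuous_on UNIV (\<lambda>p :: real \<times> real. \<alpha> + \<beta> * fst p)" by (intro continuous_intros)
  have int: "set_integrable lborel (rect L B) (\<lambda>z. f z * \<beta> + g z * (\<alpha> + \<beta> * fst z))"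
    using assms L2_const[OF rect_measurable emeasure_rect] continuous_on_UNIV_L2_rect[OF c]
    by (intro set_integral_add L2_mult_integrable)
  show ?thesis
    using lines k set_integral_slices(1)[OF int[unfolded rect_def]] unfolding x_lines_def
  proof eventually_elim
    case (elim y)
    show ?case
    proof
      assume y: "y \<in> {0<..<B}"
      with elim obtain F where F: "ac_on 0 L F (\<lambda>x. g (x, y))"
        "AE x in lborel. x \<in> {0<..<L} \<longrightarrow> f (x, y) = F x" by blast
      have G: "ac_on 0 L (\<lambda>x. \<alpha> + \<beta> * x) (\<lambda>_. \<beta>)"
        by (rule ac_on_C1) (auto intro!: derivative_eq_intros)
      note FG = ac_on_mult[OF F(1) G]
      have "0 = (LBINT x:{0<..<L}. f (x, y) * \<beta> + g (x, y) * (\<alpha> + \<beta> * x))"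
        using elim y by simp
      also have "\<dots> = (LBINT x:{0<..<L}. g (x, y) * (\<alpha> + \<beta> * x) + F x * \<beta>)"
      proof (rule set_integral_cong_AE2)
        show "AE x in lborel. x \<in> {0<..<L} \<longrightarrow> f (x, y) * \<beta> + g (x, y) * (\<alpha> + \<beta> * x) = g (x, y) * (\<alpha> + \<beta> * x) + F x * \<beta>"
          using F(2) by eventually_elim auto
      qed (use elim y ac_onD(1)[OF FG] in \<open>auto intro: set_integrable_measurable\<close>)
      finally have "F L * (\<alpha> + \<beta> * L) = F 0 * (\<alpha> + \<beta> * 0)"
        using ac_onD(2)[OF FG, of L] \<open>0 < L\<close> by simp
      then show "\<exists>F. ac_on 0 L F (\<lambda>x. g (x, y)) \<and> (AE x in lborel. x \<in> {0<..<L} \<longrightarrow> f (x, y) = F x) \<and>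
          (\<alpha> + \<beta> * L) * F L = \<alpha> * F 0"
        using F by (intro exI[of _ F]) (simp add: mult.commute)
    qed
  qed
qed

text \<open>The part of a vanishing trace that is visible on x-lines: approximation of the function,
  of its derivative across the edge, and of the zero edge values. Dropping the tangential derivative
  lets edges of the other direction satisfy the same definition after exchanging the
  coordinates.\<close>

definition approx_trace_x :: "real \<Rightarrow> real \<Rightarrow> real \<Rightarrow> (real \<times> real \<Rightarrow> real) \<Rightarrow> (real \<times> real \<Rightarrow> real) \<Rightarrow> bool" where
  "approx_trace_x L B c f g \<longleftrightarrow> (\<exists>\<phi>. (\<forall>n. smooth (\<phi> n)) \<and>
     (\<lambda>n. L2_norm (rect L B) (\<lambda>z. \<phi> n z - f z)) \<longlonglongrightarrow> 0 \<and>
     (\<lambda>n. L2_norm (rect L B) (\<lambda>z. partial_deriv (1, 0) (\<phi> n) z - g z)) \<longlonglongrightarrow> 0 \<and>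
     (\<lambda>n. L2_norm {0<..<B} (\<lambda>y. \<phi> n (c, y))) \<longlonglongrightarrow> 0)"

text \<open>For a smooth approximant the weighted derivative integrates over a line to
  \<open>d\<close> times its value on the edge \<open>c\<close>, because \<open>aff\<close> makes
  the weight ignore the other edge. The edge values tend to 0 in L1, and the line integrals tend in
  L1 to those of f and g, which must therefore vanish.\<close>

lemma approx_trace_x_imp_x_lines:
  assumes "0 < L" and L2: "L2 (rect L B) f" "L2 (rect L B) g" and lines: "x_lines L B (\<lambda>_ _. True) f g"
    and tr: "approx_trace_x L B c f g"
    and aff: "\<And>v :: real \<Rightarrow> real. (\<alpha> + \<beta> * L) * v L - \<alpha> * v 0 = d * v c"
  shows "x_lines L B (\<lambda>p q. (\<alpha> + \<beta> * L) * q = \<alpha> * p) f g"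
proof (rule x_lines_affine[OF \<open>0 < L\<close> L2 lines])
  let ?R = "rect L B" and ?I = "{0<..<L}" and ?J = "{0<..<B}"
  obtain \<phi> where \<phi>: "\<And>n. smooth (\<phi> n)"
    and lim: "(\<lambda>n. L2_norm ?R (\<lambda>z. \<phi> n z - f z)) \<longlonglongrightarrow> 0"
      "(\<lambda>n. L2_norm ?R (\<lambda>z. partial_deriv (1, 0) (\<phi> n) z - g z)) \<longlonglongrightarrow> 0"
      "(\<lambda>n. L2_norm ?J (\<lambda>y. \<phi> n (c, y))) \<longlonglongrightarrow> 0"
    using tr unfolding approx_trace_x_def by (elim exE conjE) (rule that, simp_all)
  let ?\<phi>' = "\<lambda>n. partial_deriv (1, 0) (\<phi> n)"
  have \<phi>': "smooth (?\<phi>' n)" for n using \<phi> by (rule smooth_partial_deriv) (simp add: Basis_prod_def)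
  have cont_c: "continuous_on UNIV (\<lambda>y. \<phi> n (c, y))" for n
    using smooth_imp_continuous[OF \<phi>, of UNIV] by (rule continuous_on_compose2) (auto intro!: continuous_intros)
  have L2_\<phi>: "L2 ?R (\<phi> n)" "L2 ?R (?\<phi>' n)" "L2 ?J (\<lambda>y. \<phi> n (c, y))" for n
    by (intro continuous_on_UNIV_L2_rect continuous_on_UNIV_L2_Ioo cont_c smooth_imp_continuous \<phi> \<phi>')+
  have c: "continuous_on UNIV (\<lambda>p :: real \<times> real. \<alpha> + \<beta> * fst p)" by (intro continuous_intros)
  define M where "M h h' z = h z * \<beta> + h' z * (\<alpha> + \<beta> * fst z)" for h h' :: "real \<times> real \<Rightarrow> real" and z
  have int_M: "set_integrable lborel ?R (M h h')" if "L2 ?R h" "L2 ?R h'" for h h'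
    unfolding M_def using that L2_const[OF rect_measurable emeasure_rect] continuous_on_UNIV_L2_rect[OF c]
    by (intro set_integral_add L2_mult_integrable)
  \<comment> \<open>A bound for the affine weight on the interval from 0 to
    \<open>L\<close>.\<close>
  define C where "C = \<bar>\<alpha>\<bar> + \<bar>\<beta>\<bar> * L"
  define e where "e n z = \<bar>\<beta>\<bar> * \<bar>\<phi> n z - f z\<bar> + C * \<bar>?\<phi>' n z - g z\<bar>" for n z
  have int_abs: "set_integrable lborel ?R (\<lambda>z. \<bar>\<phi> n z - f z\<bar>)" "set_integrable lborel ?R (\<lambda>z. \<bar>?\<phi>' n z - g z\<bar>)" for n
    by (intro set_integrable_abs L2_rect_imp_set_integrable[OF L2_diff] L2 L2_\<phi>)+
  have int_e: "set_integrable lborel ?R (e n)" for n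
    unfolding e_def using int_abs by (intro set_integral_add set_integrable_mult_right)
  have diff_e: "\<bar>M (\<phi> n) (?\<phi>' n) z - M f g z\<bar> \<le> e n z" if "z \<in> ?R" for n z
  proof -
    have "\<bar>\<alpha> + \<beta> * fst z\<bar> \<le> \<bar>\<alpha>\<bar> + \<bar>\<beta>\<bar> * fst z"
      using that abs_triangle_ineq[of \<alpha> "\<beta> * fst z"] by (auto simp: rect_def abs_mult)
    also have "\<dots> \<le> C" using that unfolding C_def by (intro add_left_mono mult_left_mono) (auto simp: rect_def)
    finally have "\<bar>(?\<phi>' n z - g z) * (\<alpha> + \<beta> * fst z)\<bar> \<le> C * \<bar>?\<phi>' n z - g z\<bar>"
      unfolding abs_mult by (subst mult.commute) (rule mult_right_mono, auto)
    moreover have "M (\<phi> n) (?\<phi>' n) z - M f g z = (\<phi> n z - f z) * \<beta> + (?\<phi>' n z - g z) * (\<alpha> + \<beta> * fst z)"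
      by (simp add: M_def algebra_simps)
    moreover have "\<bar>(\<phi> n z - f z) * \<beta>\<bar> = \<bar>\<beta>\<bar> * \<bar>\<phi> n z - f z\<bar>" by (simp add: abs_mult)
    ultimately show ?thesis
      unfolding e_def by linarith
  qed
  let ?k = "\<lambda>y. LBINT x:?I. M f g (x, y)"
  have bound: "(LBINT y:?J. \<bar>?k y\<bar>) \<le> \<bar>d\<bar> * (LBINT y:?J. \<bar>\<phi> n (c, y)\<bar>) + (LBINT z:?R. e n z)" for n
  proof -
    have int_c: "set_integrable lborel ?J (\<lambda>y. \<bar>d\<bar> * \<bar>\<phi> n (c, y)\<bar>)"
      using L2_imp_set_integrable[OF L2_\<phi>(3) _ emeasure_Ioo_finite] by (intro set_integrable_mult_right set_integrable_abs) auto
    note s = set_integral_slices[OF int_M[OF L2, unfolded rect_def]] set_integral_slices[OF int_e[of n, unfolded rect_def]]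
      set_integral_slices(1)[OF int_M[OF L2_\<phi>(1,2)[of n], unfolded rect_def]]
    have "(LBINT y:?J. \<bar>?k y\<bar>) \<le> (LBINT y:?J. \<bar>d\<bar> * \<bar>\<phi> n (c, y)\<bar> + (LBINT x:?I. e n (x, y)))"
    proof (rule set_integral_mono_AE)
      show "set_integrable lborel ?J (\<lambda>y. \<bar>?k y\<bar>)" using s(2) by (rule set_integrable_abs)
      show "set_integrable lborel ?J (\<lambda>y. \<bar>d\<bar> * \<bar>\<phi> n (c, y)\<bar> + (LBINT x:?I. e n (x, y)))"
        using int_c s(5) by (rule set_integral_add)
      show "AE y\<in>?J in lborel. \<bar>?k y\<bar> \<le> \<bar>d\<bar> * \<bar>\<phi> n (c, y)\<bar> + (LBINT x:?I. e n (x, y))"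
        using s(1) s(4) s(7)
      proof eventually_elim
        case (elim y)
        show ?case
        proof
          assume y: "y \<in> ?J"
          let ?kn = "LBINT x:?I. M (\<phi> n) (?\<phi>' n) (x, y)"
          have i: "set_integrable lborel ?I (\<lambda>x. M f g (x, y))" "set_integrable lborel ?I (\<lambda>x. e n (x, y))"
            "set_integrable lborel ?I (\<lambda>x. M (\<phi> n) (?\<phi>' n) (x, y))" using elim y by auto
          have P: "ac_on 0 L (\<lambda>x. \<phi> n (x, y)) (\<lambda>x. ?\<phi>' n (x, y))"
          proof (rule ac_on_C1[OF smooth_partial_x[OF \<phi>]])
            show "continuous_on {0..L} (\<lambda>x. ?\<phi>' n (x, y))"
              using smooth_imp_continuous[OF \<phi>', of UNIV] by (rule continuous_on_compose2) (auto intro!: continuous_intros)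
          qed
          have G: "ac_on 0 L (\<lambda>x. \<alpha> + \<beta> * x) (\<lambda>_. \<beta>)"
            by (rule ac_on_C1) (auto intro!: derivative_eq_intros)
          \<comment> \<open>The fundamental theorem for the approximant times the weight;
            \<open>aff\<close> then merges the two end values into the value on the edge.\<close>
          have "\<phi> n (L, y) * (\<alpha> + \<beta> * L) = \<phi> n (0, y) * (\<alpha> + \<beta> * 0) + ?kn"
            using ac_onD(2)[OF ac_on_mult[OF P G], of L] \<open>0 < L\<close> by (simp add: M_def add.commute)
          then have kn: "?kn = d * \<phi> n (c, y)"
            using aff[of "\<lambda>x. \<phi> n (x, y)"] by (simp add: mult.commute)
          have "\<bar>?kn - ?k y\<bar> = \<bar>LBINT x:?I. M (\<phi> n) (?\<phi>' n) (x, y) - M f g (x, y)\<bar>"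
            using i by simp
          also have "\<dots> \<le> (LBINT x:?I. \<bar>M (\<phi> n) (?\<phi>' n) (x, y) - M f g (x, y)\<bar>)"
            using set_integral_norm_bound[OF set_integral_diff(1)[OF i(3,1)]] by simp
          also have "\<dots> \<le> (LBINT x:?I. e n (x, y))"
            using i y diff_e by (intro set_integral_mono set_integrable_abs set_integral_diff) (auto simp: rect_def)
          finally have "\<bar>?k y\<bar> \<le> \<bar>?kn\<bar> + (LBINT x:?I. e n (x, y))" by linarith
          then show "\<bar>?k y\<bar> \<le> \<bar>d\<bar> * \<bar>\<phi> n (c, y)\<bar> + (LBINT x:?I. e n (x, y))"
            by (simp add: kn abs_mult)
        qed
      qed
    qed
    also have "\<dots> = \<bar>d\<bar> * (LBINT y:?J. \<bar>\<phi> n (c, y)\<bar>) + (LBINT z:?R. e n z)"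
      using int_c s(5) s(6) by (simp add: rect_def)
    finally show ?thesis .
  qed
  have fin: "(\<lambda>n. LBINT z:?R. \<bar>\<phi> n z - f z\<bar>) \<longlonglongrightarrow> 0"
    "(\<lambda>n. LBINT z:?R. \<bar>?\<phi>' n z - g z\<bar>) \<longlonglongrightarrow> 0"
    "(\<lambda>n. LBINT y:?J. \<bar>\<phi> n (c, y)\<bar>) \<longlonglongrightarrow> 0"
    using L2_norm_tendsto_0_imp_L1[OF L2_diff[OF L2_\<phi>(1) L2(1)] rect_measurable emeasure_rect lim(1)]
      L2_norm_tendsto_0_imp_L1[OF L2_diff[OF L2_\<phi>(2) L2(2)] rect_measurable emeasure_rect lim(2)]
      L2_norm_tendsto_0_imp_L1[OF L2_\<phi>(3) _ emeasure_Ioo_finite lim(3)] by simp_all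
  have "(\<lambda>n. \<bar>d\<bar> * (LBINT y:?J. \<bar>\<phi> n (c, y)\<bar>) + (\<bar>\<beta>\<bar> * (LBINT z:?R. \<bar>\<phi> n z - f z\<bar>)
      + C * (LBINT z:?R. \<bar>?\<phi>' n z - g z\<bar>))) \<longlonglongrightarrow> \<bar>d\<bar> * 0 + (\<bar>\<beta>\<bar> * 0 + C * 0)"
    by (intro tendsto_intros fin)
  moreover have "(LBINT z:?R. e n z) = \<bar>\<beta>\<bar> * (LBINT z:?R. \<bar>\<phi> n z - f z\<bar>)
      + C * (LBINT z:?R. \<bar>?\<phi>' n z - g z\<bar>)" for n
    unfolding e_def using int_abs[of n] by simp
  ultimately have "(\<lambda>n. \<bar>d\<bar> * (LBINT y:?J. \<bar>\<phi> n (c, y)\<bar>) + (LBINT z:?R. e n z)) \<longlonglongrightarrow> 0"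
    by simp
  \<comment> \<open>The left side of \<open>bound\<close> does not depend on \<open>n\<close>, while
    its right side tends to 0.\<close>
  then have "(LBINT y:?J. \<bar>?k y\<bar>) \<le> 0"
    by (rule tendsto_lowerbound) (use bound in auto)
  moreover have "0 \<le> (LBINT y:?J. \<bar>?k y\<bar>)" by (rule set_integral_nonneg_AE) simp
  ultimately have "(LBINT y:?J. \<bar>?k y\<bar>) = 0" by (rule order.antisym)
  then have "(LBINT y. indicator ?J y *\<^sub>R \<bar>?k y\<bar>) = 0"
    unfolding set_lebesgue_integral_def[of lborel ?J] .
  then have "AE y in lborel. indicator ?J y *\<^sub>R \<bar>?k y\<bar> = 0"
    using set_integrable_abs[OF set_integral_slices(2)[OF int_M[OF L2, unfolded rect_def]]]
    by (subst (asm) integral_nonneg_eq_0_iff_AE) (auto simp: set_integrable_def)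
  then show "AE y\<in>?J in lborel. (LBINT x:?I. f (x, y) * \<beta> + g (x, y) * (\<alpha> + \<beta> * x)) = 0"
    by eventually_elim (auto simp: M_def)
qed

text \<open>The weight is L - x, with \<open>d = - L\<close>: it vanishes at the far end.\<close>

lemma approx_trace_x_0:
  assumes "0 < L" "L2 (rect L B) f" "L2 (rect L B) g" "wdx L B f g" "approx_trace_x L B 0 f g"
  shows "x_lines L B (\<lambda>p q. p = 0) f g"
  using approx_trace_x_imp_x_lines[OF assms(1-3) wdx_imp_x_lines[OF assms(1-4)] assms(5), of L "- 1" "- L"] \<open>0 < L\<close>
  by simp

text \<open>The weight is x, with \<open>d = L\<close>.\<close>

lemma approx_trace_x_L:
  assumes "0 < L" "L2 (rect L B) f" "L2 (rect L B) g" "wdx L B f g" "approx_trace_x L B L f g"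
  shows "x_lines L B (\<lambda>p q. q = 0) f g"
  using approx_trace_x_imp_x_lines[OF assms(1-3) wdx_imp_x_lines[OF assms(1-4)] assms(5), of 0 1 L] \<open>0 < L\<close>
  by simp

lemma multi_indices_1: "[] \<in> multi_indices 1" "[(1, 0) :: real \<times> real] \<in> multi_indices 1"
  "[(0, 1) :: real \<times> real] \<in> multi_indices 1"
  by (auto simp: multi_indices_def Basis_prod_def)

text \<open>\<open>has_trace\<close> measures distances to chosen weak derivatives even at order
  zero, where the choice is only almost everywhere equal to \<open>f\<close>; uniqueness puts
  \<open>f\<close> itself in its place.\<close>

lemma has_trace_approx:
  assumes tr: "has_trace (rect L B) e I f (\<lambda>_. 0)" and f: "L2 (rect L B) f"
  obtains \<phi> g1 g2 where "\<And>n. smooth (\<phi> n)"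
    "has_weak_deriv (rect L B) [(1, 0)] f g1" "L2 (rect L B) g1"
    "has_weak_deriv (rect L B) [(0, 1)] f g2" "L2 (rect L B) g2"
    "(\<lambda>n. L2_norm (rect L B) (\<lambda>z. \<phi> n z - f z)) \<longlonglongrightarrow> 0"
    "(\<lambda>n. L2_norm (rect L B) (\<lambda>z. partial_deriv (1, 0) (\<phi> n) z - g1 z)) \<longlonglongrightarrow> 0"
    "(\<lambda>n. L2_norm (rect L B) (\<lambda>z. partial_deriv (0, 1) (\<phi> n) z - g2 z)) \<longlonglongrightarrow> 0"
    "(\<lambda>n. L2_norm I (\<lambda>s. \<phi> n (e s))) \<longlonglongrightarrow> 0"
proof -
  let ?R = "rect L B"
  have sob: "\<exists>g. has_weak_deriv ?R bs f g \<and> L2 ?R g" if "bs \<in> multi_indices 1" for bs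
    using tr that by (simp add: has_trace_def sobolev_def)
  obtain \<phi> where \<phi>: "\<And>n. smooth (\<phi> n)"
    and lim: "\<And>bs. bs \<in> multi_indices 1 \<Longrightarrow>
      (\<lambda>n. L2_norm ?R (\<lambda>z. partial_derivs bs (\<phi> n) z - weak_deriv ?R bs f z)) \<longlonglongrightarrow> 0"
    and lim_e: "(\<lambda>n. L2_norm I (\<lambda>s. \<phi> n (e s))) \<longlonglongrightarrow> 0"
    using tr unfolding has_trace_def by (elim exE conjE) (rule that, simp_all)
  have wd: "has_weak_deriv ?R bs f (weak_deriv ?R bs f)" "L2 ?R (weak_deriv ?R bs f)"
    if "bs \<in> multi_indices 1" for bs
    using sob[OF that] has_weak_deriv_weak_deriv weak_deriv_L2[OF open_rect] by blast+
  have loc: "locally_integrable ?R f"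
    by (rule set_integrable_imp_locally_integrable[OF L2_rect_imp_set_integrable[OF f]])
  have "L2_norm ?R (\<lambda>z. \<phi> n z - weak_deriv ?R [] f z) = L2_norm ?R (\<lambda>z. \<phi> n z - f z)" for n
  proof (rule L2_norm_cong_AE)
    have "L2 ?R (\<phi> n)" by (intro continuous_on_UNIV_L2_rect smooth_imp_continuous \<phi>)
    then show "set_borel_measurable lborel ?R (\<lambda>z. \<phi> n z - weak_deriv ?R [] f z)"
      "set_borel_measurable lborel ?R (\<lambda>z. \<phi> n z - f z)"
      using f wd(2)[OF multi_indices_1(1)] by (auto intro: L2_measurable L2_diff)
    show "AE z\<in>?R in lborel. \<phi> n z - weak_deriv ?R [] f z = \<phi> n z - f z"
      using has_weak_deriv_unique[OF open_rect wd(1)[OF multi_indices_1(1)] has_weak_deriv_refl[OF loc]]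
      by eventually_elim auto
  qed
  with lim[OF multi_indices_1(1)] have "(\<lambda>n. L2_norm ?R (\<lambda>z. \<phi> n z - f z)) \<longlonglongrightarrow> 0" by simp
  then show thesis
    using lim[OF multi_indices_1(2)] lim[OF multi_indices_1(3)]
    by (intro that[of \<phi> "weak_deriv ?R [(1, 0)] f" "weak_deriv ?R [(0, 1)] f"] \<phi> lim_e
        wd[OF multi_indices_1(2)] wd[OF multi_indices_1(3)]) simp_all
qed

text \<open>The derivative approximated by the trace sequence need not be the given
  \<open>g\<close>; both are weak x-derivatives of \<open>f\<close>, so the norms coincide.\<close>

lemma vanishes_on_x_approx:
  assumes tr: "vanishes_on_x L B c f" and L2: "L2 (rect L B) f" "L2 (rect L B) g" and "wdx L B f g"
  shows "approx_trace_x L B c f g"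
proof -
  obtain \<phi> g1 where \<phi>: "\<And>n. smooth (\<phi> n)"
    and g1: "has_weak_deriv (rect L B) [(1, 0)] f g1" "L2 (rect L B) g1"
    and lim: "(\<lambda>n. L2_norm (rect L B) (\<lambda>z. \<phi> n z - f z)) \<longlonglongrightarrow> 0"
      "(\<lambda>n. L2_norm (rect L B) (\<lambda>z. partial_deriv (1, 0) (\<phi> n) z - g1 z)) \<longlonglongrightarrow> 0"
      "(\<lambda>n. L2_norm {0<..<B} (\<lambda>y. \<phi> n (c, y))) \<longlonglongrightarrow> 0"
    using has_trace_approx[OF tr[unfolded vanishes_on_x_def] L2(1)] by blast
  have loc: "locally_integrable (rect L B) f"
    by (rule set_integrable_imp_locally_integrable[OF L2_rect_imp_set_integrable[OF L2(1)]])
  have "wdx L B f g1"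
    using has_weak_deriv_imp_wdx[of L B 0 0 f f g1] has_weak_deriv_refl[OF loc] g1(1) by (simp add: dxy_def)
  then have ae: "AE z\<in>rect L B in lborel. g1 z = g z"
    by (rule wdx_unique[OF g1(2) L2(2) _ assms(4)])
  have "L2_norm (rect L B) (\<lambda>z. partial_deriv (1, 0) (\<phi> n) z - g1 z)
      = L2_norm (rect L B) (\<lambda>z. partial_deriv (1, 0) (\<phi> n) z - g z)" for n
  proof (rule L2_norm_cong_AE)
    have "L2 (rect L B) (partial_deriv (1, 0) (\<phi> n))"
      by (intro continuous_on_UNIV_L2_rect smooth_imp_continuous smooth_partial_deriv \<phi>) (simp add: Basis_prod_def)
    then show "set_borel_measurable lborel (rect L B) (\<lambda>z. partial_deriv (1, 0) (\<phi> n) z - g1 z)"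
      "set_borel_measurable lborel (rect L B) (\<lambda>z. partial_deriv (1, 0) (\<phi> n) z - g z)"
      using g1(2) L2(2) by (auto intro: L2_measurable L2_diff)
  qed (use ae in \<open>auto elim: eventually_mono\<close>)
  then show ?thesis
    unfolding approx_trace_x_def using \<phi> lim by (intro exI[of _ \<phi>]) simp
qed

section \<open>Edges with constant y, treated by exchanging the coordinates\<close>

lemma L2_norm_rect_swap:
  assumes "set_borel_measurable lborel (rect L B) f"
  shows "L2_norm (rect B L) (\<lambda>p. f (prod.swap p)) = L2_norm (rect L B) f"
  unfolding L2_norm_def power2_eq_square
  using set_integral_rect_swap[OF set_borel_measurable_mult[OF assms assms]] by simp

lemma smooth_swap:
  fixes \<phi> :: "real \<times> real \<Rightarrow> real"
  assumes "smooth \<phi>"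
  shows "smooth (\<lambda>p. \<phi> (prod.swap p))"
  unfolding smooth_def
proof
  have "bounded_linear (prod.swap :: real \<times> real \<Rightarrow> real \<times> real)"
    unfolding prod.swap_def by (intro bounded_linear_Pair bounded_linear_fst bounded_linear_snd)
  then show "C_k k (\<lambda>p. \<phi> (prod.swap p))" for k
    using assms by (intro C_k_compose_linear[of k \<phi> prod.swap]) (auto simp: smooth_def Basis_prod_def)
qed

lemma partial_deriv_swap:
  fixes \<phi> :: "real \<times> real \<Rightarrow> real"
  assumes "smooth \<phi>"
  shows "partial_deriv (1, 0) (\<lambda>p. \<phi> (prod.swap p)) p = partial_deriv (0, 1) \<phi> (prod.swap p)"
proof -
  have "bounded_linear (prod.swap :: real \<times> real \<Rightarrow> real \<times> real)"
    unfolding prod.swap_def by (intro bounded_linear_Pair bounded_linear_fst bounded_linear_snd)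
  from has_derivative_compose[OF bounded_linear_imp_has_derivative[OF this] smooth_imp_differentiable[OF assms]]
  have "((\<lambda>p. \<phi> (prod.swap p)) has_derivative (\<lambda>h. frechet_derivative \<phi> (at (prod.swap p)) (prod.swap h))) (at p)" .
  from partial_deriv_eq[OF this] show ?thesis by (simp add: partial_deriv_def)
qed

lemma vanishes_on_y_approx:
  assumes tr: "vanishes_on_y L B c f" and L2: "L2 (rect L B) f" "L2 (rect L B) g" and "wdy L B f g"
  shows "approx_trace_x B L c (\<lambda>p. f (prod.swap p)) (\<lambda>p. g (prod.swap p))"
proof -
  obtain \<phi> g2 where \<phi>: "\<And>n. smooth (\<phi> n)"
    and g2: "has_weak_deriv (rect L B) [(0, 1)] f g2" "L2 (rect L B) g2"
    and lim: "(\<lambda>n. L2_norm (rect L B) (\<lambda>z. \<phi> n z - f z)) \<longlonglongrightarrow> 0"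
      "(\<lambda>n. L2_norm (rect L B) (\<lambda>z. partial_deriv (0, 1) (\<phi> n) z - g2 z)) \<longlonglongrightarrow> 0"
      "(\<lambda>n. L2_norm {0<..<L} (\<lambda>x. \<phi> n (x, c))) \<longlonglongrightarrow> 0"
    using has_trace_approx[OF tr[unfolded vanishes_on_y_def] L2(1)] by blast
  have loc: "locally_integrable (rect L B) f"
    by (rule set_integrable_imp_locally_integrable[OF L2_rect_imp_set_integrable[OF L2(1)]])
  have "wdy L B f g2"
    using has_weak_deriv_imp_wdy[of L B 0 0 f f g2] has_weak_deriv_refl[OF loc] g2(1) by (simp add: dxy_def)
  then have ae: "AE z\<in>rect L B in lborel. g2 z = g z"
    by (rule wdy_unique[OF g2(2) L2(2) L2(1) _ assms(4)])
  have L2': "L2 (rect L B) (\<phi> n)" "L2 (rect L B) (partial_deriv (0, 1) (\<phi> n))" for n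
    by (auto intro!: continuous_on_UNIV_L2_rect smooth_imp_continuous[OF \<phi>]
        smooth_imp_continuous[OF smooth_partial_deriv[OF \<phi>]] simp: Basis_prod_def)
  have eq2: "L2_norm (rect L B) (\<lambda>z. partial_deriv (0, 1) (\<phi> n) z - g2 z)
      = L2_norm (rect B L) (\<lambda>p. partial_deriv (1, 0) (\<lambda>p. \<phi> n (prod.swap p)) p - g (prod.swap p))" for n
    unfolding partial_deriv_swap[OF \<phi>]
  proof (subst L2_norm_rect_swap[of L B "\<lambda>z. partial_deriv (0, 1) (\<phi> n) z - g z"])
    show m: "set_borel_measurable lborel (rect L B) (\<lambda>z. partial_deriv (0, 1) (\<phi> n) z - g z)"
      using L2'(2) L2(2) by (intro L2_measurable L2_diff)
    show "L2_norm (rect L B) (\<lambda>z. partial_deriv (0, 1) (\<phi> n) z - g2 z)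
        = L2_norm (rect L B) (\<lambda>z. partial_deriv (0, 1) (\<phi> n) z - g z)"
    proof (rule L2_norm_cong_AE[OF _ m])
      show "set_borel_measurable lborel (rect L B) (\<lambda>z. partial_deriv (0, 1) (\<phi> n) z - g2 z)"
        using L2'(2) g2(2) by (intro L2_measurable L2_diff)
    qed (use ae in \<open>auto elim: eventually_mono\<close>)
  qed
  have eq1: "L2_norm (rect L B) (\<lambda>z. \<phi> n z - f z)
      = L2_norm (rect B L) (\<lambda>p. \<phi> n (prod.swap p) - f (prod.swap p))" for n
    using L2'(1) L2(1) by (intro L2_norm_rect_swap[symmetric] L2_measurable L2_diff)
  show ?thesis
    unfolding approx_trace_x_def using lim smooth_swap[OF \<phi>]
    by (intro exI[of _ "\<lambda>n p. \<phi> n (prod.swap p)"]) (simp add: eq1 eq2)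
qed

lemma vanishes_on_x_lines:
  assumes "0 < L" "L2 (rect L B) f" "L2 (rect L B) g" "wdx L B f g" "vanishes_on_x L B 0 f" "vanishes_on_x L B L f"
  shows "x_lines L B (\<lambda>p q. p = 0 \<and> q = 0) f g"
  using assms by (intro x_lines_conj approx_trace_x_0 approx_trace_x_L vanishes_on_x_approx)

lemma vanishes_on_y_lines:
  assumes "0 < B" "L2 (rect L B) f" "L2 (rect L B) g" "wdy L B f g" "vanishes_on_y L B 0 f" "vanishes_on_y L B B f"
  shows "y_lines L B (\<lambda>p q. p = 0 \<and> q = 0) f g"
  unfolding y_lines_def using assms
  by (intro x_lines_conj approx_trace_x_0 approx_trace_x_L vanishes_on_y_approx L2_rect_swap wdy_imp_wdx)

lemma x_lines_tensor:
  assumes "\<And>x. (\<eta> has_real_derivative \<eta>' x) (at x)" "continuous_on UNIV \<eta>'"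
    and "\<And>y. Q (\<eta> 0 * \<psi> y) (\<eta> L * \<psi> y)"
  shows "x_lines L B Q (tensor \<eta> \<psi>) (tensor \<eta>' \<psi>)"
proof -
  have "ac_on 0 L (\<lambda>x. \<eta> x * \<psi> y) (\<lambda>x. \<eta>' x * \<psi> y)" for y
    using assms(1,2) by (intro ac_on_C1) (auto intro!: derivative_eq_intros continuous_intros continuous_on_subset[OF assms(2)])
  then show ?thesis
    unfolding x_lines_def using assms(3) by (intro AE_I2 impI exI[of _ "\<lambda>x. \<eta> x * \<psi> _"]) auto
qed

lemma L2_tensor:
  assumes "continuous_on UNIV \<eta>" "continuous_on UNIV \<psi>"
  shows "L2 (rect L B) (tensor \<eta> \<psi>)"
proof (rule continuous_on_UNIV_L2_rect)
  show "continuous_on UNIV (tensor \<eta> \<psi>)"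
    unfolding tensor_def
    by (intro continuous_intros continuous_on_compose2[OF assms(1)] continuous_on_compose2[OF assms(2)]) auto
qed

text \<open>The tangential derivative inherits the vanishing trace: testing \<open>f\<^sub>y \<eta>' + f\<^sub>x\<^sub>y \<eta>\<close> with \<open>\<zeta>(y)\<close> moves
  the \<open>y\<close>-derivative to \<open>\<zeta>\<close>, and then \<open>f = 0\<close> at both ends of the \<open>x\<close>-lines applies.\<close>

lemma x_lines_tangential:
  assumes "0 < L" "0 < B"
    and f: "x_lines L B (\<lambda>p q. p = 0 \<and> q = 0) f fx" and fy: "y_lines L B (\<lambda>_ _. True) f fy"
    and fxy: "y_lines L B (\<lambda>_ _. True) fx fxy" and fyx: "x_lines L B (\<lambda>_ _. True) fy fxy"
    and L2: "L2 (rect L B) f" "L2 (rect L B) fx" "L2 (rect L B) fy" "L2 (rect L B) fxy"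
  shows "x_lines L B (\<lambda>p q. p = 0 \<and> q = 0) fy fxy"
proof -
  let ?R = "rect L B"
  have *: "x_lines L B (\<lambda>p q. (\<alpha> + \<beta> * L) * q = \<alpha> * p) fy fxy" for \<alpha> \<beta>
  proof (rule x_lines_affine[OF \<open>0 < L\<close> L2(3,4) fyx])
    let ?\<eta> = "\<lambda>x. \<alpha> + \<beta> * x" and ?\<beta> = "\<lambda>_ :: real. \<beta>"
    have c: "continuous_on UNIV ?\<eta>" "continuous_on UNIV ?\<beta>" by (intro continuous_intros)+
    define M where "M z = fy z * \<beta> + fxy z * ?\<eta> (fst z)" for z
    have c': "continuous_on UNIV (\<lambda>p :: real \<times> real. ?\<eta> (fst p))" by (intro continuous_intros)
    have int_M: "set_integrable lborel ?R M"
      unfolding M_def using L2 L2_const[OF rect_measurable emeasure_rect] continuous_on_UNIV_L2_rect[OF c']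
      by (intro set_integral_add L2_mult_integrable)
    \<comment> \<open>Pointwise information on almost every line is recovered from orthogonality to
      all bumps in y.\<close>
    have "AE y in lborel. y \<in> {0<..<B} \<longrightarrow> (LBINT x:{0<..<L}. M (x, y)) = 0"
    proof (rule AE_zero_if_orthogonal_to_bumps)
      show "locally_integrable {0<..<B} (\<lambda>y. LBINT x:{0<..<L}. M (x, y))"
        by (rule set_integrable_imp_locally_integrable[OF set_integral_slices(2)[OF int_M[unfolded rect_def]]])
      fix p q :: real and n assume pq: "cbox p q \<subseteq> {0<..<B}"
      define \<zeta> where "\<zeta> = box_bump p q n"
      define \<zeta>' where "\<zeta>' = partial_deriv 1 \<zeta>"
      have t: "test_function {0<..<B} \<zeta>"
        unfolding \<zeta>_def using pq box_subset_cbox by (metis order_trans test_function_box_bump test_function_mono)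
      have s: "smooth \<zeta>" "smooth \<zeta>'"
        using t by (auto simp: \<zeta>'_def intro: test_function_smooth smooth_partial_deriv)
      have \<zeta>c: "continuous_on UNIV \<zeta>" "continuous_on UNIV \<zeta>'" using s by (auto intro: smooth_imp_continuous)
      have \<zeta>0: "\<zeta> 0 = 0" "\<zeta> B = 0" using test_function_eq_0[OF t] by auto
      have y_tensor: "y_lines L B (\<lambda>p q. p = 0 \<and> q = 0) (tensor \<xi> \<zeta>) (tensor \<xi> \<zeta>')" for \<xi> :: "real \<Rightarrow> real"
      proof -
        have "x_lines B L (\<lambda>p q. p = 0 \<and> q = 0) (tensor \<zeta> \<xi>) (tensor \<zeta>' \<xi>)"
          using \<zeta>0 \<zeta>c(2) smooth_real_has_derivative[OF s(1)] by (intro x_lines_tensor) (auto simp: \<zeta>'_def)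
        then show ?thesis unfolding y_lines_def by (simp add: tensor_def[abs_def] mult.commute)
      qed
      have 1: "(LBINT z:?R. f z * tensor ?\<beta> \<zeta>' z) = - (LBINT z:?R. fy z * tensor ?\<beta> \<zeta> z)"
        by (rule y_lines_ibp[OF \<open>0 < B\<close> fy y_tensor L2(1,3) L2_tensor L2_tensor]) (use c \<zeta>c in auto)
      have 2: "(LBINT z:?R. fx z * tensor ?\<eta> \<zeta>' z) = - (LBINT z:?R. fxy z * tensor ?\<eta> \<zeta> z)"
        by (rule y_lines_ibp[OF \<open>0 < B\<close> fxy y_tensor L2(2,4) L2_tensor L2_tensor]) (use c \<zeta>c in auto)
      \<comment> \<open>The affine factor need not vanish at the ends of the x-lines; here
        \<open>f\<close> does.\<close>
      have "x_lines L B (\<lambda>_ _. True) (tensor ?\<eta> \<zeta>') (tensor ?\<beta> \<zeta>')"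
        by (rule x_lines_tensor) (auto intro!: derivative_eq_intros)
      from x_lines_ibp[OF \<open>0 < L\<close> f this L2(1,2) L2_tensor L2_tensor]
      have 3: "(LBINT z:?R. f z * tensor ?\<beta> \<zeta>' z) = - (LBINT z:?R. fx z * tensor ?\<eta> \<zeta>' z)"
        using c \<zeta>c by auto
      have int: "set_integrable lborel ?R (\<lambda>z. fy z * tensor ?\<beta> \<zeta> z)" "set_integrable lborel ?R (\<lambda>z. fxy z * tensor ?\<eta> \<zeta> z)"
        using L2 c \<zeta>c by (auto intro!: L2_mult_integrable L2_tensor)
      have sum: "fy z * tensor ?\<beta> \<zeta> z + fxy z * tensor ?\<eta> \<zeta> z = M z * \<zeta> (snd z)" for z
        by (simp add: M_def tensor_def algebra_simps)
      have "0 = (LBINT z:?R. M z * \<zeta> (snd z))"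
        using 1 2 3 int unfolding sum[symmetric] by simp
      also have "\<dots> = (LBINT y:{0<..<B}. LBINT x:{0<..<L}. M (x, y) * \<zeta> y)"
        using set_integral_slices(3)[OF set_integral_add(1)[OF int, unfolded sum rect_def]] by (simp add: rect_def)
      finally show "(LBINT y:{0<..<B}. (LBINT x:{0<..<L}. M (x, y)) * box_bump p q n y) = 0"
        by (simp add: \<zeta>_def)
    qed simp
    then show "AE y in lborel. y \<in> {0<..<B} \<longrightarrow> (LBINT x:{0<..<L}. fy (x, y) * \<beta> + fxy (x, y) * (\<alpha> + \<beta> * x)) = 0"
      by (simp add: M_def)
  qed
  have "x_lines L B (\<lambda>p q. p = 0) fy fxy"
    using *[of L "- 1"] by (rule x_lines_mono) (use \<open>0 < L\<close> in auto)
  moreover have "x_lines L B (\<lambda>p q. q = 0) fy fxy"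
    using *[of 0 1] by (rule x_lines_mono) (use \<open>0 < L\<close> in auto)
  ultimately show ?thesis by (rule x_lines_conj[OF \<open>0 < L\<close>])
qed

section \<open>The energy estimate\<close>

text \<open>With \<open>h\<close> a second derivative of \<open>f\<close> and \<open>X\<close> the
  squared norm of the first, expanding the square of h + k f gives |h|^2 >= 2 k X - k^2 |f|^2, and X
  >= k |f|^2. This avoids a Wirtinger inequality for the first derivative, whose end values are
  unknown in the y-direction.\<close>

lemma integral_square_second_deriv_bound:
  assumes L2: "L2 \<Omega> f" "L2 \<Omega> h" and k: "0 \<le> k"
    and fh: "(LBINT z:\<Omega>. f z * h z) = - X" and X: "k * (LBINT z:\<Omega>. (f z)\<^sup>2) \<le> X"
  shows "k\<^sup>2 * (LBINT z:\<Omega>. (f z)\<^sup>2) \<le> (LBINT z:\<Omega>. (h z)\<^sup>2)"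
proof -
  let ?S = "LBINT z:\<Omega>. (f z)\<^sup>2" and ?P = "LBINT z:\<Omega>. (h z)\<^sup>2"
  have "0 \<le> (LBINT z:\<Omega>. (h z + k * f z)\<^sup>2)" by (rule set_integral_nonneg_AE) simp
  also have "\<dots> = (LBINT z:\<Omega>. (h z)\<^sup>2 + (2 * k) * (f z * h z) + k\<^sup>2 * (f z)\<^sup>2)"
    by (simp add: power2_sum power_mult_distrib algebra_simps)
  also have "\<dots> = ?P + (2 * k) * (- X) + k\<^sup>2 * ?S"
    using L2_square_integrable[OF L2(1)] L2_square_integrable[OF L2(2)] L2_mult_integrable[OF L2] fh by simp
  finally have "2 * k * X \<le> ?P + k\<^sup>2 * ?S" by simp
  moreover have "k * (k * ?S) \<le> k * X" using X k by (rule mult_left_mono)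
  ultimately show ?thesis by (simp add: power2_eq_square)
qed

text \<open>Twice the line integral is - F(0)^2, since F vanishes at the other end. This fixes the
  sign of the fifth-order term.\<close>

lemma x_lines_integral_mult_deriv_le:
  assumes "0 < L" and f: "x_lines L B (\<lambda>p q. q = 0) f g" and L2: "L2 (rect L B) f" "L2 (rect L B) g"
  shows "(LBINT z:rect L B. f z * g z) \<le> 0"
proof -
  note int = L2_mult_integrable[OF L2, unfolded rect_def]
  have "AE y in lborel. y \<in> {0<..<B} \<longrightarrow> 0 \<le> - (LBINT x:{0<..<L}. f (x, y) * g (x, y))"
    using f[unfolded x_lines_def] set_integral_slices(1)[OF int]
  proof eventually_elim
    case (elim y)
    show ?case
    proof
      assume y: "y \<in> {0<..<B}"
      with elim obtain F where F: "ac_on 0 L F (\<lambda>x. g (x, y))"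
        "AE x in lborel. x \<in> {0<..<L} \<longrightarrow> f (x, y) = F x" "F L = 0" by blast
      note FF = ac_on_mult[OF F(1) F(1)]
      have "2 * (LBINT x:{0<..<L}. f (x, y) * g (x, y)) = (LBINT x:{0<..<L}. 2 * (f (x, y) * g (x, y)))"
        by simp
      also have "\<dots> = (LBINT x:{0<..<L}. g (x, y) * F x + F x * g (x, y))"
      proof (rule set_integral_cong_AE2)
        show "AE x in lborel. x \<in> {0<..<L} \<longrightarrow> 2 * (f (x, y) * g (x, y)) = g (x, y) * F x + F x * g (x, y)"
          using F(2) by eventually_elim auto
      qed (use elim y ac_onD(1)[OF FF] in \<open>auto intro: set_integrable_measurable\<close>)
      also have "\<dots> = - (F 0 * F 0)" using ac_onD(2)[OF FF, of L] F(3) \<open>0 < L\<close> by simp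
      finally have "2 * (LBINT x:{0<..<L}. f (x, y) * g (x, y)) \<le> 0" by simp
      then show "0 \<le> - (LBINT x:{0<..<L}. f (x, y) * g (x, y))" by simp
    qed
  qed
  then have "0 \<le> (LBINT y:{0<..<B}. - (LBINT x:{0<..<L}. f (x, y) * g (x, y)))"
    by (rule set_integral_nonneg_AE)
  also have "\<dots> = - (LBINT z:rect L B. f z * g z)"
    using set_integral_slices(2,3)[OF int] by (simp add: set_integral_uminus rect_def)
  finally show ?thesis by simp
qed

text \<open>The estimate at a single time: \<open>f\<close> stands for u(t) and \<open>w\<close> for
  u_t(t), and the left side is half the time derivative of the energy.\<close>

theorem energy_estimate:
  fixes L B \<gamma> :: real and f w :: "real \<times> real \<Rightarrow> real"
  defines "d \<equiv> \<lambda>i j. weak_deriv (rect L B) (dxy i j) f"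
  assumes pos: "0 < L" "0 < B" and \<gamma>: "\<gamma> \<le> 0" and f: "L2 (rect L B) f" and w: "L2 (rect L B) w"
    and reg: "\<And>i j. i + j \<le> 4 \<or> (i = 5 \<and> j = 0) \<Longrightarrow> \<exists>g. has_weak_deriv (rect L B) (dxy i j) f g \<and> L2 (rect L B) g"
    and bc: "boundary_conditions L B f"
    and eq: "AE z\<in>rect L B in lborel. w z + (d 4 0 z + 2 * d 2 2 z + d 0 4 z) + \<gamma> * (d 2 0 z + d 0 2 z)
      + (d 3 0 z + d 1 2 z) + f z * d 1 0 z - d 5 0 z = 0"
  shows "(LBINT z:rect L B. f z * w z) \<le>
    - (((pi / L)\<^sup>2 + (pi / B)\<^sup>2)\<^sup>2 - \<gamma> * ((pi / L)\<^sup>2 + (pi / B)\<^sup>2)) * (LBINT z:rect L B. (f z)\<^sup>2)"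
proof -
  let ?R = "rect L B"
  define ip where "ip g h = (LBINT z:?R. g z * h z)" for g h :: "real \<times> real \<Rightarrow> real"
  have loc: "locally_integrable ?R f"
    by (rule set_integrable_imp_locally_integrable[OF L2_rect_imp_set_integrable[OF f]])
  have f0: "has_weak_deriv ?R (dxy 0 0) f f"
    using has_weak_deriv_refl[OF loc] by (simp add: dxy_def)
  have wd: "has_weak_deriv ?R (dxy i j) f (d i j)" and L2: "L2 ?R (d i j)"
    if "i + j \<le> 4 \<or> (i = 5 \<and> j = 0)" for i j
    using reg[OF that] has_weak_deriv_weak_deriv weak_deriv_L2[OF open_rect] unfolding d_def by blast+
  have wx: "wdx L B (d i j) (d (Suc i) j)" if "i + j \<le> 3 \<or> (i = 4 \<and> j = 0)" for i j
    using that by (intro has_weak_deriv_imp_wdx[OF wd wd]) auto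
  have wy: "wdy L B (d i j) (d i (Suc j))" if "i + j \<le> 3" for i j
    using that by (intro has_weak_deriv_imp_wdy[OF wd wd]) auto
  have xl: "x_lines L B (\<lambda>_ _. True) (d i j) (d (Suc i) j)" if "i + j \<le> 3 \<or> (i = 4 \<and> j = 0)" for i j
    using that by (intro wdx_imp_x_lines[OF pos(1) L2 L2 wx]) auto
  have yl: "y_lines L B (\<lambda>_ _. True) (d i j) (d i (Suc j))" if "i + j \<le> 3" for i j
    using that by (intro wdy_imp_y_lines[OF pos(2) L2 L2 wy]) auto
  have L2s: "L2 ?R (d 1 0)" "L2 ?R (d 2 0)" "L2 ?R (d 3 0)" "L2 ?R (d 4 0)" "L2 ?R (d 5 0)"
    "L2 ?R (d 0 1)" "L2 ?R (d 0 2)" "L2 ?R (d 0 3)" "L2 ?R (d 0 4)"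
    "L2 ?R (d 1 1)" "L2 ?R (d 1 2)" "L2 ?R (d 2 1)" "L2 ?R (d 2 2)"
    by (auto intro!: L2)
  have wfx: "wdx L B f (d 1 0)" using has_weak_deriv_imp_wdx[OF f0, of "d 1 0"] wd[of 1 0] by simp
  have wfy: "wdy L B f (d 0 1)" using has_weak_deriv_imp_wdy[OF f0, of "d 0 1"] wd[of 0 1] by simp
  have v: "vanishes_on_x L B 0 f" "vanishes_on_x L B L f" "vanishes_on_y L B 0 f" "vanishes_on_y L B B f"
    "vanishes_on_y L B 0 (d 0 2)" "vanishes_on_y L B B (d 0 2)"
    "vanishes_on_x L B 0 (d 1 0)" "vanishes_on_x L B L (d 1 0)" "vanishes_on_x L B L (d 2 0)"
    using bc by (simp_all add: boundary_conditions_def d_def Let_def)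
  let ?zero = "\<lambda>p q :: real. p = 0 \<and> q = 0"
  have X0: "x_lines L B ?zero f (d 1 0)"
    by (rule vanishes_on_x_lines[OF pos(1) f L2s(1) wfx v(1,2)])
  have Y0: "y_lines L B ?zero f (d 0 1)"
    by (rule vanishes_on_y_lines[OF pos(2) f L2s(6) wfy v(3,4)])
  have X1: "x_lines L B ?zero (d 1 0) (d 2 0)"
    using vanishes_on_x_lines[OF pos(1) L2s(1,2) _ v(7,8)] wx[of 1 0] by (simp add: numeral_2_eq_2)
  have X2: "x_lines L B (\<lambda>p q. q = 0) (d 2 0) (d 3 0)"
    using approx_trace_x_L[OF pos(1) L2s(2,3) _ vanishes_on_x_approx[OF v(9) L2s(2,3)]] wx[of 2 0]
    by (simp add: numeral_3_eq_3 numeral_2_eq_2)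
  have X3: "x_lines L B (\<lambda>_ _. True) (d 3 0) (d 4 0)" and X4: "x_lines L B (\<lambda>_ _. True) (d 4 0) (d 5 0)"
    and X11: "x_lines L B (\<lambda>_ _. True) (d 1 1) (d 2 1)" and X01': "x_lines L B (\<lambda>_ _. True) (d 0 1) (d 1 1)"
    using xl[of 3 0] xl[of 4 0] xl[of 1 1] xl[of 0 1] by (simp_all add: eval_nat_numeral)
  have Y1: "y_lines L B (\<lambda>_ _. True) (d 0 1) (d 0 2)" and Y3: "y_lines L B (\<lambda>_ _. True) (d 0 3) (d 0 4)"
    and Y21: "y_lines L B (\<lambda>_ _. True) (d 2 1) (d 2 2)" and Y11: "y_lines L B (\<lambda>_ _. True) (d 1 1) (d 1 2)"
    and Y10: "y_lines L B (\<lambda>_ _. True) (d 1 0) (d 1 1)"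
    using yl[of 0 1] yl[of 0 3] yl[of 2 1] yl[of 1 1] yl[of 1 0] by (simp_all add: eval_nat_numeral)
  have Y2: "y_lines L B ?zero (d 0 2) (d 0 3)"
    using vanishes_on_y_lines[OF pos(2) L2s(7,8) _ v(5,6)] wy[of 0 2] by (simp add: eval_nat_numeral)
  have Y0': "y_lines L B (\<lambda>_ _. True) f (d 0 1)"
    by (rule wdy_imp_y_lines[OF pos(2) f L2s(6) wfy])
  \<comment> \<open>The derived boundary condition u_y = 0 at both ends of the x-lines. The
    identities for u_xxyy and u_xyy and the Wirtinger bound on u_xy all rest on it.\<close>
  have X01: "x_lines L B ?zero (d 0 1) (d 1 1)"
    by (rule x_lines_tangential[OF pos X0 Y0' Y10 X01' f L2s(1,6,10)])
  have ibx: "ip F G' = - ip F' G"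
    if "x_lines L B Q1 F F'" "x_lines L B Q2 G G'" "L2 ?R F" "L2 ?R F'" "L2 ?R G" "L2 ?R G'"
      "\<And>p q r s. Q1 p q \<Longrightarrow> Q2 r s \<Longrightarrow> q * s = p * r" for Q1 Q2 F F' G G'
    unfolding ip_def by (rule x_lines_ibp[OF pos(1) that])
  have iby: "ip F G' = - ip F' G"
    if "y_lines L B Q1 F F'" "y_lines L B Q2 G G'" "L2 ?R F" "L2 ?R F'" "L2 ?R G" "L2 ?R G'"
      "\<And>p q r s. Q1 p q \<Longrightarrow> Q2 r s \<Longrightarrow> q * s = p * r" for Q1 Q2 F F' G G'
    unfolding ip_def by (rule y_lines_ibp[OF pos(2) that])
  have comm: "ip g h = ip h g" for g h by (simp add: ip_def mult.commute)
  have t1: "ip f (d 4 0) = ip (d 2 0) (d 2 0)"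
    using ibx[OF X0 X3 f L2s(1,3,4)] ibx[OF X1 X2 L2s(1,2,2,3)] by simp
  \<comment> \<open>In the second integration by parts the boundary term vanishes thanks to u_yy,
    whereas in the x-direction it was u_x that vanished.\<close>
  have t2: "ip f (d 0 4) = ip (d 0 2) (d 0 2)"
    using iby[OF Y0 Y3 f L2s(6,8,9)] iby[OF Y2 Y1 L2s(7,8,6,7)] comm[of "d 0 1" "d 0 3"] by simp
  \<comment> \<open>One y-derivative is moved first, using u = 0, then one x-derivative, using u_y =
    0 on the x-lines.\<close>
  have t3: "ip f (d 2 2) = ip (d 1 1) (d 1 1)"
    using iby[OF Y0 Y21 f L2s(6,12,13)] ibx[OF X01 X11 L2s(6,10,10,12)] by simp
  have t4: "ip f (d 2 0) = - ip (d 1 0) (d 1 0)"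
    using ibx[OF X0 X1 f L2s(1,1,2)] by simp
  have t5: "ip f (d 0 2) = - ip (d 0 1) (d 0 1)"
    using iby[OF Y0 Y1 f L2s(6,6,7)] by simp
  \<comment> \<open>After one integration by parts the term is, up to sign, the product of u_x with
    its own x-derivative; a second one shows that it equals its negative. The next identity repeats
    this with u_y.\<close>
  have t6: "ip f (d 3 0) = 0"
    using ibx[OF X0 X2 f L2s(1,2,3)] ibx[OF X1 X1 L2s(1,2,1,2)] comm[of "d 2 0" "d 1 0"] by simp
  have t7: "ip f (d 1 2) = 0"
    using iby[OF Y0 Y11 f L2s(6,10,11)] ibx[OF X01 X01 L2s(6,10,6,10)] comm[of "d 1 1" "d 0 1"] by simp
  have t9: "ip f (d 5 0) \<le> 0"
  proof -
    have "ip (d 2 0) (d 3 0) \<le> 0"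
      unfolding ip_def by (rule x_lines_integral_mult_deriv_le[OF pos(1) X2 L2s(2,3)])
    then show ?thesis
      using ibx[OF X0 X4 f L2s(1,4,5)] ibx[OF X1 X3 L2s(1,2,3,4)] comm[of "d 3 0" "d 2 0"] by simp
  qed
  define k where "k = (pi / L)\<^sup>2"
  define l where "l = (pi / B)\<^sup>2"
  define S where "S = ip f f"
  have sq: "(LBINT z:?R. (g z)\<^sup>2) = ip g g" for g by (simp add: ip_def power2_eq_square)
  have kl: "0 \<le> k" "0 \<le> l" "0 \<le> k + l" by (simp_all add: k_def l_def)
  have p1: "k * S \<le> ip (d 1 0) (d 1 0)"
    using x_lines_wirtinger[OF pos(1) X0 f L2s(1)] unfolding sq k_def S_def .
  have p2: "l * S \<le> ip (d 0 1) (d 0 1)"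
    using y_lines_wirtinger[OF pos(2) Y0 f L2s(6)] unfolding sq l_def S_def .
  \<comment> \<open>Wirtinger in x for u_y, followed by Wirtinger in y for u.\<close>
  have p3: "k * l * S \<le> ip (d 1 1) (d 1 1)"
  proof -
    have "k * (l * S) \<le> k * ip (d 0 1) (d 0 1)" using p2 kl(1) by (rule mult_left_mono)
    also have "\<dots> \<le> ip (d 1 1) (d 1 1)"
      using x_lines_wirtinger[OF pos(1) X01 L2s(6,10)] unfolding sq k_def .
    finally show ?thesis by (simp add: mult.assoc)
  qed
  have p4: "k\<^sup>2 * S \<le> ip (d 2 0) (d 2 0)"
    using integral_square_second_deriv_bound[OF f L2s(2) kl(1) t4[unfolded ip_def]] p1
    unfolding sq S_def by (simp add: ip_def)
  have p5: "l\<^sup>2 * S \<le> ip (d 0 2) (d 0 2)"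
    using integral_square_second_deriv_bound[OF f L2s(7) kl(2) t5[unfolded ip_def]] p2
    unfolding sq S_def by (simp add: ip_def)
  define Rest where "Rest z = f z * d 5 0 z - f z * w z - (f z * d 4 0 z + 2 * (f z * d 2 2 z) + f z * d 0 4 z)
    - \<gamma> * (f z * d 2 0 z + f z * d 0 2 z) - (f z * d 3 0 z + f z * d 1 2 z)" for z
  have N_Rest: "AE z\<in>?R in lborel. f z * (f z * d 1 0 z) = Rest z"
    using eq
  proof eventually_elim
    case (elim z)
    show ?case
    proof
      assume "z \<in> ?R"
      with elim have *: "f z * d 1 0 z = - w z - (d 4 0 z + 2 * d 2 2 z + d 0 4 z) - \<gamma> * (d 2 0 z + d 0 2 z)
        - (d 3 0 z + d 1 2 z) + d 5 0 z" by linarith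
      show "f z * (f z * d 1 0 z) = Rest z"
        unfolding * Rest_def by (simp add: algebra_simps)
    qed
  qed
  note int = L2_mult_integrable[OF f w] L2s[THEN L2_mult_integrable[OF f]]
  have int_Rest: "set_integrable lborel ?R Rest"
    unfolding Rest_def using int
    by (intro set_integral_add(1) set_integral_diff(1) set_integrable_mult_right)
  have int_N: "set_integrable lborel ?R (\<lambda>z. f z * (f z * d 1 0 z))"
  proof (rule set_integrable_bound_real[OF set_integrable_abs[OF int_Rest]])
    show "set_borel_measurable lborel ?R (\<lambda>z. f z * (f z * d 1 0 z))"
      using f L2s(1) by (intro set_borel_measurable_mult L2_measurable)
  qed (use N_Rest in \<open>auto elim: eventually_mono\<close>)
  have "0 = (LBINT z:?R. f z * (f z * d 1 0 z))"
    using x_lines_integral_square_mult_deriv[OF pos(1) X0 int_N] by simp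
  also have "\<dots> = (LBINT z:?R. Rest z)"
    by (rule set_integral_cong_AE2[OF _ _ N_Rest])
      (use int_N int_Rest in \<open>auto intro: set_integrable_measurable\<close>)
  also have "\<dots> = ip f (d 5 0) - ip f w - (ip f (d 4 0) + 2 * ip f (d 2 2) + ip f (d 0 4)) - \<gamma> * (ip f (d 2 0) + ip f (d 0 2))
      - (ip f (d 3 0) + ip f (d 1 2))"
    unfolding Rest_def ip_def using int by simp
  finally have "ip f w = - (ip (d 2 0) (d 2 0) + 2 * ip (d 1 1) (d 1 1) + ip (d 0 2) (d 0 2))
      + \<gamma> * (ip (d 1 0) (d 1 0) + ip (d 0 1) (d 0 1)) + ip f (d 5 0)"
    unfolding t1 t2 t3 t4 t5 t6 t7 by (simp add: algebra_simps)
  \<comment> \<open>The sign of \<gamma> enters here: multiplication reverses the two lower bounds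
    into an upper bound.\<close>
  moreover have "\<gamma> * (ip (d 1 0) (d 1 0) + ip (d 0 1) (d 0 1)) \<le> \<gamma> * ((k + l) * S)"
    using p1 p2 \<gamma> by (intro mult_left_mono_neg) (auto simp: algebra_simps)
  \<comment> \<open>The three second-order bounds are exactly the terms of this square.\<close>
  moreover have "(k + l)\<^sup>2 * S = k\<^sup>2 * S + 2 * (k * l * S) + l\<^sup>2 * S"
    by (simp add: power2_eq_square algebra_simps)
  ultimately have "ip f w \<le> - ((k + l)\<^sup>2 * S) + \<gamma> * ((k + l) * S)"
    using p3 p4 p5 t9 by linarith
  also have "\<dots> = - ((k + l)\<^sup>2 - \<gamma> * (k + l)) * S" by (simp add: algebra_simps)
  finally show ?thesis by (simp add: sq S_def k_def l_def flip: ip_def)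
qed

section \<open>Evolution of the energy\<close>

lemma set_integral_slices_fst:
  fixes f :: "'a::euclidean_space \<times> 'b::euclidean_space \<Rightarrow> real"
  assumes f: "set_integrable lborel (X \<times> Z) f"
  shows "AE x\<in>X in lborel. set_integrable lborel Z (\<lambda>z. f (x, z))"
    and "set_integrable lborel X (\<lambda>x. LBINT z:Z. f (x, z))"
    and "(LBINT p:X \<times> Z. f p) = (LBINT x:X. LBINT z:Z. f (x, z))"
proof -
  have i: "integrable (lborel \<Otimes>\<^sub>M lborel) (\<lambda>(x, z). indicator X x * (indicator Z z * f (x, z)))"
    using f by (simp add: set_integrable_def lborel_prod indicator_times case_prod_unfold mult.assoc)
  have "AE x in lborel. integrable lborel (\<lambda>z. indicator X x * (indicator Z z * f (x, z)))"
    by (rule lborel_pair.AE_integrable_fst[OF i])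
  then show "AE x\<in>X in lborel. set_integrable lborel Z (\<lambda>z. f (x, z))"
    by eventually_elim (auto simp: set_integrable_def)
  have eq: "(LBINT z. indicator X x * (indicator Z z * f (x, z))) = indicator X x *\<^sub>R (LBINT z:Z. f (x, z))"
    for x by (simp add: set_lebesgue_integral_def)
  show "set_integrable lborel X (\<lambda>x. LBINT z:Z. f (x, z))"
    unfolding set_integrable_def eq[symmetric] by (rule lborel_pair.integrable_fst[OF i])
  have "(LBINT p:X \<times> Z. f p) = (\<integral>(x, z). indicator X x * (indicator Z z * f (x, z)) \<partial>(lborel \<Otimes>\<^sub>M lborel))"
    by (simp add: set_lebesgue_integral_def lborel_prod indicator_times case_prod_unfold mult.assoc)
  also have "\<dots> = (LBINT x. LBINT z. indicator X x * (indicator Z z * f (x, z)))"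
    by (rule lborel_pair.integral_fst[OF i, symmetric])
  finally show "(LBINT p:X \<times> Z. f p) = (LBINT x:X. LBINT z:Z. f (x, z))"
    unfolding eq set_lebesgue_integral_def .
qed

lemma AE_slices_fst:
  fixes P :: "'a::euclidean_space \<times> 'b::euclidean_space \<Rightarrow> bool"
  assumes "AE p in lborel. P p"
  shows "AE x in lborel. AE z in lborel. P (x, z)"
  using lborel_pair.AE_pair[of P] assms unfolding lborel_prod by simp

lemma AE_from_slices_fst:
  fixes P :: "'a::euclidean_space \<times> 'b::euclidean_space \<Rightarrow> bool"
  assumes m: "{p. P p} \<in> sets borel" and "AE x in lborel. AE z in lborel. P (x, z)"
  shows "AE p in lborel. P p"
proof -
  have "{p \<in> space (lborel \<Otimes>\<^sub>M (lborel :: 'b measure)). P p} \<in> sets (lborel \<Otimes>\<^sub>M lborel)"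
    unfolding lborel_prod using m by simp
  from lborel_pair.AE_pair_measure[OF this assms(2)] show ?thesis unfolding lborel_prod .
qed

lemma has_weak_deriv_Nil_AE_eq:
  assumes "open \<Omega>" "has_weak_deriv \<Omega> [] f g"
  shows "AE z\<in>\<Omega> in lborel. f z = g z"
proof -
  have "has_weak_deriv \<Omega> [] f f"
    using assms(2) by (intro has_weak_deriv_refl) (simp add: has_weak_deriv_def)
  then show ?thesis by (rule has_weak_deriv_unique[OF assms(1) _ assms(2)])
qed

text \<open>The theorem on lines, applied to functions that are constant in an auxiliary variable
  from (0, 1); any one of the good lines then gives the claim.\<close>

lemma weak_deriv_imp_ac_on:
  fixes f g :: "real \<Rightarrow> real"
  assumes "a < b" and f: "set_integrable lborel {a<..<b} f" and g: "set_integrable lborel {a<..<b} g"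
    and weak: "\<And>\<theta>. test_function {a<..<b} \<theta> \<Longrightarrow>
      (LBINT t:{a<..<b}. f t * partial_deriv 1 \<theta> t) = - (LBINT t:{a<..<b}. g t * \<theta> t)"
  obtains F where "ac_on a b F g" "AE t in lborel. t \<in> {a<..<b} \<longrightarrow> f t = F t"
proof -
  let ?I = "{a<..<b}" and ?J = "{0<..<1 :: real}"
  have J: "integrable lborel (\<lambda>z. indicator ?J z :: real)" by (rule integrable_real_indicator) auto
  have int: "set_integrable lborel (?I \<times> ?J) (\<lambda>p. h (fst p))" if "set_integrable lborel ?I h" for h :: "real \<Rightarrow> real"
  proof -
    have "integrable lborel (tensor (\<lambda>x. indicator ?I x *\<^sub>R h x) (\<lambda>z. indicator ?J z))"
      using that J by (intro integrable_tensor) (simp_all add: set_integrable_def)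
    moreover have "tensor (\<lambda>x. indicator ?I x *\<^sub>R h x) (\<lambda>z. indicator ?J z) = (\<lambda>p. indicator (?I \<times> ?J) p *\<^sub>R h (fst p))"
      by (auto simp: fun_eq_iff split: split_indicator)
    ultimately show ?thesis by (simp only: set_integrable_def)
  qed
  have "AE z\<in>?J in lborel. (\<exists>F. ac_on a b F (\<lambda>x. g (fst (x, z))) \<and>
      (AE x\<in>?I in lborel. f (fst (x, z)) = F x))"
  proof (rule weak_deriv_imp_ac_on_lines[OF \<open>a < b\<close> _ int[OF f] int[OF g]])
    fix \<theta> \<psi> assume t: "test_function ?I \<theta>" "test_function ?J \<psi>"
    have i: "set_integrable lborel (?I \<times> ?J) (\<lambda>p. h (fst p) * tensor \<xi> \<psi> p)"
      if "set_integrable lborel ?I h" "test_function ?I \<xi>" for h \<xi>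
      using set_integrable_mult_test_function[OF int[OF that(1)] _ test_function_tensor[OF that(2) t(2)]]
      by (simp add: mult.commute borel_open open_Times)
    have e: "(LBINT p:?I \<times> ?J. h (fst p) * tensor \<xi> \<psi> p) = (LBINT x:?I. h x * \<xi> x) * (LBINT z:?J. \<psi> z)"
      if "set_integrable lborel ?I h" "test_function ?I \<xi>" for h \<xi>
      using set_integral_slices(3)[OF i[OF that]] by (simp add: mult.assoc[symmetric])
    have "test_function ?I (partial_deriv 1 \<theta>)" using t(1) by (rule test_function_partial_deriv) simp
    then show "(LBINT p:?I \<times> ?J. f (fst p) * tensor (partial_deriv 1 \<theta>) \<psi> p)
        = - (LBINT p:?I \<times> ?J. g (fst p) * tensor \<theta> \<psi> p)"
      using weak[OF t(1)] by (simp add: e f g t(1))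
  qed simp
  then have "\<exists>F. ac_on a b F g \<and> (AE x\<in>?I in lborel. f x = F x)"
    by (rule AE_Ioo_witness) simp_all
  then show thesis using that by blast
qed

text \<open>The weak derivative of \<open>\<integral> u\<^sup>2\<close> is computed on almost every line in \<open>t\<close> and then integrated over
  \<open>z\<close>, so that joint measurability of the absolutely continuous representatives is not an issue.\<close>

lemma integral_square_ac_on:
  fixes u w :: "real \<times> 'b::euclidean_space \<Rightarrow> real"
  assumes "0 < T" "open Z" and fin: "emeasure lborel ({0<..<T} \<times> Z) < \<infinity>"
    and L2: "L2 ({0<..<T} \<times> Z) u" "L2 ({0<..<T} \<times> Z) w"
    and wd: "has_weak_deriv ({0<..<T} \<times> Z) [(1, 0)] u w"
  obtains F where "ac_on 0 T F (\<lambda>t. 2 * (LBINT z:Z. u (t, z) * w (t, z)))"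
    "AE t in lborel. t \<in> {0<..<T} \<longrightarrow> (LBINT z:Z. (u (t, z))\<^sup>2) = F t"
proof -
  let ?I = "{0<..<T}" and ?\<Omega> = "{0<..<T} \<times> Z"
  have m: "?\<Omega> \<in> sets borel" using \<open>open Z\<close> by (intro borel_open open_Times) auto
  have lines: "AE z\<in>Z in lborel.
      (\<exists>F. ac_on 0 T F (\<lambda>t. w (t, z)) \<and> (AE t\<in>?I in lborel. u (t, z) = F t))"
  proof (rule weak_deriv_imp_ac_on_lines[OF \<open>0 < T\<close> \<open>open Z\<close>])
    show "set_integrable lborel ?\<Omega> u" "set_integrable lborel ?\<Omega> w"
      using L2 m fin by (auto intro: L2_imp_set_integrable)
    fix \<theta> \<psi> assume t: "test_function ?I \<theta>" "test_function Z \<psi>"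
    have "partial_derivs [(1, 0)] (tensor \<theta> \<psi>) = tensor (partial_deriv 1 \<theta>) \<psi>"
      using t by (simp add: partial_deriv_tensor test_function_smooth)
    then show "(LBINT p:?\<Omega>. u p * tensor (partial_deriv 1 \<theta>) \<psi> p) = - (LBINT p:?\<Omega>. w p * tensor \<theta> \<psi> p)"
      using wd test_function_tensor[OF t] unfolding has_weak_deriv_def by force
  qed
  have int_u: "set_integrable lborel ?\<Omega> (\<lambda>p. (u p)\<^sup>2)" using L2 by (intro L2_square_integrable)
  have int_w: "set_integrable lborel ?\<Omega> (\<lambda>p. u p * w p)" using L2 by (intro L2_mult_integrable)
  have int_\<theta>: "set_integrable lborel ?\<Omega> (\<lambda>p. h p * \<theta> (fst p))"
    if h: "set_integrable lborel ?\<Omega> h" and \<theta>: "test_function ?I \<theta>" for h \<theta>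
  proof -
    obtain C where "\<And>x. \<bar>\<theta> x\<bar> \<le> C" using test_function_bounded[OF \<theta>] by blast
    moreover have "set_borel_measurable lborel ?\<Omega> (\<lambda>p. \<theta> (fst p))"
    proof -
      have "continuous_on UNIV (\<lambda>p :: real \<times> 'b. \<theta> (fst p))"
        using smooth_imp_continuous[OF test_function_smooth[OF \<theta>], of UNIV]
        by (rule continuous_on_compose2) (auto intro: continuous_intros)
      then have "(\<lambda>p :: real \<times> 'b. \<theta> (fst p)) \<in> borel_measurable borel"
        by (rule borel_measurable_continuous_onI)
      then show ?thesis using m unfolding set_borel_measurable_def by measurable
    qed
    ultimately have "set_integrable lborel ?\<Omega> (\<lambda>p. \<theta> (fst p) * h p)"
      using h m by (intro set_integrable_bounded_mult[of _ _ _ C]) auto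
    then show ?thesis by (simp add: mult.commute)
  qed
  have weak: "(LBINT t:?I. (LBINT z:Z. (u (t, z))\<^sup>2) * partial_deriv 1 \<theta> t)
      = - (LBINT t:?I. (2 * (LBINT z:Z. u (t, z) * w (t, z))) * \<theta> t)"
    if \<theta>: "test_function ?I \<theta>" for \<theta>
  proof -
    have \<theta>': "test_function ?I (partial_deriv 1 \<theta>)" using \<theta> by (rule test_function_partial_deriv) simp
    note i1 = int_\<theta>[OF int_u \<theta>'] and i2 = int_\<theta>[OF set_integrable_mult_right[OF int_w, of 2] \<theta>]
    have "(LBINT t:?I. (LBINT z:Z. (u (t, z))\<^sup>2) * partial_deriv 1 \<theta> t)
        = (LBINT p:?\<Omega>. (u p)\<^sup>2 * partial_deriv 1 \<theta> (fst p))"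
      using set_integral_slices_fst(3)[OF i1] by simp
    \<comment> \<open>Fubini exchanges the order, so that t runs along the lines on which
      \<open>u\<close> is absolutely continuous.\<close>
    also have "\<dots> = (LBINT z:Z. LBINT t:?I. (u (t, z))\<^sup>2 * partial_deriv 1 \<theta> t)"
      using set_integral_slices(3)[OF i1] by simp
    also have "\<dots> = (LBINT z:Z. (- 1) * (LBINT t:?I. (2 * (u (t, z) * w (t, z))) * \<theta> t))"
    proof (rule set_integral_cong_AE2)
      show "set_borel_measurable lborel Z (\<lambda>z. LBINT t:?I. (u (t, z))\<^sup>2 * partial_deriv 1 \<theta> t)"
        using set_integral_slices(2)[OF i1] by (intro set_integrable_measurable) simp
      show "set_borel_measurable lborel Z (\<lambda>z. (- 1) * (LBINT t:?I. (2 * (u (t, z) * w (t, z))) * \<theta> t))"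
        using set_integrable_mult_right[of "- 1", OF set_integral_slices(2)[OF i2]]
        by (intro set_integrable_measurable) simp
      show "AE z\<in>Z in lborel. (LBINT t:?I. (u (t, z))\<^sup>2 * partial_deriv 1 \<theta> t)
          = (- 1) * (LBINT t:?I. (2 * (u (t, z) * w (t, z))) * \<theta> t)"
        using lines set_integral_slices(1)[OF i1] set_integral_slices(1)[OF i2]
      proof eventually_elim
        case (elim z)
        show ?case
        proof
          assume z: "z \<in> Z"
          with elim obtain F where F: "ac_on 0 T F (\<lambda>t. w (t, z))" "AE t\<in>?I in lborel. u (t, z) = F t"
            by blast
          have i: "set_integrable lborel ?I (\<lambda>t. (u (t, z))\<^sup>2 * partial_deriv 1 \<theta> t)"
            "set_integrable lborel ?I (\<lambda>t. (2 * (u (t, z) * w (t, z))) * \<theta> t)"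
            using elim z by auto
          note FF\<theta> = ac_on_mult[OF ac_on_mult[OF F(1) F(1)] smooth_ac_on[OF test_function_smooth[OF \<theta>]]]
          have "0 = (LBINT t:?I. (w (t, z) * F t + F t * w (t, z)) * \<theta> t + F t * F t * partial_deriv 1 \<theta> t)"
            using ac_onD(2)[OF FF\<theta>, of T] test_function_eq_0[OF \<theta>, of 0] test_function_eq_0[OF \<theta>, of T] \<open>0 < T\<close>
            by simp
          also have "\<dots> = (LBINT t:?I. (2 * (u (t, z) * w (t, z))) * \<theta> t + (u (t, z))\<^sup>2 * partial_deriv 1 \<theta> t)"
          proof (rule set_integral_cong_AE2)
            show "AE t\<in>?I in lborel. (w (t, z) * F t + F t * w (t, z)) * \<theta> t + F t * F t * partial_deriv 1 \<theta> t
                = (2 * (u (t, z) * w (t, z))) * \<theta> t + (u (t, z))\<^sup>2 * partial_deriv 1 \<theta> t"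
              using F(2) by eventually_elim (auto simp: power2_eq_square algebra_simps)
            show "set_borel_measurable lborel ?I (\<lambda>t. (2 * (u (t, z) * w (t, z))) * \<theta> t + (u (t, z))\<^sup>2 * partial_deriv 1 \<theta> t)"
              using i by (intro set_integrable_measurable set_integral_add)
          qed (rule set_integrable_measurable[OF ac_onD(1)[OF FF\<theta>]])
          also have "\<dots> = (LBINT t:?I. (2 * (u (t, z) * w (t, z))) * \<theta> t) + (LBINT t:?I. (u (t, z))\<^sup>2 * partial_deriv 1 \<theta> t)"
            using i(2,1) by (rule set_integral_add(2))
          finally show "(LBINT t:?I. (u (t, z))\<^sup>2 * partial_deriv 1 \<theta> t)
            = (- 1) * (LBINT t:?I. (2 * (u (t, z) * w (t, z))) * \<theta> t)" by linarith
        qed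
      qed
    qed
    also have "\<dots> = - (LBINT z:Z. LBINT t:?I. (2 * (u (t, z) * w (t, z))) * \<theta> t)"
      by (simp only: set_integral_mult_right)
    also have "\<dots> = - (LBINT p:?\<Omega>. (2 * (u p * w p)) * \<theta> (fst p))"
      using set_integral_slices(3)[OF i2] by simp
    also have "\<dots> = - (LBINT t:?I. (2 * (LBINT z:Z. u (t, z) * w (t, z))) * \<theta> t)"
      using set_integral_slices_fst(3)[OF i2] by simp
    finally show ?thesis .
  qed
  have "set_integrable lborel ?I (\<lambda>t. LBINT z:Z. (u (t, z))\<^sup>2)"
    "set_integrable lborel ?I (\<lambda>t. 2 * (LBINT z:Z. u (t, z) * w (t, z)))"
    using set_integral_slices_fst(2)[OF int_u] set_integral_slices_fst(2)[OF int_w] by auto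
  from weak_deriv_imp_ac_on[OF \<open>0 < T\<close> this weak] that show thesis by blast
qed

text \<open>With v = u(s) - u(t) the squares differ by |v|^2 plus twice the product of v and u(t),
  and \<open>L2_abs_mult_bound\<close> controls the latter by the norm of v.\<close>

lemma L2_norm_square_tendsto:
  assumes u: "L2 \<Omega> (u t)" "\<And>s. s \<in> S \<Longrightarrow> L2 \<Omega> (u s)"
    and lim: "((\<lambda>s. L2_norm \<Omega> (\<lambda>z. u s z - u t z)) \<longlongrightarrow> 0) (at t within S)"
  shows "((\<lambda>s. (L2_norm \<Omega> (u s))\<^sup>2) \<longlongrightarrow> (L2_norm \<Omega> (u t))\<^sup>2) (at t within S)"
proof -
  let ?d = "\<lambda>s. L2_norm \<Omega> (\<lambda>z. u s z - u t z)"
  have bound: "\<bar>(L2_norm \<Omega> (u s))\<^sup>2 - (L2_norm \<Omega> (u t))\<^sup>2\<bar> \<le> (?d s)\<^sup>2 + ?d s * (1 + (L2_norm \<Omega> (u t))\<^sup>2)"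
    if "s \<in> S" for s
  proof -
    define v where "v z = u s z - u t z" for z
    have v: "L2 \<Omega> v" unfolding v_def using u that by (intro L2_diff)
    have "(LBINT z:\<Omega>. (u s z)\<^sup>2) = (LBINT z:\<Omega>. (u t z)\<^sup>2 + (v z)\<^sup>2 + 2 * (v z * u t z))"
      by (simp add: v_def power2_eq_square algebra_simps)
    also have "\<dots> = (LBINT z:\<Omega>. (u t z)\<^sup>2) + (LBINT z:\<Omega>. (v z)\<^sup>2) + 2 * (LBINT z:\<Omega>. v z * u t z)"
      using L2_square_integrable[OF u(1)] L2_square_integrable[OF v] L2_mult_integrable[OF v u(1)] by simp
    finally have "(L2_norm \<Omega> (u s))\<^sup>2 - (L2_norm \<Omega> (u t))\<^sup>2 = (L2_norm \<Omega> v)\<^sup>2 + 2 * (LBINT z:\<Omega>. v z * u t z)"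
      by (simp add: L2_norm_square)
    moreover have "\<bar>LBINT z:\<Omega>. v z * u t z\<bar> \<le> (LBINT z:\<Omega>. \<bar>v z * u t z\<bar>)"
      using set_integral_norm_bound[OF L2_mult_integrable[OF v u(1)]] by simp
    ultimately show ?thesis
      using L2_abs_mult_bound[OF v u(1)] zero_le_power2[of "L2_norm \<Omega> v"] unfolding v_def by linarith
  qed
  have "((\<lambda>s. (?d s)\<^sup>2 + ?d s * (1 + (L2_norm \<Omega> (u t))\<^sup>2)) \<longlongrightarrow> 0\<^sup>2 + 0 * (1 + (L2_norm \<Omega> (u t))\<^sup>2)) (at t within S)"
    by (intro tendsto_intros lim)
  then have "((\<lambda>s. (L2_norm \<Omega> (u s))\<^sup>2 - (L2_norm \<Omega> (u t))\<^sup>2) \<longlongrightarrow> 0) (at t within S)"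
    by (rule Lim_null_comparison[rotated, OF tendsto_eq_rhs])
      (use bound in \<open>auto simp: eventually_at_filter\<close>)
  then show ?thesis by (simp add: Lim_null[symmetric])
qed

text \<open>Since \<open>N\<close> is nonincreasing, \<open>N' \<le> -c N\<close> gives \<open>N(t) (1 + c (t - s)) \<le> N(s)\<close>, and the exponential
  bound follows by iterating this \<open>n\<close> times with step \<open>t / n\<close>.\<close>

lemma exp_decay:
  fixes N M :: "real \<Rightarrow> real"
  assumes "0 \<le> c" and nonneg: "\<And>t. 0 \<le> t \<Longrightarrow> 0 \<le> N t" and cont: "continuous_on {0..} N"
    and loc: "\<And>T. 0 < T \<Longrightarrow> \<exists>F M. ac_on 0 T F M \<and>
      (AE t in lborel. t \<in> {0<..<T} \<longrightarrow> N t = F t) \<and> (AE t in lborel. t \<in> {0<..<T} \<longrightarrow> M t \<le> - c * N t)"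
    and "0 \<le> t"
  shows "N t \<le> N 0 * exp (- c * t)"
proof -
  \<comment> \<open>An inequality valid for good times extends to all times, since \<open>N\<close>
    is continuous and good times are dense. It is applied with \<kappa> = 0 for monotonicity and
    with \<kappa> = c for the decay.\<close>
  have ext: "h s t \<le> 0"
    if h: "\<And>s' t'. s' < t' \<Longrightarrow> s' \<in> G \<Longrightarrow> t' \<in> G \<Longrightarrow> h s' t' \<le> 0" and G: "G \<subseteq> {0<..<T}"
      and AE_G: "AE t in lborel. t \<in> {0<..<T} \<longrightarrow> t \<in> G"
      and hN: "\<And>s t. h s t = N t * (1 + \<kappa> * (t - s)) - N s" and st: "0 \<le> s" "s < t" "t \<le> T"
    for h :: "real \<Rightarrow> real \<Rightarrow> real" and G T s t \<kappa>
  proof -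
    \<comment> \<open>Good times are picked to the right of \<open>s\<close> and to the left of
      \<open>t\<close>, so they stay inside the interval even if \<open>s = 0\<close> or
      \<open>t = T\<close>. The factor 2 keeps the two sequences on either side of the
      midpoint.\<close>
    define \<delta> where "\<delta> n = (t - s) / (2 * real (Suc n))" for n
    have e: "0 < \<delta> n" "\<delta> n \<le> (t - s) / 2" for n
    proof -
      show "0 < \<delta> n" using st by (simp add: \<delta>_def)
      show "\<delta> n \<le> (t - s) / 2" unfolding \<delta>_def using st by (intro divide_left_mono) auto
    qed
    have e0: "\<delta> \<longlonglongrightarrow> 0"
      unfolding \<delta>_def by real_asymp
    have "\<exists>s'. s' \<in> {s<..<s + \<delta> n} \<and> s' \<in> G" for n
    proof -
      have sub: "{s<..<s + \<delta> n} \<subseteq> {0<..<T}" using st e[of n] by auto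
      have "AE s' in lborel. s' \<in> {s<..<s + \<delta> n} \<longrightarrow> s' \<in> G"
        using AE_G by eventually_elim (use sub in blast)
      then show ?thesis by (rule AE_Ioo_witness) (use e[of n] in auto)
    qed
    then obtain S where S: "\<And>n. S n \<in> {s<..<s + \<delta> n}" "\<And>n. S n \<in> G" by metis
    have "\<exists>t'. t' \<in> {t - \<delta> n<..<t} \<and> t' \<in> G" for n
    proof -
      have sub: "{t - \<delta> n<..<t} \<subseteq> {0<..<T}" using st e[of n] by auto
      have "AE t' in lborel. t' \<in> {t - \<delta> n<..<t} \<longrightarrow> t' \<in> G"
        using AE_G by eventually_elim (use sub in blast)
      then show ?thesis by (rule AE_Ioo_witness) (use e[of n] in auto)
    qed
    then obtain U where U: "\<And>n. U n \<in> {t - \<delta> n<..<t}" "\<And>n. U n \<in> G" by metis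
    have lt: "S n < U n" for n using S(1)[of n] U(1)[of n] e[of n] by auto
    have S_lim: "S \<longlonglongrightarrow> s"
    proof (rule tendsto_sandwich[where f = "\<lambda>_. s" and h = "\<lambda>n. s + \<delta> n"])
      show "(\<lambda>n. s + \<delta> n) \<longlonglongrightarrow> s" using tendsto_add[OF tendsto_const[of s] e0] by simp
    qed (use S(1) in \<open>auto intro!: always_eventually simp: less_imp_le\<close>)
    have U_lim: "U \<longlonglongrightarrow> t"
    proof (rule tendsto_sandwich[where f = "\<lambda>n. t - \<delta> n" and h = "\<lambda>_. t"])
      show "(\<lambda>n. t - \<delta> n) \<longlonglongrightarrow> t" using tendsto_diff[OF tendsto_const[of t] e0] by simp
    qed (use U(1) in \<open>auto intro!: always_eventually simp: less_imp_le\<close>)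
    have nn: "0 \<le> S n" "0 \<le> U n" for n
      using S(1)[of n] lt[of n] st by auto
    have NS: "(\<lambda>n. N (S n)) \<longlonglongrightarrow> N s"
      by (rule continuous_on_tendsto_compose[OF cont S_lim]) (use st nn in auto)
    have NU: "(\<lambda>n. N (U n)) \<longlonglongrightarrow> N t"
      by (rule continuous_on_tendsto_compose[OF cont U_lim]) (use st nn in auto)
    have "(\<lambda>n. h (S n) (U n)) \<longlonglongrightarrow> h s t"
      unfolding hN by (intro tendsto_intros NS NU S_lim U_lim)
    then show "h s t \<le> 0"
      by (rule tendsto_upperbound) (use h lt S(2) U(2) in auto)
  qed
  have step: "N t * (1 + c * (t - s)) \<le> N s" if st: "0 \<le> s" "s < t" for s t
  proof -
    have "0 < t" using st by simp
    from loc[OF this] obtain F M where F: "ac_on 0 t F M" "AE r in lborel. r \<in> {0<..<t} \<longrightarrow> N r = F r"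
      and M: "AE r in lborel. r \<in> {0<..<t} \<longrightarrow> M r \<le> - c * N r" by blast
    define G where "G = {r \<in> {0<..<t}. N r = F r}"
    have G: "G \<subseteq> {0<..<t}" "AE r in lborel. r \<in> {0<..<t} \<longrightarrow> r \<in> G"
      using F(2) by (auto simp: G_def elim: eventually_mono)
    have diff: "N t' - N s' = (LBINT r:{s'<..<t'}. M r)" and int: "set_integrable lborel {s'<..<t'} M"
      if "s' < t'" "s' \<in> G" "t' \<in> G" for s' t'
    proof -
      have "F t' - F s' = (LBINT r:{s'<..<t'}. M r)"
        by (rule ac_on_diff[OF F(1)]) (use that in \<open>auto simp: G_def\<close>)
      then show "N t' - N s' = (LBINT r:{s'<..<t'}. M r)" using that by (simp add: G_def)
      show "set_integrable lborel {s'<..<t'} M"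
        using ac_onD(1)[OF F(1)] by (rule set_integrable_subset) (use that in \<open>auto simp: G_def\<close>)
    qed
    have mono: "N t' \<le> N s'" if "0 \<le> s'" "s' < t'" "t' \<le> t" for s' t'
    proof -
      have "N t' * (1 + 0 * (t' - s')) - N s' \<le> 0"
      proof (rule ext[where h = "\<lambda>s t. N t * (1 + 0 * (t - s)) - N s", OF _ G refl that])
        fix s' t' assume a: "s' < t'" "s' \<in> G" "t' \<in> G"
        have "0 \<le> (LBINT r:{s'<..<t'}. - M r)"
        proof (rule set_integral_nonneg_AE)
          show "AE r in lborel. r \<in> {s'<..<t'} \<longrightarrow> 0 \<le> - M r"
            using M
          proof eventually_elim
            case (elim r)
            show ?case
            proof
              assume "r \<in> {s'<..<t'}"
              then have "r \<in> {0<..<t}" using a by (auto simp: G_def)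
              then have "M r \<le> - (c * N r)" "0 \<le> c * N r" using elim nonneg[of r] \<open>0 \<le> c\<close> by auto
              then show "0 \<le> - M r" by linarith
            qed
          qed
        qed
        then show "N t' * (1 + 0 * (t' - s')) - N s' \<le> 0"
          using diff[OF a] int[OF a] by (simp add: set_integral_uminus)
      qed
      then show ?thesis by simp
    qed
    have "N t * (1 + c * (t - s)) - N s \<le> 0"
    proof (rule ext[where h = "\<lambda>s t. N t * (1 + c * (t - s)) - N s", OF _ G refl st order_refl])
      fix s' t' assume a: "s' < t'" "s' \<in> G" "t' \<in> G"
      have "0 \<le> (LBINT r:{s'<..<t'}. - c * N t' - M r)"
      proof (rule set_integral_nonneg_AE)
        show "AE r in lborel. r \<in> {s'<..<t'} \<longrightarrow> 0 \<le> - c * N t' - M r"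
          using M
        proof eventually_elim
          case (elim r)
          show ?case
          proof
            assume r: "r \<in> {s'<..<t'}"
            then have r': "r \<in> {0<..<t}" using a by (auto simp: G_def)
            \<comment> \<open>By monotonicity the integrand is bounded by a constant, the value at
              the right end point.\<close>
            have "N t' \<le> N r" using mono[of r t'] r r' a by (auto simp: G_def)
            then have "c * N t' \<le> c * N r" using \<open>0 \<le> c\<close> by (rule mult_left_mono)
            then show "0 \<le> - c * N t' - M r" using elim r' by auto
          qed
        qed
      qed
      also have "(LBINT r:{s'<..<t'}. - c * N t' - M r) = (LBINT r:{s'<..<t'}. - c * N t') - (LBINT r:{s'<..<t'}. M r)"
        using a int[OF a] by (intro set_integral_diff(2)) (auto simp: set_integrable_def)
      also have "(LBINT r:{s'<..<t'}. - c * N t') = (t' - s') * (- c * N t')"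
        using a by (simp add: set_lebesgue_integral_def)
      finally show "N t' * (1 + c * (t' - s')) - N s' \<le> 0"
        using diff[OF a] by (simp add: algebra_simps)
    qed
    then show ?thesis by simp
  qed
  show ?thesis
  proof (cases "t = 0")
    case False
    with \<open>0 \<le> t\<close> have "0 < t" by simp
    have pow: "N (real j * (t / real n)) * (1 + c * t / real n) ^ j \<le> N 0" if "0 < n" for j n
    proof (induction j)
      case (Suc j)
      have pos: "0 \<le> (1 + c * t / real n) ^ j"
        using \<open>0 \<le> c\<close> \<open>0 < t\<close> by (intro zero_le_power add_nonneg_nonneg) auto
      have "N (real (Suc j) * (t / real n)) * (1 + c * (real (Suc j) * (t / real n) - real j * (t / real n))) \<le> N (real j * (t / real n))"
        using \<open>0 < t\<close> that by (intro step) (auto simp: field_simps)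
      also have "real (Suc j) * (t / real n) - real j * (t / real n) = t / real n"
        by (simp add: algebra_simps add_divide_distrib)
      finally have "N (real (Suc j) * (t / real n)) * (1 + c * t / real n) * (1 + c * t / real n) ^ j
          \<le> N (real j * (t / real n)) * (1 + c * t / real n) ^ j"
        using pos by (intro mult_right_mono) auto
      with Suc show ?case by (simp add: mult.assoc)
    qed simp
    have "(\<lambda>n. N t * (1 + c * t / real n) ^ n) \<longlonglongrightarrow> N t * exp (c * t)"
      by (intro tendsto_intros tendsto_exp_limit_sequentially)
    moreover have "\<forall>\<^sub>F n in sequentially. N t * (1 + c * t / real n) ^ n \<le> N 0"
      using eventually_gt_at_top[of 0]
    proof eventually_elim
      case (elim n)
      with pow[of n n] show ?case by simp
    qed
    ultimately have "N t * exp (c * t) \<le> N 0"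
      by (rule tendsto_upperbound) simp
    then have "N t \<le> N 0 / exp (c * t)" by (simp add: pos_le_divide_eq)
    then show ?thesis by (simp add: exp_minus divide_inverse)
  qed simp
qed

section \<open>Versions of the solution and of its derivatives\<close>

lemma has_spatial_deriv_spatial_deriv:
  "has_spatial_deriv T \<Omega> bs u v \<Longrightarrow> has_spatial_deriv T \<Omega> bs u (spatial_deriv T \<Omega> bs u)"
  unfolding spatial_deriv_def by (rule someI[where P = "has_spatial_deriv T \<Omega> bs u"])

lemma has_weak_deriv_measurable:
  "open \<Omega> \<Longrightarrow> has_weak_deriv \<Omega> bs f g \<Longrightarrow> set_borel_measurable lborel \<Omega> g"
  "open \<Omega> \<Longrightarrow> has_weak_deriv \<Omega> bs f g \<Longrightarrow> set_borel_measurable lborel \<Omega> f"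
  by (auto simp: has_weak_deriv_def intro: locally_integrable_measurable)

lemma L2_spacetime_slices:
  assumes "open \<Omega>" "has_spatial_deriv T \<Omega> bs u v" "L2_spacetime T \<Omega> v"
  shows "AE t in lborel. t \<in> {0<..<T} \<longrightarrow> has_weak_deriv \<Omega> bs (u t) (v t) \<and> L2 \<Omega> (v t)"
proof -
  have "AE t in lborel. t \<in> {0<..<T} \<longrightarrow> set_integrable lborel \<Omega> (\<lambda>z. (v t z)\<^sup>2)"
    using set_integral_slices_fst(1)[of "{0<..<T}" \<Omega> "\<lambda>p. (case p of (t, z) \<Rightarrow> v t z)\<^sup>2"] assms(3)
    by (simp add: L2_spacetime_def L2_def)
  moreover have "AE t in lborel. t \<in> {0<..<T} \<longrightarrow> has_weak_deriv \<Omega> bs (u t) (v t)"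
    using assms(2) by (simp add: has_spatial_deriv_def)
  ultimately show ?thesis
    by eventually_elim (auto simp: L2_def intro: has_weak_deriv_measurable(1)[OF assms(1)])
qed

text \<open>The solution classes provide some jointly measurable version \<open>v\<close>, equal to
  \<open>u\<close> on almost every time slice. Equality almost everywhere in space-time follows only
  because \<open>u\<close> is jointly measurable too, which the weak time derivative will
  supply.\<close>

lemma L2_spacetime_version:
  fixes u v :: "real \<Rightarrow> 'a::euclidean_space \<Rightarrow> real"
  assumes "open \<Omega>" "has_spatial_deriv T \<Omega> [] u v" "L2_spacetime T \<Omega> v"
    and u: "set_borel_measurable lborel ({0<..<T} \<times> \<Omega>) (\<lambda>(t, z). u t z)"
  shows "L2 ({0<..<T} \<times> \<Omega>) (\<lambda>(t, z). u t z)"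
proof (rule L2_cong_AE[OF assms(3)[unfolded L2_spacetime_def] u])
  let ?\<Omega> = "{0<..<T} \<times> \<Omega>"
  have "AE p in lborel. indicator ?\<Omega> p *\<^sub>R (case p of (t, z) \<Rightarrow> v t z) = indicator ?\<Omega> p *\<^sub>R (case p of (t, z) \<Rightarrow> u t z)"
  proof (rule AE_from_slices_fst)
    have [measurable]: "(\<lambda>p. indicator ?\<Omega> p *\<^sub>R (case p of (t, z) \<Rightarrow> v t z)) \<in> borel_measurable borel"
      "(\<lambda>p. indicator ?\<Omega> p *\<^sub>R (case p of (t, z) \<Rightarrow> u t z)) \<in> borel_measurable borel"
      using u assms(2) by (simp_all add: has_spatial_deriv_def set_borel_measurable_def)
    show "{p. indicator ?\<Omega> p *\<^sub>R (case p of (t, z) \<Rightarrow> v t z) = indicator ?\<Omega> p *\<^sub>R (case p of (t, z) \<Rightarrow> u t z)} \<in> sets borel"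
      by measurable
    have "AE t in lborel. t \<in> {0<..<T} \<longrightarrow> has_weak_deriv \<Omega> [] (u t) (v t)"
      using assms(2) by (simp add: has_spatial_deriv_def)
    then show "AE t in lborel. AE z in lborel. indicator ?\<Omega> (t, z) *\<^sub>R (case (t, z) of (t, z) \<Rightarrow> v t z)
        = indicator ?\<Omega> (t, z) *\<^sub>R (case (t, z) of (t, z) \<Rightarrow> u t z)"
    proof eventually_elim
      case (elim t)
      show ?case
      proof (cases "t \<in> {0<..<T}")
        case True
        with elim have "AE z\<in>\<Omega> in lborel. u t z = v t z"
          using has_weak_deriv_Nil_AE_eq[OF assms(1)] by blast
        then show ?thesis by eventually_elim (auto split: split_indicator)
      qed auto
    qed
  qed
  then show "AE p\<in>?\<Omega> in lborel. (case p of (t, z) \<Rightarrow> v t z) = (case p of (t, z) \<Rightarrow> u t z)"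
    by eventually_elim (auto split: split_indicator_asm)
qed

lemma dxy_multi_indices: "i + j \<le> k \<Longrightarrow> dxy i j \<in> multi_indices k"
  by (auto simp: multi_indices_def dxy_def Basis_prod_def)

lemma Nil_multi_indices: "[] \<in> multi_indices k"
  by (simp add: multi_indices_def)

text \<open>\<open>F\<close> and \<open>M\<close> are the absolutely continuous energy and its
  derivative, twice the integral of u u_t; \<open>energy_estimate\<close> bounds the latter at
  almost every time.\<close>

lemma regular_solution_energy_inequality:
  assumes pos: "0 < L" "0 < B" "0 < T" and \<gamma>: "\<gamma> \<le> 0"
    and sol: "global_regular_solution \<gamma> L B u0 u"
    and c: "c = ((pi / L)\<^sup>2 + (pi / B)\<^sup>2)\<^sup>2 - \<gamma> * ((pi / L)\<^sup>2 + (pi / B)\<^sup>2)"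
  shows "\<exists>F M. ac_on 0 T F M \<and>
    (AE t in lborel. t \<in> {0<..<T} \<longrightarrow> (L2_norm (rect L B) (u t))\<^sup>2 = F t) \<and>
    (AE t in lborel. t \<in> {0<..<T} \<longrightarrow> M t \<le> - (2 * c) * (L2_norm (rect L B) (u t))\<^sup>2)"
proof -
  let ?R = "rect L B" and ?I = "{0<..<T}"
  let ?\<Omega> = "?I \<times> ?R"
  define w where "w = time_deriv T ?R u"
  define sd where "sd i j = spatial_deriv T ?R (dxy i j) u" for i j
  have L2u: "L2 ?R (u t)" if "0 \<le> t" for t
    using sol that by (simp add: global_regular_solution_def Let_def)
  have reg4: "L2_sobolev 4 T ?R u" and reg5: "\<exists>v. has_spatial_deriv T ?R (dxy 5 0) u v \<and> L2_spacetime T ?R v"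
    and td: "\<exists>w. has_time_deriv T ?R u w" and w2: "L2_sobolev 2 T ?R w" and equ: "equation_ae \<gamma> T ?R u"
    and bc: "AE t in lborel. t > 0 \<longrightarrow> boundary_conditions L B (u t)"
    using sol \<open>0 < T\<close> by (simp_all add: global_regular_solution_def Let_def w_def)
  have "has_time_deriv T ?R u w"
    using td unfolding w_def time_deriv_def by (rule someI_ex)
  then have wd: "has_weak_deriv ?\<Omega> [(1, 0)] (\<lambda>(t, z). u t z) (\<lambda>(t, z). w t z)"
    by (simp add: has_time_deriv_def)
  have open_\<Omega>: "open ?\<Omega>" by (intro open_Times open_rect) simp
  obtain uv where uv: "has_spatial_deriv T ?R [] u uv" "L2_spacetime T ?R uv"
    using reg4 Nil_multi_indices unfolding L2_sobolev_def by blast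
  obtain wv where wv: "has_spatial_deriv T ?R [] w wv" "L2_spacetime T ?R wv"
    using w2 Nil_multi_indices unfolding L2_sobolev_def by blast
  have L2\<Omega>: "L2 ?\<Omega> (\<lambda>(t, z). u t z)" "L2 ?\<Omega> (\<lambda>(t, z). w t z)"
    using L2_spacetime_version[OF open_rect uv has_weak_deriv_measurable(2)[OF open_\<Omega> wd]]
      L2_spacetime_version[OF open_rect wv has_weak_deriv_measurable(1)[OF open_\<Omega> wd]] by auto
  have fin: "emeasure lborel ?\<Omega> < \<infinity>"
    unfolding rect_def by (intro emeasure_bounded_finite bounded_Times bounded_Ioo)
  obtain F where F: "ac_on 0 T F (\<lambda>t. 2 * (LBINT z:?R. u t z * w t z))"
    "AE t\<in>?I in lborel. (LBINT z:?R. (u t z)\<^sup>2) = F t"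
    using integral_square_ac_on[OF \<open>0 < T\<close> open_rect fin L2\<Omega> wd] by auto
  let ?good = "\<lambda>i j. i + j \<le> 4 \<or> (i = 5 \<and> j = 0)"
  have ex: "\<exists>v. has_spatial_deriv T ?R (dxy i j) u v \<and> L2_spacetime T ?R v" if "?good i j" for i j
    using that reg4 reg5 dxy_multi_indices unfolding L2_sobolev_def by blast
  \<comment> \<open>There are only countably many index pairs, so a single null set of times serves
    all derivatives.\<close>
  have reg_ae: "AE t in lborel. \<forall>i j. ?good i j \<longrightarrow> t \<in> ?I \<longrightarrow> (\<exists>g. has_weak_deriv ?R (dxy i j) (u t) g \<and> L2 ?R g)"
    unfolding AE_all_countable
  proof (intro allI)
    fix i j
    show "AE t in lborel. ?good i j \<longrightarrow> t \<in> ?I \<longrightarrow> (\<exists>g. has_weak_deriv ?R (dxy i j) (u t) g \<and> L2 ?R g)"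
    proof (cases "?good i j")
      case True
      with ex obtain v where v: "has_spatial_deriv T ?R (dxy i j) u v" "L2_spacetime T ?R v" by blast
      show ?thesis using L2_spacetime_slices[OF open_rect v] by eventually_elim blast
    next
      case False
      then show ?thesis by (intro AE_I2 impI) (rule notE)
    qed
  qed
  have sd_wd: "AE t in lborel. \<forall>i j. ?good i j \<longrightarrow> t \<in> ?I \<longrightarrow>
      has_weak_deriv ?R (dxy i j) (u t) (sd i j t)"
    unfolding AE_all_countable
  proof (intro allI)
    fix i j
    show "AE t in lborel. ?good i j \<longrightarrow> t \<in> ?I \<longrightarrow> has_weak_deriv ?R (dxy i j) (u t) (sd i j t)"
    proof (cases "?good i j")
      case True
      with ex obtain v where "has_spatial_deriv T ?R (dxy i j) u v" by blast
      from has_spatial_deriv_spatial_deriv[OF this] show ?thesis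
        unfolding has_spatial_deriv_def sd_def by (auto elim: eventually_mono)
    next
      case False
      then show ?thesis by (intro AE_I2 impI) (rule notE)
    qed
  qed
  have eq_ae: "AE t in lborel. AE z in lborel. (t, z) \<in> ?\<Omega> \<longrightarrow>
      w t z + (sd 4 0 t z + 2 * sd 2 2 t z + sd 0 4 t z) + \<gamma> * (sd 2 0 t z + sd 0 2 t z) + (sd 3 0 t z + sd 1 2 t z)
      + u t z * sd 1 0 t z - sd 5 0 t z = 0"
    using AE_slices_fst[OF equ[unfolded equation_ae_def Let_def]] unfolding w_def sd_def by simp
  have M: "AE t\<in>?I in lborel. 2 * (LBINT z:?R. u t z * w t z) \<le> - (2 * c) * (L2_norm ?R (u t))\<^sup>2"
    using reg_ae sd_wd eq_ae bc L2_spacetime_slices[OF open_rect wv]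
  proof eventually_elim
    case (elim t)
    show ?case
    proof
      assume t: "t \<in> ?I"
      define d where "d i j = weak_deriv ?R (dxy i j) (u t)" for i j
      \<comment> \<open>Square integrability in space-time is known for the version
        \<open>wv\<close>; at the present time it agrees almost everywhere with the chosen time
        derivative.\<close>
      have wt: "L2 ?R (w t)"
      proof -
        have v: "has_weak_deriv ?R [] (w t) (wv t)" "L2 ?R (wv t)" using elim t by auto
        show ?thesis
        proof (rule L2_cong_AE[OF v(2) has_weak_deriv_measurable(2)[OF open_rect v(1)]])
          show "AE z\<in>?R in lborel. wv t z = w t z"
            using has_weak_deriv_Nil_AE_eq[OF open_rect v(1)] by eventually_elim auto
        qed
      qed
      have reg: "\<exists>g. has_weak_deriv ?R (dxy i j) (u t) g \<and> L2 ?R g" if "?good i j" for i j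
        using elim t that by blast
      \<comment> \<open>Here the choice made in space-time meets the choice made for the fixed time:
        both are weak derivatives of \<open>u t\<close>.\<close>
      have sd_d: "AE z in lborel. \<forall>i j. ?good i j \<longrightarrow> z \<in> ?R \<longrightarrow> sd i j t z = d i j z"
        unfolding AE_all_countable
      proof (intro allI)
        fix i j
        show "AE z in lborel. ?good i j \<longrightarrow> z \<in> ?R \<longrightarrow> sd i j t z = d i j z"
        proof (cases "?good i j")
          case True
          then have "has_weak_deriv ?R (dxy i j) (u t) (sd i j t)"
            using elim t by blast
          then have "AE z\<in>?R in lborel. sd i j t z = d i j z"
            unfolding d_def using has_weak_deriv_unique[OF open_rect] has_weak_deriv_weak_deriv by blast
          then show ?thesis by eventually_elim blast
        next
          case False
          then show ?thesis by (intro AE_I2 impI) (rule notE)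
        qed
      qed
      have "AE z\<in>?R in lborel. w t z + (d 4 0 z + 2 * d 2 2 z + d 0 4 z) + \<gamma> * (d 2 0 z + d 0 2 z)
          + (d 3 0 z + d 1 2 z) + u t z * d 1 0 z - d 5 0 z = 0"
        using elim(3) sd_d
      proof eventually_elim
        case (elim z)
        show ?case
        proof
          assume z: "z \<in> ?R"
          have "sd i j t z = d i j z" if "?good i j" for i j
            using elim(2) z that by blast
          note s = this[of 4 0] this[of 2 2] this[of 0 4] this[of 2 0] this[of 0 2] this[of 3 0] this[of 1 2]
            this[of 1 0] this[of 5 0]
          have "(t, z) \<in> ?\<Omega>" using t z by simp
          with elim(1) s show "w t z + (d 4 0 z + 2 * d 2 2 z + d 0 4 z) + \<gamma> * (d 2 0 z + d 0 2 z)
            + (d 3 0 z + d 1 2 z) + u t z * d 1 0 z - d 5 0 z = 0"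
            by simp
        qed
      qed
      then have "(LBINT z:?R. u t z * w t z) \<le> - c * (LBINT z:?R. (u t z)\<^sup>2)"
        unfolding c d_def using elim t by (intro energy_estimate[OF pos(1,2) \<gamma> L2u wt reg]) auto
      then show "2 * (LBINT z:?R. u t z * w t z) \<le> - (2 * c) * (L2_norm ?R (u t))\<^sup>2"
        by (simp add: L2_norm_square)
    qed
  qed
  show ?thesis
    using F M unfolding L2_norm_square by blast
qed

theorem theorem6p2:
  fixes \<gamma> L B a chi :: real
    and u0 :: "real \<times> real \<Rightarrow> real"
    and u :: "real \<Rightarrow> real \<times> real \<Rightarrow> real"
  assumes "\<gamma> \<le> 0" and "L > 0" and "B > 0"
    and "a = pi\<^sup>2 / B\<^sup>2 + pi\<^sup>2 / L\<^sup>2"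
    and "chi = 2 * (\<bar>\<gamma>\<bar> / a + 1) * a\<^sup>2"
    and "sobolev 4 (rect L B) u0"
    and "\<exists>g. has_weak_deriv (rect L B) (dxy 5 0) u0 g \<and> L2 (rect L B) g"
    and "boundary_conditions L B u0"
    and "J_w L B u0 < \<infinity>"
    and "global_regular_solution \<gamma> L B u0 u"
  shows "\<forall>t\<ge>0. (L2_norm (rect L B) (u t))\<^sup>2 \<le> (L2_norm (rect L B) u0)\<^sup>2 * exp (- chi * t)"
proof (intro allI impI)
  fix t :: real assume "t \<ge> 0"
  let ?R = "rect L B"
  define N where "N t = (L2_norm ?R (u t))\<^sup>2" for t
  have a: "a = (pi / L)\<^sup>2 + (pi / B)\<^sup>2"
    using assms(4) by (simp add: power_divide)
  have "a > 0" unfolding a using assms(2,3) by (intro add_pos_pos) auto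
  \<comment> \<open>Since \<gamma> is not positive, \<open>chi\<close> becomes twice the constant of
    \<open>energy_estimate\<close>, the factor 2 coming from the time derivative of a
    square.\<close>
  have "\<bar>\<gamma>\<bar> / a * a = - \<gamma>" using assms(1) \<open>a > 0\<close> by simp
  moreover have "chi = 2 * (\<bar>\<gamma>\<bar> / a * a * a + a\<^sup>2)"
    unfolding assms(5) power2_eq_square by (simp only: distrib_left distrib_right mult.assoc mult_1)
  ultimately have chi: "chi = 2 * (a\<^sup>2 - \<gamma> * a)" by simp
  have "\<gamma> * a \<le> a\<^sup>2"
    by (rule order_trans[OF mult_nonpos_nonneg zero_le_power2]) (use assms(1) \<open>a > 0\<close> in simp_all)
  then have "chi \<ge> 0" by (simp add: chi)
  have sol: "L2 ?R (u t)" "((\<lambda>s. L2_norm ?R (\<lambda>z. u s z - u t z)) \<longlongrightarrow> 0) (at t within {0..})" if "0 \<le> t" for t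
    using assms(10) that by (simp_all add: global_regular_solution_def Let_def)
  have cont: "continuous_on {0..} N"
    unfolding continuous_on_def N_def using sol by (auto intro!: L2_norm_square_tendsto)
  have "N t \<le> N 0 * exp (- chi * t)"
  proof (rule exp_decay[OF \<open>chi \<ge> 0\<close> _ cont])
    fix T :: real assume "0 < T"
    show "\<exists>F M. ac_on 0 T F M \<and> (AE t in lborel. t \<in> {0<..<T} \<longrightarrow> N t = F t) \<and>
        (AE t in lborel. t \<in> {0<..<T} \<longrightarrow> M t \<le> - chi * N t)"
      using regular_solution_energy_inequality[OF assms(2,3) \<open>0 < T\<close> assms(1,10) refl]
      unfolding N_def chi a .
  qed (use \<open>t \<ge> 0\<close> in \<open>auto simp: N_def\<close>)
  \<comment> \<open>The initial condition holds only almost everywhere, so the norms are compared as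
    integrals; measurability of \<open>u0\<close> comes from the order-zero part of its Sobolev
    regularity.\<close>
  moreover have "N 0 = (L2_norm ?R u0)\<^sup>2"
  proof -
    obtain g where "has_weak_deriv ?R [] u0 g"
      using assms(6) Nil_multi_indices unfolding sobolev_def by blast
    then have "set_borel_measurable lborel ?R u0"
      by (rule has_weak_deriv_measurable(2)[OF open_rect])
    moreover have "AE z\<in>?R in lborel. u 0 z = u0 z"
      using assms(10) by (simp add: global_regular_solution_def Let_def)
    ultimately have "L2_norm ?R (u 0) = L2_norm ?R u0"
      using L2_measurable[OF sol(1)[of 0]] by (intro L2_norm_cong_AE) auto
    then show ?thesis by (simp add: N_def)
  qed
  ultimately show "(L2_norm ?R (u t))\<^sup>2 \<le> (L2_norm ?R u0)\<^sup>2 * exp (- chi * t)"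
    by (simp add: N_def)
qed

end
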